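(* For every $\epsilon>0$ there is a constant $C(\epsilon)>0$ with the property that in any dimension $d\in\mathbb{Z}^+$, and for any convex body $K$ in $\mathbb{R}^d$ containing the origin in its interior, at least one of the following two statements holds: (i) there is an $m$-dimensional linear subspace $H$ of $\mathbb{R}^d$ such that $d(H\cap K,\mathbf{B}_2^m)<1+\epsilon$, for some $m$ satisfying $\ln\ln m\geq \frac{1}{2}\ln\ln d$, or (ii) there is an $m$-dimensional linear subspace $H$ of $\mathbb{R}^d$ such that $d(H\cap K,\mathbf{B}_\infty^m)<1+\epsilon$, for some $m$ satisfying $\ln\ln m\geq \frac{1}{2}\ln\ln d - C(\epsilon)$.
   Context: A convex body in $\mathbb{R}^d$ is a compact convex set with non-empty interior. For $p=1,2,\infty$, $\mathbf{B}_p^d$ denotes the closed unit ball of $\ell_p^d$ centered at the origin. For convex bodies $K$ and $L$ in $\mathbb{R}^d$ with $L=-L$, their distance is $$d(K,L)=\inf\{\lambda>0 : L\subset T(K-a)\subset \lambda L \text{ for some } a\in\mathbb{R}^d \text{ and } T\in GL(\mathbb{R}^d)\}.$$ The distance $d(H\cap K,\mathbf{B}_p^m)$ is this distance taken in dimension $m$, with the $m$-dimensional subspace $H$ identified with $\mathbb{R}^m$ by a linear isomorphism (the value does not depend on the choice).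
   Formalization: The undefined value ln ln 1 is taken to be 0 (and m ≥ 1 required), so m = 1 is admitted for d bounded in terms of C(ε); with ln ln 1 = −∞ the claim fails, e.g. for d = 2, K a disc and small ε. *)

theory Defs
  imports "HOL-Analysis.Analysis" "HOL-Library.Function_Algebras"
begin

text \<open>
  The dimension is quantified inside the scope of the constant \<open>C\<close>, so \<open>\<real>\<^sup>n\<close> cannot be a type here.
  It is the carrier of \<^const>\<open>Euclidean_space\<close>: the sequences \<^typ>\<open>nat \<Rightarrow> real\<close> that vanish from
  index \<open>n\<close> on. Pointwise operations make all sequences a real vector space, so that
  \<^const>\<open>subspace\<close>, \<^const>\<open>dim\<close>, \<^const>\<open>linear\<close> and \<^const>\<open>convex\<close> apply.
\<close>

instantiation "fun" :: (type, real_vector) real_vector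
begin

definition scaleR_fun :: "real \<Rightarrow> ('a \<Rightarrow> 'b) \<Rightarrow> 'a \<Rightarrow> 'b"
  where "scaleR_fun c f = (\<lambda>x. c *\<^sub>R f x)"

instance
  by standard (simp_all add: scaleR_fun_def fun_eq_iff algebra_simps)

end

lemma scaleR_fun_apply [simp]: "(c *\<^sub>R f) x = c *\<^sub>R f x"
  by (simp add: scaleR_fun_def)

abbreviation coord_space :: "nat \<Rightarrow> (nat \<Rightarrow> real) set"
  where "coord_space n \<equiv> topspace (Euclidean_space n)"

definition convex_body :: "nat \<Rightarrow> (nat \<Rightarrow> real) set \<Rightarrow> bool"
  where "convex_body n K \<longleftrightarrow>
    compactin (Euclidean_space n) K \<and> convex K \<and> Euclidean_space n interior_of K \<noteq> {}"

definition ball_2 :: "nat \<Rightarrow> (nat \<Rightarrow> real) set"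
  where "ball_2 n = {x \<in> coord_space n. L2_set x {..<n} \<le> 1}"

definition ball_inf :: "nat \<Rightarrow> (nat \<Rightarrow> real) set"
  where "ball_inf n = {x \<in> coord_space n. \<forall>i<n. \<bar>x i\<bar> \<le> 1}"

text \<open>
  An element of \<open>GL(\<real>\<^sup>n)\<close> is given by any linear extension to all sequences. Only its
  restriction to \<^term>\<open>coord_space n\<close> matters.
\<close>

definition body_dist :: "nat \<Rightarrow> (nat \<Rightarrow> real) set \<Rightarrow> (nat \<Rightarrow> real) set \<Rightarrow> real"
  where "body_dist n K L = Inf {r. r > 0 \<and>
    (\<exists>a \<in> coord_space n. \<exists>T. linear T \<and> bij_betw T (coord_space n) (coord_space n) \<and>
       L \<subseteq> T ` ((\<lambda>x. x - a) ` K) \<and> T ` ((\<lambda>x. x - a) ` K) \<subseteq> (\<lambda>x. r *\<^sub>R x) ` L)}"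

definition coord_iso :: "nat \<Rightarrow> (nat \<Rightarrow> real) set \<Rightarrow> ((nat \<Rightarrow> real) \<Rightarrow> nat \<Rightarrow> real) \<Rightarrow> bool"
  where "coord_iso m H J \<longleftrightarrow> linear J \<and> bij_betw J H (coord_space m)"

text \<open>
  The choice of the identification of \<open>H\<close> with \<open>\<real>\<^sup>m\<close> is immaterial: one exists by
  \<open>coord_iso_exists\<close> and all give the same value by \<open>section_dist_eq\<close> below.
\<close>

definition section_dist ::
    "nat \<Rightarrow> (nat \<Rightarrow> real) set \<Rightarrow> (nat \<Rightarrow> real) set \<Rightarrow> (nat \<Rightarrow> real) set \<Rightarrow> real"
  where "section_dist m H K L = body_dist m ((SOME J. coord_iso m H J) ` (H \<inter> K)) L"

definition unit_seq :: "nat \<Rightarrow> nat \<Rightarrow> real"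
  where "unit_seq i = (\<lambda>j. if j = i then 1 else 0)"

lemma subspace_coord_space: "subspace (coord_space n)"
  by (auto simp: subspace_def topspace_Euclidean_space)

lemma sum_fun_apply: "(\<Sum>i\<in>A. f i) x = (\<Sum>i\<in>A. f i x)"
  for f :: "'i \<Rightarrow> 'a \<Rightarrow> 'b::comm_monoid_add"
  by (induction A rule: infinite_finite_induct) auto

lemma inj_unit_seq: "inj unit_seq"
  by (auto simp: inj_def unit_seq_def fun_eq_iff)

lemma coord_space_eq_span: "coord_space n = span (unit_seq ` {..<n})"
proof
  show "coord_space n \<subseteq> span (unit_seq ` {..<n})"
  proof
    fix x assume x: "x \<in> coord_space n"
    have "x = (\<Sum>i<n. x i *\<^sub>R unit_seq i)"
    proof
      fix j
      have "(\<Sum>i<n. x i *\<^sub>R unit_seq i) j = (\<Sum>i<n. if i = j then x i else 0)"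
        unfolding sum_fun_apply by (rule sum.cong) (simp_all add: unit_seq_def)
      also have "\<dots> = x j"
        using x by (auto simp: topspace_Euclidean_space)
      finally show "x j = (\<Sum>i<n. x i *\<^sub>R unit_seq i) j" by simp
    qed
    also have "\<dots> \<in> span (unit_seq ` {..<n})"
      by (intro span_sum span_scale span_base) auto
    finally show "x \<in> span (unit_seq ` {..<n})" .
  qed
  show "span (unit_seq ` {..<n}) \<subseteq> coord_space n"
    by (intro span_minimal subspace_coord_space)
       (auto simp: topspace_Euclidean_space unit_seq_def)
qed

lemma independent_unit_seq: "independent (unit_seq ` {..<n})"
proof (induction n)
  case (Suc n)
  have "unit_seq n \<notin> coord_space n"
    by (auto simp: topspace_Euclidean_space unit_seq_def)
  with Suc show ?case
    by (simp add: coord_space_eq_span lessThan_Suc independent_insert)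
qed (simp add: real_vector.independent_empty)

lemma dim_coord_space: "dim (coord_space n) = n"
  by (metis coord_space_eq_span dim_span dim_eq_card_independent independent_unit_seq
      card_image inj_unit_seq inj_on_subset subset_UNIV card_lessThan)

lemma coord_iso_exists:
  assumes H: "subspace H" "H \<subseteq> coord_space d" "dim H = m"
  shows "\<exists>J. coord_iso m H J"
proof -
  obtain B where B: "B \<subseteq> H" "independent B" "H \<subseteq> span B" "card B = dim H"
    using basis_exists by blast
  have finB: "finite B"
    using independent_span_bound[of "unit_seq ` {..<d}" B] B(1,2) H(2)
    by (auto simp: coord_space_eq_span)
  have cE: "card (unit_seq ` {..<m}) = m"
    by (metis card_image card_lessThan inj_on_subset inj_unit_seq subset_UNIV)
  obtain f where f: "bij_betw f B (unit_seq ` {..<m})"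
    using finite_same_card_bij[of B "unit_seq ` {..<m}"] finB cE B(4) H(3) by auto
  obtain g where g: "linear g" "\<forall>x\<in>B. g x = f x"
    using linear_independent_extend[OF B(2)] by blast
  have gB: "g ` B = unit_seq ` {..<m}"
    using f g(2) by (auto simp: bij_betw_def image_def)
  have "inj_on g B"
    using f g(2) by (metis bij_betw_def inj_on_cong)
  hence "inj_on g (span B)"
    using linear_inj_on_span_iff_independent_image[OF g(1)] gB independent_unit_seq
      linear_inj_on_span_independent_image linear_independent_injective_image
    by (metis)
  moreover have HB: "span B = H"
    using B(1,3) H(1) by (meson span_minimal subset_antisym)
  moreover have "g ` span B = coord_space m"
    by (metis coord_space_eq_span gB g(1) linear_span_image)
  ultimately show ?thesis
    using g(1) by (auto simp: coord_iso_def bij_betw_def)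
qed

lemma section_dist_eq:
  assumes H: "subspace H" and J: "coord_iso m H J"
  shows "section_dist m H K L = body_dist m (J ` (H \<inter> K)) L"
proof -
  define P where "P J r \<longleftrightarrow> (\<exists>a \<in> coord_space m. \<exists>T. linear T \<and>
       bij_betw T (coord_space m) (coord_space m) \<and>
       L \<subseteq> T ` ((\<lambda>x. x - a) ` J ` (H \<inter> K)) \<and>
       T ` ((\<lambda>x. x - a) ` J ` (H \<inter> K)) \<subseteq> (\<lambda>x. r *\<^sub>R x) ` L)"
    for J :: "(nat \<Rightarrow> real) \<Rightarrow> nat \<Rightarrow> real" and r :: real
  have step: "P J2 r" if J1: "coord_iso m H J1" and J2: "coord_iso m H J2" and P: "P J1 r"
    for J1 J2 r
  proof -
    obtain a T where a: "a \<in> coord_space m" and T: "linear T"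
        "bij_betw T (coord_space m) (coord_space m)"
        "L \<subseteq> T ` ((\<lambda>x. x - a) ` J1 ` (H \<inter> K))"
        "T ` ((\<lambda>x. x - a) ` J1 ` (H \<inter> K)) \<subseteq> (\<lambda>x. r *\<^sub>R x) ` L"
      using P unfolding P_def by blast
    obtain b where b: "b \<in> H" "J1 b = a"
      using a J1 by (metis bij_betwE bij_betw_imp_surj_on coord_iso_def imageE)
    obtain g where g: "linear g" "\<And>v. v \<in> H \<Longrightarrow> g (J2 v) = v"
      using linear_exists_left_inverse_on[of J2 H] J2 H
      by (auto simp: coord_iso_def bij_betw_def)
    have lin: "linear J1" "linear J2" using J1 J2 by (auto simp: coord_iso_def)
    have bg: "bij_betw g (coord_space m) H"
    proof (rule bij_betw_byWitness[where f' = J2])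
      have s: "coord_space m = J2 ` H"
        using J2 by (auto simp: coord_iso_def bij_betw_def)
      show "\<forall>x\<in>coord_space m. J2 (g x) = x" "\<forall>x\<in>H. g (J2 x) = x"
        "g ` coord_space m \<subseteq> H" "J2 ` H \<subseteq> coord_space m"
        unfolding s using g(2) by auto
    qed
    let ?T = "T \<circ> J1 \<circ> g"
    have "linear ?T"
      using lin g(1) T(1) by (simp add: linear_compose)
    moreover have "bij_betw ?T (coord_space m) (coord_space m)"
      using bg J1 T(2) by (auto simp: coord_iso_def intro!: bij_betw_trans)
    moreover have "?T ` ((\<lambda>x. x - J2 b) ` J2 ` (H \<inter> K)) = T ` ((\<lambda>x. x - a) ` J1 ` (H \<inter> K))"
      unfolding image_image
    proof (rule image_cong[OF refl])
      fix x assume "x \<in> H \<inter> K"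
      hence "g (J2 x - J2 b) = x - b"
        using g b(1) by (simp add: linear_diff)
      thus "?T (J2 x - J2 b) = T (J1 x - a)"
        using b(2) lin(1) by (simp add: linear_diff)
    qed
    moreover have "J2 b \<in> coord_space m"
      using b(1) J2 by (auto simp: coord_iso_def bij_betw_def)
    ultimately show ?thesis
      unfolding P_def using T(3,4) by metis
  qed
  have "coord_iso m H (SOME J. coord_iso m H J)"
    using J by (simp add: someI[of "coord_iso m H"])
  hence "P (SOME J. coord_iso m H J) = P J"
    using step J by blast
  thus ?thesis
    unfolding section_dist_def body_dist_def P_def by (simp add: fun_eq_iff)
qed

text \<open>
  On \<open>ln (ln m)\<close>: since \<open>ln 0 = 0\<close> in HOL, \<open>ln (ln 1) = 0\<close>. A bound \<open>ln (ln m) \<ge> ln (ln d) / 2 - C\<close>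
  thus admits \<open>m = 1\<close> exactly when \<open>ln (ln d) \<le> 2 * C\<close>, so a large \<open>C\<close> makes the claim trivial
  for boundedly many \<open>d\<close>. Reading \<open>ln (ln 1)\<close> as \<open>-\<infinity>\<close> instead would make the claim false for small
  \<open>d\<close>: a disc in the plane is at distance \<open>sqrt 2\<close> from the square, and
  \<open>ln (ln 2) < ln (ln 2) / 2\<close>.
\<close>

end

theory Submission
  imports Defs "HOL-Probability.Probability" "Jordan_Normal_Form.Determinant"
begin

text \<open>
  The gauge \<open>p\<close> of \<open>K\<close> is sublinear but not even; let \<open>N x = max (p x) (p (-x))\<close>. A nearly maximal
  determinant (Dvoretzky-Rogers) gives about \<open>d / 2\<close> vectors \<open>x i\<close> with \<open>N (x i) \<ge> 1 / 6\<close> and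
  \<open>N (\<Sum>i. a i x i) \<le> |a|\<close>, the Euclidean norm. Let \<open>\<mu>\<close> be the mean of \<open>p (\<Sum>i. g i x i)\<close> over
  independent standard Gaussians \<open>g i\<close>.

  If \<open>\<mu>\<close> is at least \<open>exp (2 * sqrt (ln d))\<close>, then Gaussian concentration for Lipschitz functions and a
  net argument make \<open>p\<close> nearly \<open>\<mu>\<close> times the Euclidean norm on the range of a random Gaussian
  matrix. Evenness plays no role here, so this also serves non-symmetric \<open>K\<close>. Concentration comes
  from Maurey's property tau: \<open>F x * G y \<le> exp (|x - y|\<^sup>2 / 4)\<close> implies \<open>\<integral>F * \<integral>G \<le> 1\<close>, which
  tensorizes.

  If \<open>\<mu>\<close> is smaller, the average of \<open>N (\<Sum>i. \<epsilon> i x i)\<close> over signs is at most \<open>4 * \<mu>\<close>. Splitting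
  \<open>k * k\<close> vectors into \<open>k\<close> blocks and choosing one vector from each at random, symmetrization and
  contraction (Talagrand) give \<open>k\<close> vectors all of whose signed sums have \<open>N \<le> 1 + 8 * \<mu>\<close>. James'
  blocking argument lowers this bound to \<open>1 + \<delta>\<close> at the price of a root of \<open>k\<close> of order
  \<open>ln \<mu> / ln (1 + \<delta>)\<close>. Differences of pairs finally pass from \<open>N\<close> to \<open>p\<close>.
\<close>

section \<open>Sublinear functionals\<close>

text \<open>The threshold \<open>exp (2 * x)\<close> with \<open>x = sqrt (ln d)\<close> balances
  two losses. The Euclidean case yields dimensions up to a power of \<open>\<mu>\<close>; the factor
  2 in the exponent leaves room for \<open>m\<close> about \<open>exp x\<close> with all constants
  absorbed, so (i) needs no \<open>C\<close>. The cube case starts from a power of \<open>d\<close>,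
  whose logarithm is of order \<open>x * x\<close>, and James' argument divides this logarithm by a
  number of order \<open>ln \<mu>\<close>, that is, of order \<open>x\<close>. What remains is a
  multiple of \<open>x\<close> that depends on \<epsilon>, and the logarithm of the factor is the
  loss \<open>C\<close>. In boundedly many dimensions a line serves for (ii). The obstacle is the
  missing symmetry: the choice of the vectors, the sign averages and James' argument work with an
  even functional, but sections are measured by \<open>p\<close>. The case distinction is made on
  the mean of \<open>p\<close> itself, which controls that of \<open>N\<close> up to a factor 2.
  Determinants and vectors are chosen extremal only up to a factor 2. This replaces compactness
  arguments and costs constants such as 1/6.\<close>

locale sublinear =
  fixes q :: "'a::real_vector \<Rightarrow> real"
  assumes triangle: "q (x + y) \<le> q x + q y"
    and scale: "0 \<le> c \<Longrightarrow> q (c *\<^sub>R x) = c * q x"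
    and nonneg: "0 \<le> q x"
begin

lemma zero [simp]: "q 0 = 0"
  using scale[of 0 0] by simp

lemma le_add_diff: "q x \<le> q y + q (x - y)"
  using triangle[of y "x - y"] by simp

text \<open>Hahn-Banach for a finite family, stated through coefficients because the
  \<open>v i\<close> may be linearly dependent: \<open>c i\<close> is the value at
  \<open>v i\<close> of a linear functional that is dominated by \<open>q\<close> and agrees with
  \<open>q\<close> at \<open>v 0\<close>. It is extended by one vector at a time.\<close>

lemma ex_dominated_coeffs:
  fixes v :: "nat \<Rightarrow> 'a"
  shows "\<exists>c. c 0 = q (v 0) \<and> (\<forall>a. (\<Sum>i\<le>n. a i * c i) \<le> q (\<Sum>i\<le>n. a i *\<^sub>R v i))"
proof (induction n)
  case 0
  have "s * q (v 0) \<le> q (s *\<^sub>R v 0)" for s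
  proof (cases "0 \<le> s")
    case False
    hence "s * q (v 0) \<le> 0" using nonneg by (simp add: mult_nonpos_nonneg)
    thus ?thesis using nonneg order_trans by blast
  qed (simp add: scale)
  thus ?case by (intro exI[of _ "\<lambda>_. q (v 0)"]) simp
next
  case (Suc n)
  then obtain c where c: "c 0 = q (v 0)"
    "\<And>a. (\<Sum>i\<le>n. a i * c i) \<le> q (\<Sum>i\<le>n. a i *\<^sub>R v i)" by blast
  define w where "w = v (Suc n)"
  define C where "C a = (\<Sum>i\<le>n. a i * c i)" for a :: "nat \<Rightarrow> real"
  define V where "V a = (\<Sum>i\<le>n. a i *\<^sub>R v i)" for a :: "nat \<Rightarrow> real"
  have CV: "C a \<le> q (V a)" for a using c(2) by (simp add: C_def V_def)
  \<comment> \<open>The value \<open>t\<close> at the new vector has to lie above all left sides and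
    below all right sides. Subadditivity separates them; homogeneity then reduces a general multiple
    of \<open>w\<close> to \<open>w\<close> and \<open>- w\<close>.\<close>
  have key: "C a - q (V a - w) \<le> q (V b + w) - C b" for a b
  proof -
    have "C a + C b = C (\<lambda>i. a i + b i)"
      by (simp add: C_def sum.distrib algebra_simps)
    also have "\<dots> \<le> q (V (\<lambda>i. a i + b i))" by (rule CV)
    also have "V (\<lambda>i. a i + b i) = (V a - w) + (V b + w)"
      by (simp add: V_def sum.distrib algebra_simps)
    also have "q \<dots> \<le> q (V a - w) + q (V b + w)" by (rule triangle)
    finally show ?thesis by simp
  qed
  define t where "t = (SUP a. C a - q (V a - w))"
  have t1: "C a - q (V a - w) \<le> t" for a
    unfolding t_def using key by (intro cSUP_upper bdd_aboveI2) auto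
  have t2: "t \<le> q (V b + w) - C b" for b
    unfolding t_def using key by (intro cSUP_least) auto
  have main: "C a + s * t \<le> q (V a + s *\<^sub>R w)" for a s
  proof -
    have Cs: "C (\<lambda>i. a i / r) = C a / r" and Vs: "V (\<lambda>i. a i / r) = (1/r) *\<^sub>R V a" for r
      by (simp_all add: C_def V_def sum_divide_distrib scaleR_right.sum)
    consider "s = 0" | "s > 0" | "s < 0" by linarith
    thus ?thesis
    proof cases
      case 2
      have "s * (C a / s + t) \<le> s * q ((1/s) *\<^sub>R V a + w)"
        using t2[of "\<lambda>i. a i / s"] 2 unfolding Cs Vs by (intro mult_left_mono) auto
      also have "\<dots> = q (s *\<^sub>R ((1/s) *\<^sub>R V a + w))" using 2 by (simp add: scale)
      finally show ?thesis using 2 by (simp add: algebra_simps)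
    next
      case 3
      have "(-s) * (C a / (-s) - t) \<le> (-s) * q ((1/(-s)) *\<^sub>R V a - w)"
        using t1[of "\<lambda>i. a i / (-s)"] 3 unfolding Cs Vs by (intro mult_left_mono) auto
      also have "\<dots> = q ((-s) *\<^sub>R ((1/(-s)) *\<^sub>R V a - w))" using 3 by (subst scale) auto
      finally show ?thesis using 3 by (simp add: algebra_simps)
    qed (simp add: CV)
  qed
  show ?case
  proof (intro exI[of _ "c(Suc n := t)"] conjI allI)
    fix a :: "nat \<Rightarrow> real"
    have "(\<Sum>i\<le>Suc n. a i * (c(Suc n := t)) i) = C a + a (Suc n) * t"
      by (simp add: C_def)
    also have "\<dots> \<le> q (V a + a (Suc n) *\<^sub>R w)" by (rule main)
    finally show "(\<Sum>i\<le>Suc n. a i * (c(Suc n := t)) i) \<le> q (\<Sum>i\<le>Suc n. a i *\<^sub>R v i)"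
      by (simp add: V_def w_def)
  qed (use c in simp)
qed

end

locale even_sublinear = sublinear +
  assumes minus: "q (- x) = q x"

definition symmetrize :: "('a::real_vector \<Rightarrow> real) \<Rightarrow> 'a \<Rightarrow> real"
  where "symmetrize q x = max (q x) (q (- x))"

lemma (in sublinear) even_sublinear_symmetrize: "even_sublinear (symmetrize q)"
proof
  fix x y :: 'a and c :: real
  show "symmetrize q (x + y) \<le> symmetrize q x + symmetrize q y"
    using triangle[of x y] triangle[of "-x" "-y"] by (fastforce simp: symmetrize_def)
  show "symmetrize q (c *\<^sub>R x) = c * symmetrize q x" if "0 \<le> c"
    using scale[OF that, of x] scale[OF that, of "-x"] that
    by (simp add: symmetrize_def max_mult_distrib_left)
  show "0 \<le> symmetrize q x" using nonneg[of x] by (simp add: symmetrize_def max_def)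
  show "symmetrize q (- x) = symmetrize q x" by (simp add: symmetrize_def max.commute)
qed

lemma (in sublinear) sublinear_compose:
  assumes "linear f"
  shows "sublinear (\<lambda>x. q (f x))"
  using assms by unfold_locales (simp_all add: linear_add linear_cmul triangle scale nonneg)

section \<open>Blocks of vectors spanning a cube\<close>

text \<open>Only the upper half of being close to a cube. The lower half is carried along as
  \<open>1 \<le> q (y i)\<close>, which is what James' argument reproduces. Real coefficients,
  rather than signs, allow block vectors to be substituted directly.\<close>

definition cube_bounded :: "('a::real_vector \<Rightarrow> real) \<Rightarrow> nat \<Rightarrow> (nat \<Rightarrow> 'a) \<Rightarrow> real \<Rightarrow> bool"
  where "cube_bounded q k y B \<longleftrightarrow>
    (\<forall>a. (\<forall>i<k. \<bar>a i\<bar> \<le> 1) \<longrightarrow> q (\<Sum>i<k. a i *\<^sub>R y i) \<le> B)"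

lemma cube_bounded_mono: 
  assumes "cube_bounded q k y B" "k' \<le> k" "B \<le> B'"
  shows "cube_bounded q k' y B'"
  unfolding cube_bounded_def
proof (intro allI impI)
  fix a :: "nat \<Rightarrow> real" assume a: "\<forall>i<k'. \<bar>a i\<bar> \<le> 1"
  define a' where "a' i = (if i < k' then a i else 0)" for i
  have "(\<Sum>i<k'. a i *\<^sub>R y i) = (\<Sum>i<k. a' i *\<^sub>R y i)"
    using assms(2) by (intro sum.mono_neutral_cong_left) (auto simp: a'_def)
  moreover have "q (\<Sum>i<k. a' i *\<^sub>R y i) \<le> B"
    using assms(1) a unfolding cube_bounded_def by (auto simp: a'_def)
  ultimately show "q (\<Sum>i<k'. a i *\<^sub>R y i) \<le> B'" using assms(3) by simp
qed

lemma sum_blocks: "(\<Sum>g<n. \<Sum>i<k. f (g * k + i)) = (\<Sum>j<n * k. f j)"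
  for f :: "nat \<Rightarrow> 'b::comm_monoid_add"
proof -
  have "(\<Sum>i<k. f (g * k + i)) = sum f {g * k..<g * k + k}" for g
    using sum.shift_bounds_nat_ivl[of f 0 "g * k" k] by (simp add: add.commute lessThan_atLeast0)
  thus ?thesis by (simp add: sum.nat_group)
qed

text \<open>James' argument: either some block keeps the bound \<open>sqrt B\<close>, or each block contains a vector
  of size \<open>sqrt B\<close> and these vectors, normalised, have the bound \<open>sqrt B\<close>.\<close>

lemma (in even_sublinear) james_blocking:
  assumes "0 < B" "\<And>i. i < r ^ 2 ^ s \<Longrightarrow> 1 \<le> q (y i)" "cube_bounded q (r ^ 2 ^ s) y B"
  shows "\<exists>z. (\<forall>j<r. 1 \<le> q (z j)) \<and> cube_bounded q r z (B powr (1 / 2 ^ s))"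
  using assms
proof (induction s arbitrary: y B)
  case 0
  thus ?case by (intro exI[of _ y]) (auto simp: powr_one_gt_zero_iff)
next
  case (Suc s)
  define R where "R = r ^ 2 ^ s"
  have RR: "r ^ 2 ^ Suc s = R * R"
    by (simp add: R_def power2_eq_square[symmetric] power_mult[symmetric] mult.commute)
  have sq: "sqrt B powr (1 / 2 ^ s) = B powr (1 / 2 ^ Suc s)"
    using Suc.prems(1) by (simp add: powr_half_sqrt[symmetric] powr_powr)
  have idx: "g * R + i < R * R" if "g < R" "i < R" for g i
  proof -
    have "(g + 1) * R \<le> R * R" using that(1) by (intro mult_le_mono1) simp
    thus ?thesis using that(2) by simp
  qed
  note IH = Suc.IH[of "sqrt B", unfolded sq, folded R_def]
  show ?case
  proof (cases "\<exists>g<R. cube_bounded q R (\<lambda>i. y (g * R + i)) (sqrt B)")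
    case True
    then obtain g where g: "g < R" "cube_bounded q R (\<lambda>i. y (g * R + i)) (sqrt B)" by blast
    show ?thesis
      using g Suc.prems(1,2) idx RR by (intro IH[of "\<lambda>i. y (g * R + i)"]) auto
  next
    case False
    hence "\<forall>g. \<exists>a. g < R \<longrightarrow> (\<forall>i<R. \<bar>a i\<bar> \<le> 1) \<and> sqrt B < q (\<Sum>i<R. a i *\<^sub>R y (g * R + i))"
      unfolding cube_bounded_def by (meson not_le)
    then obtain a where a: "\<And>g i. g < R \<Longrightarrow> i < R \<Longrightarrow> \<bar>a g i\<bar> \<le> 1"
      "\<And>g. g < R \<Longrightarrow> sqrt B < q (\<Sum>i<R. a g i *\<^sub>R y (g * R + i))" by metis
    define z where "z g = (1 / sqrt B) *\<^sub>R (\<Sum>i<R. a g i *\<^sub>R y (g * R + i))" for g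
    show ?thesis
    proof (rule IH[of z])
      show "0 < sqrt B" using Suc.prems(1) by simp
      show "1 \<le> q (z g)" if "g < R" for g
        using a(2)[OF that] Suc.prems(1) by (simp add: z_def scale)
      show "cube_bounded q R z (sqrt B)"
        unfolding cube_bounded_def
      proof (intro allI impI)
        fix b :: "nat \<Rightarrow> real" assume b: "\<forall>g<R. \<bar>b g\<bar> \<le> 1"
        \<comment> \<open>The products \<open>b g * a g i\<close> over the flat index stay in the
          cube, so the bound \<open>B\<close> for all \<open>R * R\<close> vectors applies; the
          normalisation of the \<open>z g\<close> divides it by \<open>sqrt B\<close>.\<close>
        define c where "c j = b (j div R) * a (j div R) (j mod R)" for j
        have "(\<Sum>g<R. b g *\<^sub>R z g) = (1 / sqrt B) *\<^sub>R (\<Sum>g<R. \<Sum>i<R. c (g * R + i) *\<^sub>R y (g * R + i))"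
          unfolding scaleR_sum_right
          by (intro sum.cong refl) (auto simp: z_def c_def scaleR_sum_right intro!: sum.cong)
        also have "(\<Sum>g<R. \<Sum>i<R. c (g * R + i) *\<^sub>R y (g * R + i)) = (\<Sum>j<R * R. c j *\<^sub>R y j)"
          by (rule sum_blocks)
        finally have "q (\<Sum>g<R. b g *\<^sub>R z g) = q (\<Sum>j<R * R. c j *\<^sub>R y j) / sqrt B"
          using Suc.prems(1) by (simp add: scale)
        moreover have "\<bar>c j\<bar> \<le> 1" if "j < R * R" for j
        proof -
          have "j div R < R" "j mod R < R"
            using that by (auto simp: less_mult_imp_div_less) (metis gr_zeroI less_zeroE mod_less_divisor mult_is_0)
          thus ?thesis using b a(1) by (simp add: c_def abs_mult mult_le_one)
        qed
        hence "q (\<Sum>j<R * R. c j *\<^sub>R y j) \<le> B"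
          using Suc.prems(3) unfolding RR cube_bounded_def by blast
        hence "q (\<Sum>j<R * R. c j *\<^sub>R y j) / sqrt B \<le> B / sqrt B"
          using Suc.prems(1) by (intro divide_right_mono) auto
        ultimately show "q (\<Sum>g<R. b g *\<^sub>R z g) \<le> sqrt B"
          using Suc.prems(1) by (simp add: real_div_sqrt)
      qed
    qed
  qed
qed

definition max_norm :: "nat \<Rightarrow> (nat \<Rightarrow> real) \<Rightarrow> real"
  where "max_norm m a = Max (insert 0 ((\<lambda>i. \<bar>a i\<bar>) ` {..<m}))"

lemma max_norm_ge: "i < m \<Longrightarrow> \<bar>a i\<bar> \<le> max_norm m a"
  by (simp add: max_norm_def)

lemma max_norm_nonneg: "0 \<le> max_norm m a"
  by (simp add: max_norm_def)

lemma max_norm_le_iff: "0 \<le> c \<Longrightarrow> max_norm m a \<le> c \<longleftrightarrow> (\<forall>i<m. \<bar>a i\<bar> \<le> c)"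
  by (auto simp: max_norm_def)

lemma max_norm_attained: "0 < max_norm m a \<Longrightarrow> \<exists>i<m. \<bar>a i\<bar> = max_norm m a"
  using Max_in[of "insert 0 ((\<lambda>i. \<bar>a i\<bar>) ` {..<m})"] by (auto simp: max_norm_def)

text \<open>Differences of pairs make a cube of the symmetrized functional into a cube of the functional
  itself: \<open>q (u - v) \<ge> 2 * q u - q (u + v)\<close>.\<close>

lemma (in sublinear) cube_of_symmetrized_cube:
  assumes u: "\<And>j. j < 2 * m \<Longrightarrow> 1 \<le> symmetrize q (u j)"
    and bd: "cube_bounded (symmetrize q) (2 * m) u (1 + \<delta>)"
  shows "\<exists>v. \<forall>b. (1 - 3 * \<delta>) * max_norm m b \<le> q (\<Sum>j<m. b j *\<^sub>R v j) \<and>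
    q (\<Sum>j<m. b j *\<^sub>R v j) \<le> (1 + \<delta>) * max_norm m b"
proof -
  \<comment> \<open>A sign makes each vector large for \<open>q\<close> itself, not only for the
    symmetrized functional.\<close>
  have "\<exists>s. \<bar>s\<bar> = (1::real) \<and> (j < 2 * m \<longrightarrow> 1 \<le> q (s *\<^sub>R u j))" for j
    using u[of j] by (cases "1
      \<le> q (u j)") (auto simp: symmetrize_def le_max_iff_disj intro: exI[of _ 1] exI[of _ "-1"])
  then obtain s where s: "\<And>j. \<bar>s j\<bar> = (1::real)" "\<And>j. j < 2 * m \<Longrightarrow> 1 \<le> q (s j *\<^sub>R u j)" by metis
  define v where "v j = s (2*j) *\<^sub>R u (2*j) - s (2*j+1) *\<^sub>R u (2*j+1)" for j
  have bd': "q (\<Sum>j<2*m. c j *\<^sub>R u j) \<le> 1 + \<delta>" if "\<And>j. j < 2*m \<Longrightarrow> \<bar>c j\<bar> \<le> 1" for c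
    using bd that unfolding cube_bounded_def symmetrize_def by force
  have sumpairs: "(\<Sum>j<2*m. f j) = (\<Sum>j<m. f (2*j) + f (2*j+1))" for f :: "nat \<Rightarrow> 'a"
    by (induction m) (simp_all add: algebra_simps)
  have up1: "q (\<Sum>j<m. b j *\<^sub>R v j) \<le> 1 + \<delta>" if b: "\<And>j. j < m \<Longrightarrow> \<bar>b j\<bar> \<le> 1" for b
  proof -
    have "(\<Sum>j<m. b j *\<^sub>R v j) = (\<Sum>j<2*m. (b (j div 2) * s j * (if even j then 1 else -1)) *\<^sub>R u j)"
      unfolding sumpairs by (intro sum.cong) (auto simp: v_def algebra_simps)
    moreover have "q \<dots> \<le> 1 + \<delta>"
      using b s(1) by (intro bd') (auto simp: abs_mult)
    ultimately show ?thesis by simp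
  qed
  have up: "q (\<Sum>j<m. b j *\<^sub>R v j) \<le> (1 + \<delta>) * M" if b: "\<And>j. j < m \<Longrightarrow> \<bar>b j\<bar> \<le> M" and M: "0 < M" for b M
  proof -
    have "(\<Sum>j<m. b j *\<^sub>R v j) = M *\<^sub>R (\<Sum>j<m. (b j / M) *\<^sub>R v j)"
      using M by (simp add: scaleR_sum_right)
    hence "q (\<Sum>j<m. b j *\<^sub>R v j) = M * q (\<Sum>j<m. (b j / M) *\<^sub>R v j)"
      using M by (simp add: scale)
    also have "\<dots> \<le> M * (1 + \<delta>)"
      using M b by (intro mult_left_mono up1) (auto simp: divide_simps)
    finally show ?thesis by (simp add: mult.commute)
  qed
  \<comment> \<open>Each pair is large in both directions: for \<open>t = -1\<close> its two members
    exchange roles. This is what restores the symmetry that \<open>q\<close> lacks.\<close>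
  have lowv: "1 - \<delta> \<le> q (t *\<^sub>R v j)" if j: "j < m" and t: "t = 1 \<or> t = -1" for t j
  proof -
    define i i' where "i = (if t = 1 then 2*j else 2*j+1)" and "i' = (if t = 1 then 2*j+1 else 2*j)"
    have ii: "i < 2*m" "i' < 2*m" "i \<noteq> i'" using j by (auto simp: i_def i'_def)
    have tv: "t *\<^sub>R v j = s i *\<^sub>R u i - s i' *\<^sub>R u i'"
      using t by (auto simp: v_def i_def i'_def)
    have "s i *\<^sub>R u i + s i' *\<^sub>R u i'
      = (\<Sum>l<2*m. (if l = i then s i else if l = i' then s i' else 0) *\<^sub>R u l)"
    proof -
      have "(\<Sum>l<2*m. (if l = i then s i else if l = i' then s i' else 0) *\<^sub>R u l)
        = (\<Sum>l\<in>{i,i'}. (if l = i then s i else if l = i' then s i' else 0) *\<^sub>R u l)"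
        using ii by (intro sum.mono_neutral_right) auto
      thus ?thesis using ii by simp
    qed
    hence "q (s i *\<^sub>R u i + s i' *\<^sub>R u i') \<le> 1 + \<delta>"
      using s(1) by (simp only:) (intro bd', auto)
    moreover have "q (2 *\<^sub>R (s i *\<^sub>R u i)) \<le> q (s i *\<^sub>R u i - s i' *\<^sub>R u i')
      + q (s i *\<^sub>R u i + s i' *\<^sub>R u i')"
      using triangle[of "s i *\<^sub>R u i - s i' *\<^sub>R u i'" "s i *\<^sub>R u i + s i' *\<^sub>R u i'"]
      by (simp add: scaleR_2 del: scaleR_scaleR)
    moreover have "q (2 *\<^sub>R (s i *\<^sub>R u i)) = 2 * q (s i *\<^sub>R u i)" by (rule scale) simp
    ultimately show ?thesis using s(2)[OF ii(1)] tv by simp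
  qed
  show ?thesis
  proof (intro exI[of _ v] allI)
    fix b :: "nat \<Rightarrow> real"
    define M where "M = max_norm m b"
    show "(1 - 3 * \<delta>) * max_norm m b \<le> q (\<Sum>j<m. b j *\<^sub>R v j) \<and>
      q (\<Sum>j<m. b j *\<^sub>R v j) \<le> (1 + \<delta>) * max_norm m b"
    proof (cases "M = 0")
      case True
      hence "(\<Sum>j<m. b j *\<^sub>R v j) = 0"
        using max_norm_ge[of _ m b] by (intro sum.neutral) (fastforce simp: M_def)
      thus ?thesis using True by (simp add: M_def)
    next
      case False
      hence M: "0 < M" using max_norm_nonneg[of m b] by (simp add: M_def)
      have bM: "\<bar>b j\<bar> \<le> M" if "j < m" for j using max_norm_ge[OF that] by (simp add: M_def)
      obtain i where i: "i < m" "\<bar>b i\<bar> = M" using max_norm_attained[of m b] M by (auto simp: M_def)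
      define t :: real where "t = (if 0 \<le> b i then 1 else -1)"
      have t: "t = 1 \<or> t = -1" "b i = t * M" using i by (auto simp: t_def)
      \<comment> \<open>Flipping all coefficients but the largest and adding leaves
        \<open>2 * b i\<close> times \<open>v i\<close>. The upper bound for \<open>b'\<close> thus
        becomes a lower bound for \<open>b\<close>, with constant
        \<open>2 * (1 - \<delta>) - (1 + \<delta>) = 1 - 3 * \<delta>\<close>.\<close>
      define b' where "b' = (\<lambda>j. - b j)(i := b i)"
      have "(2 * M) *\<^sub>R (t *\<^sub>R v i) = (\<Sum>j<m. b j *\<^sub>R v j) + (\<Sum>j<m. b' j *\<^sub>R v j)"
      proof -
        have "(\<Sum>j<m. b j *\<^sub>R v j) + (\<Sum>j<m. b' j *\<^sub>R v j)
          = (\<Sum>j<m. if j = i then (2 * b i) *\<^sub>R v i else 0)"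
          unfolding sum.distrib[symmetric] by (intro sum.cong) (auto simp: b'_def scaleR_2 scaleR_add_left[symmetric])
        thus ?thesis using i t by (simp add: mult.assoc mult.commute)
      qed
      moreover have "q ((2 * M) *\<^sub>R (t *\<^sub>R v i)) = 2 * M * q (t *\<^sub>R v i)" using M by (intro scale) simp
      moreover have "2 * M * (1 - \<delta>) \<le> 2 * M * q (t *\<^sub>R v i)"
        using M lowv[OF i(1) t(1)] by (intro mult_left_mono) auto
      moreover have "q (\<Sum>j<m. b' j *\<^sub>R v j) \<le> (1 + \<delta>) * M"
        using M bM by (intro up) (auto simp: b'_def)
      ultimately have "2 * M * (1 - \<delta>) \<le> q (\<Sum>j<m. b j *\<^sub>R v j) + (1 + \<delta>) * M"
        using triangle[of "\<Sum>j<m. b j *\<^sub>R v j" "\<Sum>j<m. b' j *\<^sub>R v j"] by simp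
      hence "(1 - 3 * \<delta>) * M \<le> q (\<Sum>j<m. b j *\<^sub>R v j)" by (simp add: algebra_simps)
      thus ?thesis using up[of b M] M bM by (simp add: M_def)
    qed
  qed
qed

section \<open>Selecting a cube from small sign averages\<close>

lemma SUP_add_SUP_le:
  fixes f g :: "'a \<Rightarrow> real"
  assumes "T \<noteq> {}" "\<And>x y. x \<in> T \<Longrightarrow> y \<in> T \<Longrightarrow> f x + g y \<le> c"
  shows "(SUP x\<in>T. f x) + (SUP x\<in>T. g x) \<le> c"
proof -
  have "(SUP x\<in>T. f x) \<le> c - (SUP x\<in>T. g x)"
  proof (rule cSUP_least[OF assms(1)])
    fix x assume "x \<in> T"
    hence "(SUP x\<in>T. g x) \<le> c - f x"
      using assms by (intro cSUP_least) (auto simp: algebra_simps)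
    thus "f x \<le> c - (SUP x\<in>T. g x)" by simp
  qed
  thus ?thesis by simp
qed

text \<open>One step of Talagrand's contraction principle, for the absolute value and a single sign.
  The two suprema are compared at a pair of points; according to the signs of \<open>u x\<close> and
  \<open>u y\<close>, one of the two ways to distribute plus and minus over the pair
  dominates.\<close>

lemma SUP_abs_contraction:
  fixes h u :: "'a \<Rightarrow> real"
  assumes T: "T \<noteq> {}" and b: "bdd_above ((\<lambda>x. h x + u x) ` T)" "bdd_above ((\<lambda>x. h x - u x) ` T)"
  shows "(SUP x\<in>T. h x + \<bar>u x\<bar>) + (SUP x\<in>T. h x - \<bar>u x\<bar>) \<le> (SUP x\<in>T. h x + u x) + (SUP x\<in>T. h x - u x)"
proof (rule SUP_add_SUP_le[OF T])
  fix x y assume "x \<in> T" "y \<in> T"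
  hence "h x + u x \<le> (SUP x\<in>T. h x + u x)" "h y + u y \<le> (SUP x\<in>T. h x + u x)"
    "h x - u x \<le> (SUP x\<in>T. h x - u x)" "h y - u y \<le> (SUP x\<in>T. h x - u x)"
    using b by (auto intro: cSUP_upper)
  thus "h x + \<bar>u x\<bar> + (h y - \<bar>u y\<bar>) \<le> (SUP x\<in>T. h x + u x) + (SUP x\<in>T. h x - u x)"
    by (cases "0 \<le> u x"; cases "0 \<le> u y") auto
qed

text \<open>Averaging against an independent copy of the index replaces the absolute values by symmetric
  differences, which split into the two contracted halves.\<close>

lemma SUP_symmetrization:
  fixes h :: "'a \<Rightarrow> real" and u :: "'i \<Rightarrow> 'a \<Rightarrow> real"
  assumes T: "T \<noteq> {}" and h: "\<And>x. x \<in> T \<Longrightarrow> \<bar>h x\<bar> \<le> H" and u: "\<And>i x. i \<in> I \<Longrightarrow> x \<in> T \<Longrightarrow> \<bar>u i x\<bar> \<le> U"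
    and I: "finite I"
  shows "(\<Sum>i\<in>I. SUP x\<in>T. h x + \<bar>u i x\<bar>) \<le>
    (\<Sum>i\<in>I. ((SUP x\<in>T. h x + (\<Sum>j\<in>I. \<bar>u j x\<bar>) / card I + 2 * u i x) +
             (SUP x\<in>T. h x + (\<Sum>j\<in>I. \<bar>u j x\<bar>) / card I - 2 * u i x)) / 2)"
proof (cases "I = {}")
  case False
  define c where "c = real (card I)"
  have c: "0 < c" using I False by (simp add: c_def card_gt_0_iff)
  define m where "m x = h x + (\<Sum>j\<in>I. \<bar>u j x\<bar>) / c" for x
  have m: "\<bar>m x\<bar> \<le> H + U" if "x \<in> T" for x
  proof -
    have "(\<Sum>j\<in>I. \<bar>u j x\<bar>) \<le> (\<Sum>j\<in>I. U)" using u that by (intro sum_mono) auto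
    hence "(\<Sum>j\<in>I. \<bar>u j x\<bar>) / c \<le> U" using c by (simp add: c_def divide_simps mult.commute)
    moreover have "0 \<le> (\<Sum>j\<in>I. \<bar>u j x\<bar>) / c" using c by (intro divide_nonneg_pos sum_nonneg) auto
    ultimately show ?thesis using h[OF that] by (simp add: m_def)
  qed
  have bd: "bdd_above (f ` T)" if "\<And>x. x \<in> T \<Longrightarrow> f x \<le> K" for f :: "'a \<Rightarrow> real" and K
    using that by (intro bdd_aboveI2)
  have bdp: "bdd_above ((\<lambda>x. m x + 2 * u i x) ` T)" "bdd_above ((\<lambda>x. m x - 2 * u i x) ` T)"
    "bdd_above ((\<lambda>x. m x + 2 * \<bar>u i x\<bar>) ` T)" "bdd_above ((\<lambda>x. m x - 2 * \<bar>u i x\<bar>) ` T)" if "i \<in> I" for i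
    using m u[OF that] by (auto intro!: bd[where K = "H + U + 2 * U"] simp: abs_le_iff) (smt (verit))+
  define P where "P i = (SUP x\<in>T. m x + 2 * \<bar>u i x\<bar>)" for i
  define Q where "Q i = (SUP x\<in>T. m x - 2 * \<bar>u i x\<bar>)" for i
  have step1: "(SUP x\<in>T. h x + \<bar>u i x\<bar>) \<le> (\<Sum>j\<in>I. (P i + Q j) / 2) / c" if i: "i \<in> I" for i
  proof (rule cSUP_least[OF T])
    fix x assume x: "x \<in> T"
    \<comment> \<open>Since \<open>m\<close> contains the average of the
      \<open>\<bar>u j x\<bar>\<close>, the value at \<open>i\<close> is an average over
      \<open>j\<close> of midpoints of \<open>m + 2 * \<bar>u i\<bar>\<close> and
      \<open>m - 2 * \<bar>u j\<bar>\<close>, whose suprema can be taken separately. Summation over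
      \<open>i\<close> and \<open>j\<close> then decouples.\<close>
    have "c * (h x + \<bar>u i x\<bar>) = (\<Sum>j\<in>I. m x + \<bar>u i x\<bar> - \<bar>u j x\<bar>)"
      using c by (simp add: m_def sum.distrib sum_subtractf c_def algebra_simps)
    also have "\<dots> \<le> (\<Sum>j\<in>I. (P i + Q j) / 2)"
    proof (rule sum_mono)
      fix j assume j: "j \<in> I"
      have "m x + 2 * \<bar>u i x\<bar> \<le> P i" unfolding P_def using x bdp(3)[OF i] by (rule cSUP_upper)
      moreover have "m x - 2 * \<bar>u j x\<bar> \<le> Q j" unfolding Q_def using x bdp(4)[OF j] by (rule cSUP_upper)
      ultimately show "m x + \<bar>u i x\<bar> - \<bar>u j x\<bar> \<le> (P i + Q j) / 2" by simp
    qed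
    finally show "h x + \<bar>u i x\<bar> \<le> (\<Sum>j\<in>I. (P i + Q j) / 2) / c"
      using c by (simp add: divide_simps mult.commute)
  qed
  have "(\<Sum>i\<in>I. SUP x\<in>T. h x + \<bar>u i x\<bar>) \<le> (\<Sum>i\<in>I. (\<Sum>j\<in>I. (P i + Q j) / 2) / c)"
    by (intro sum_mono step1)
  also have "\<dots> = (\<Sum>i\<in>I. (P i + Q i) / 2)"
  proof -
    have "(\<Sum>j\<in>I. (P i + Q j) / 2) / c = P i / 2 + (\<Sum>j\<in>I. Q j) / 2 / c" for i
      using c by (simp add: sum_divide_distrib[symmetric] sum.distrib c_def[symmetric] field_simps)
    hence "(\<Sum>i\<in>I. (\<Sum>j\<in>I. (P i + Q j) / 2) / c) = (\<Sum>i\<in>I. P i / 2) + (\<Sum>j\<in>I. Q j) / 2"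
      using c by (simp add: sum.distrib c_def[symmetric])
    thus ?thesis by (simp add: sum.distrib sum_divide_distrib add_divide_distrib)
  qed
  also have "\<dots> \<le> (\<Sum>i\<in>I. ((SUP x\<in>T. m x + 2 * u i x) + (SUP x\<in>T. m x - 2 * u i x)) / 2)"
  proof (intro sum_mono divide_right_mono)
    fix i assume i: "i \<in> I"
    show "P i + Q i \<le> (SUP x\<in>T. m x + 2 * u i x) + (SUP x\<in>T. m x - 2 * u i x)"
      using SUP_abs_contraction[OF T bdp(1,2)[OF i]] by (simp add: P_def Q_def abs_mult)
  qed simp
  finally show ?thesis by (simp add: m_def c_def)
qed simp

text \<open>Sign vectors vanish off \<open>A\<close>, so that they are themselves points at which a
  functional on sequences can be evaluated.\<close>

definition signs :: "nat set \<Rightarrow> (nat \<Rightarrow> real) set"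
  where "signs A = {\<epsilon>. (\<forall>i\<in>A. \<epsilon> i = 1 \<or> \<epsilon> i = -1) \<and> (\<forall>i. i \<notin> A \<longrightarrow> \<epsilon> i = 0)}"

lemma signs_empty: "signs {} = {\<lambda>_. 0}"
  by (auto simp: signs_def)

lemma signs_insert:
  assumes "i \<notin> A"
  shows "signs (insert i A) = (\<lambda>\<epsilon>. \<epsilon>(i := 1)) ` signs A \<union> (\<lambda>\<epsilon>. \<epsilon>(i := -1)) ` signs A"
proof (intro equalityI subsetI)
  fix \<epsilon> assume e: "\<epsilon> \<in> signs (insert i A)"
  have "\<epsilon>(i := 0) \<in> signs A" using e assms by (auto simp: signs_def)
  moreover have "\<epsilon> = (\<epsilon>(i := 0))(i := \<epsilon> i)" by simp
  moreover have "\<epsilon> i = 1 \<or> \<epsilon> i = -1" using e by (auto simp: signs_def)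
  ultimately show "\<epsilon> \<in> (\<lambda>\<epsilon>. \<epsilon>(i := 1)) ` signs A \<union> (\<lambda>\<epsilon>. \<epsilon>(i := -1)) ` signs A"
    by (metis UnI1 UnI2 image_eqI)
next
  fix \<epsilon> assume "\<epsilon> \<in> (\<lambda>\<epsilon>. \<epsilon>(i := 1)) ` signs A \<union> (\<lambda>\<epsilon>. \<epsilon>(i := -1)) ` signs A"
  then obtain \<eta> c where "\<eta> \<in> signs A" "c = 1 \<or> c = -1" "\<epsilon> = \<eta>(i := c)" by blast
  thus "\<epsilon> \<in> signs (insert i A)" using assms unfolding signs_def by auto
qed

lemma finite_signs: "finite A \<Longrightarrow> finite (signs A)"
  by (induction A rule: finite_induct) (auto simp: signs_empty signs_insert)

lemma sum_signs_insert:
  assumes "finite A" "i \<notin> A"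
  shows "(\<Sum>\<epsilon>\<in>signs (insert i A). f \<epsilon>) = (\<Sum>\<epsilon>\<in>signs A. f (\<epsilon>(i := 1)) + f (\<epsilon>(i := -1)))"
proof -
  have inj: "inj_on (\<lambda>\<epsilon>. \<epsilon>(i := c)) (signs A)" for c :: real
  proof (rule inj_onI)
    fix \<epsilon> \<eta> :: "nat \<Rightarrow> real" assume *: "\<epsilon> \<in> signs A" "\<eta> \<in> signs A" "\<epsilon>(i := c) = \<eta>(i := c)"
    have "\<epsilon> i = \<eta> i" using * assms(2) by (auto simp: signs_def)
    thus "\<epsilon> = \<eta>" using *(3) by (metis fun_upd_triv fun_upd_upd)
  qed
  have "(\<lambda>\<epsilon>. \<epsilon>(i := 1)) ` signs A \<inter> (\<lambda>\<epsilon>. \<epsilon>(i := -1)) ` signs A = ({} :: (nat \<Rightarrow> real) set)"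
    by (auto simp: fun_upd_def fun_eq_iff) (metis one_neq_neg_one)
  thus ?thesis
    using assms by (simp add: signs_insert sum.union_disjoint finite_signs sum.reindex[OF inj] sum.distrib)
qed

lemma card_signs: "finite A \<Longrightarrow> card (signs A) = 2 ^ card A"
proof (induction A rule: finite_induct)
  case (insert i A)
  have "card (signs (insert i A)) = (\<Sum>\<epsilon>\<in>signs (insert i A). 1)" by simp
  also have "\<dots> = 2 * card (signs A)" using insert by (subst sum_signs_insert) auto
  finally show ?case using insert by simp
qed (simp add: signs_empty)

text \<open>Transversals of the first \<open>r\<close> consecutive blocks of length
  \<open>k\<close>, kept as index sets so that sums over a selection are ordinary sums. Averaging
  over them amounts to choosing the index in each block independently and uniformly.\<close>

fun selections :: "nat \<Rightarrow> nat \<Rightarrow> nat set set"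
  where
    "selections k 0 = {{}}"
  | "selections k (Suc r) = (\<lambda>(i, \<sigma>). insert i \<sigma>) ` ({r * k..<r * k + k} \<times> selections k r)"

lemma selections_subset: "\<sigma> \<in> selections k r \<Longrightarrow> \<sigma> \<subseteq> {..<r * k}"
  by (induction r arbitrary: \<sigma>) fastforce+

lemma sum_selections_Suc:
  "(\<Sum>\<sigma>\<in>selections k (Suc r). f \<sigma>) = (\<Sum>i\<in>{r * k..<r * k + k}. \<Sum>\<sigma>\<in>selections k r. f (insert i \<sigma>))"
proof -
  have "inj_on (\<lambda>(i, \<sigma>). insert i \<sigma>) ({r * k..<r * k + k} \<times> selections k r)"
  proof (rule inj_onI, clarify)
    fix i j \<sigma> \<tau> assume *: "i \<in> {r * k..<r * k + k}" "j \<in> {r * k..<r * k + k}"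
      "\<sigma> \<in> selections k r" "\<tau> \<in> selections k r" "insert i \<sigma> = insert j \<tau>"
    have "i \<notin> \<sigma>" "i \<notin> \<tau>" "j \<notin> \<sigma>" "j \<notin> \<tau>"
      using * selections_subset[of \<sigma> k r] selections_subset[of \<tau> k r] by auto
    thus "i = j \<and> \<sigma> = \<tau>" using *(5) by (metis insert_ident insertE insertI1)
  qed
  thus ?thesis
    by (simp add: sum.reindex sum.cartesian_product case_prod_unfold)
qed

lemma finite_selections: "finite (selections k r)"
  by (induction r) auto

lemma selections_nonempty: "0 < k \<Longrightarrow> selections k r \<noteq> {}"
  by (induction r) auto

lemma card_selection: "\<sigma> \<in> selections k r \<Longrightarrow> card \<sigma> = r"
proof (induction r arbitrary: \<sigma>)
  case (Suc r)
  then obtain i \<tau> where *: "i \<in> {r * k..<r * k + k}" "\<tau> \<in> selections k r" "\<sigma> = insert i \<tau>" by auto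
  have "\<tau> \<subseteq> {..<r * k}" using selections_subset *(2) .
  hence "i \<notin> \<tau>" "finite \<tau>" using *(1) by (auto intro: finite_subset)
  thus ?case using Suc.IH[OF *(2)] *(3) by simp
qed simp

lemma sum_swap_average:
  fixes A :: "'i \<Rightarrow> 's \<Rightarrow> 'e \<Rightarrow> 'b::field"
  shows "(\<Sum>i\<in>I. \<Sum>\<sigma>\<in>S. (\<Sum>\<epsilon>\<in>E \<sigma>. A i \<sigma> \<epsilon>) / c) = (\<Sum>\<sigma>\<in>S. (\<Sum>\<epsilon>\<in>E \<sigma>. \<Sum>i\<in>I. A i \<sigma> \<epsilon>) / c)"
proof -
  have "(\<Sum>i\<in>I. \<Sum>\<sigma>\<in>S. (\<Sum>\<epsilon>\<in>E \<sigma>. A i \<sigma> \<epsilon>) / c) = (\<Sum>\<sigma>\<in>S. \<Sum>i\<in>I. (\<Sum>\<epsilon>\<in>E \<sigma>. A i \<sigma> \<epsilon>) / c)"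
    by (rule sum.swap)
  also have "\<dots> = (\<Sum>\<sigma>\<in>S. (\<Sum>\<epsilon>\<in>E \<sigma>. \<Sum>i\<in>I. A i \<sigma> \<epsilon>) / c)"
  proof (intro sum.cong refl)
    fix \<sigma>
    show "(\<Sum>i\<in>I. (\<Sum>\<epsilon>\<in>E \<sigma>. A i \<sigma> \<epsilon>) / c) = (\<Sum>\<epsilon>\<in>E \<sigma>. \<Sum>i\<in>I. A i \<sigma> \<epsilon>) / c"
      unfolding sum_divide_distrib[symmetric] by (subst sum.swap) (rule refl)
  qed
  finally show ?thesis .
qed

text \<open>Symmetrization and contraction, one block at a time. The random index of a block is
  replaced by the mean over the block plus a signed term with factor 2. The offset \<open>h\<close>
  is arbitrary because it has to absorb what the remaining blocks contribute.\<close>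

lemma sum_SUP_selections_le:
  fixes T :: "(nat \<Rightarrow> real) set" and h :: "(nat \<Rightarrow> real) \<Rightarrow> real"
  assumes T: "T \<noteq> {}" and U: "\<And>\<phi> i. \<phi> \<in> T \<Longrightarrow> \<bar>\<phi> i\<bar> \<le> U"
    and "\<And>\<phi>. \<phi> \<in> T \<Longrightarrow> \<bar>h \<phi>\<bar> \<le> H"
  shows "(\<Sum>\<sigma>\<in>selections k r. SUP \<phi>\<in>T. h \<phi> + (\<Sum>i\<in>\<sigma>. \<bar>\<phi> i\<bar>)) \<le>
    (\<Sum>\<sigma>\<in>selections k r. (\<Sum>\<epsilon>\<in>signs \<sigma>. SUP \<phi>\<in>T. h \<phi> + (\<Sum>j<r * k. \<bar>\<phi> j\<bar>) / k + 2 * (\<Sum>i\<in>\<sigma>. \<epsilon> i * \<phi> i)) / 2 ^ r)"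
  using assms(3)
proof (induction r arbitrary: h H)
  case 0
  thus ?case by (simp add: signs_empty)
next
  case (Suc r)
  let ?I = "{r * k..<r * k + k}"
  define G where "G \<sigma> \<epsilon> \<phi> = h \<phi> + (\<Sum>j<r * k. \<bar>\<phi> j\<bar>) / k + 2 * (\<Sum>i\<in>\<sigma>. \<epsilon> i * \<phi> i)"
    for \<sigma> and \<epsilon> \<phi> :: "nat \<Rightarrow> real"
  have Gb: "\<bar>G \<sigma> \<epsilon> \<phi>\<bar> \<le> H + r * k * U / k + 2 * (\<Sum>i\<in>\<sigma>. \<bar>\<epsilon> i\<bar> * U)" if p: "\<phi> \<in> T" for \<sigma> \<epsilon> \<phi>
  proof -
    have "(\<Sum>j<r * k. \<bar>\<phi> j\<bar>) \<le> (\<Sum>j<r * k. U)" using U[OF p] by (intro sum_mono) auto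
    hence "(\<Sum>j<r * k. \<bar>\<phi> j\<bar>) / k \<le> r * k * U / k" by (intro divide_right_mono) auto
    moreover have "0 \<le> (\<Sum>j<r * k. \<bar>\<phi> j\<bar>) / k" by (intro divide_nonneg_nonneg sum_nonneg) auto
    moreover have "\<bar>\<Sum>i\<in>\<sigma>. \<epsilon> i * \<phi> i\<bar> \<le> (\<Sum>i\<in>\<sigma>. \<bar>\<epsilon> i\<bar> * U)"
      using U[OF p] by (intro order_trans[OF sum_abs] sum_mono) (auto simp: abs_mult intro!: mult_left_mono)
    ultimately show ?thesis using Suc.prems[OF p] unfolding G_def by (smt (verit))
  qed
  define S where "S \<sigma> \<epsilon> = (SUP \<phi>\<in>T. h \<phi> + (\<Sum>j<Suc r * k. \<bar>\<phi> j\<bar>) / k + 2 * (\<Sum>i\<in>\<sigma>. \<epsilon> i * \<phi> i))"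
    for \<sigma> and \<epsilon> :: "nat \<Rightarrow> real"
  have split: "{..<Suc r * k} = {..<r * k} \<union> ?I" by auto
  have split_sum: "(\<Sum>j<Suc r * k. \<bar>\<phi> j\<bar>) = (\<Sum>j<r * k. \<bar>\<phi> j\<bar>) + (\<Sum>j\<in>?I. \<bar>\<phi> j\<bar>)" for \<phi> :: "nat \<Rightarrow> real"
    unfolding split by (rule sum.union_disjoint) auto
  have S_upd: "S (insert i \<sigma>) (\<epsilon>(i := c))
    = (SUP \<phi>\<in>T. G \<sigma> \<epsilon> \<phi> + (\<Sum>j\<in>?I. \<bar>\<phi> j\<bar>) / card ?I + 2 * (c * \<phi> i))"
    if "i \<in> ?I" "\<sigma> \<in> selections k r" for i \<sigma> c \<epsilon>
  proof -
    have i: "i \<notin> \<sigma>" "finite \<sigma>" using that selections_subset[of \<sigma> k r] by (auto intro: finite_subset)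
    have "(\<Sum>l\<in>insert i \<sigma>. (\<epsilon>(i := c)) l * \<phi> l) = c * \<phi> i + (\<Sum>l\<in>\<sigma>. \<epsilon> l * \<phi> l)" for \<phi>
      using i by (auto intro!: sum.cong)
    thus ?thesis unfolding S_def G_def split_sum
      by (simp add: add_divide_distrib algebra_simps)
  qed
  have "(\<Sum>\<sigma>\<in>selections k (Suc r). SUP \<phi>\<in>T. h \<phi> + (\<Sum>i\<in>\<sigma>. \<bar>\<phi> i\<bar>))
    = (\<Sum>i\<in>?I. \<Sum>\<sigma>\<in>selections k r. SUP \<phi>\<in>T. (h \<phi> + \<bar>\<phi> i\<bar>) + (\<Sum>i\<in>\<sigma>. \<bar>\<phi> i\<bar>))"
    unfolding sum_selections_Suc
  proof (intro sum.cong refl)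
    fix i \<sigma> assume *: "i \<in> ?I" "\<sigma> \<in> selections k r"
    have i: "i \<notin> \<sigma>" "finite \<sigma>" using * selections_subset[of \<sigma> k r] by (auto intro: finite_subset)
    show "(SUP \<phi>\<in>T. h \<phi> + (\<Sum>i\<in>insert i \<sigma>. \<bar>\<phi> i\<bar>)) = (SUP \<phi>\<in>T. h \<phi> + \<bar>\<phi> i\<bar> + (\<Sum>i\<in>\<sigma>. \<bar>\<phi> i\<bar>))"
      using i by (simp add: add.assoc)
  qed
  \<comment> \<open>The index \<open>i\<close> of the last block is held fixed and
    \<open>\<bar>\<phi> i\<bar>\<close> joins the offset while the earlier blocks are
    treated.\<close>
  also have "\<dots> \<le> (\<Sum>i\<in>?I. \<Sum>\<sigma>\<in>selections k r. (\<Sum>\<epsilon>\<in>signs \<sigma>. SUP \<phi>\<in>T. (h \<phi> + \<bar>\<phi> i\<bar>) + (\<Sum>j<r * k. \<bar>\<phi> j\<bar>) / k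
    + 2 * (\<Sum>i\<in>\<sigma>. \<epsilon> i * \<phi> i)) / 2 ^ r)"
  proof (rule sum_mono, rule Suc.IH)
    fix i \<phi> assume "\<phi> \<in> T"
    thus "\<bar>h \<phi> + \<bar>\<phi> i\<bar>\<bar> \<le> H + U" using Suc.prems[of \<phi>] U[of \<phi> i] by linarith
  qed
  also have "\<dots> = (\<Sum>\<sigma>\<in>selections k r. (\<Sum>\<epsilon>\<in>signs \<sigma>. \<Sum>i\<in>?I. SUP \<phi>\<in>T. G \<sigma> \<epsilon> \<phi> + \<bar>\<phi> i\<bar>) / 2 ^ r)"
    unfolding sum_swap_average G_def by (simp only: add_ac)
  also have "\<dots> \<le> (\<Sum>\<sigma>\<in>selections k r. (\<Sum>\<epsilon>\<in>signs \<sigma>. \<Sum>i\<in>?I. (S (insert i \<sigma>) (\<epsilon>(i := 1))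
    + S (insert i \<sigma>) (\<epsilon>(i := -1))) / 2) / 2 ^ r)"
  \<comment> \<open>Now the selection and the signs of the earlier blocks are held fixed and the
    last block is symmetrized. The two suprema that arise are the two values of the new
    sign.\<close>
  proof (rule sum_mono, rule divide_right_mono, rule sum_mono)
    fix \<sigma> \<epsilon> assume s: "\<sigma> \<in> selections k r"
    have "(\<Sum>i\<in>?I. SUP \<phi>\<in>T. G \<sigma> \<epsilon> \<phi> + \<bar>\<phi> i\<bar>) \<le>
      (\<Sum>i\<in>?I. ((SUP \<phi>\<in>T. G \<sigma> \<epsilon> \<phi> + (\<Sum>j\<in>?I. \<bar>\<phi> j\<bar>) / card ?I + 2 * \<phi> i) +
             (SUP \<phi>\<in>T. G \<sigma> \<epsilon> \<phi> + (\<Sum>j\<in>?I. \<bar>\<phi> j\<bar>) / card ?I - 2 * \<phi> i)) / 2)"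
      by (rule SUP_symmetrization[where u = "\<lambda>i \<phi>. \<phi> i" and U = U and
            H = "H + r * k * U / k + 2 * (\<Sum>i\<in>\<sigma>. \<bar>\<epsilon> i\<bar> * U)", OF T])
         (rule Gb, assumption, rule U, assumption, simp)
    also have "\<dots> = (\<Sum>i\<in>?I. (S (insert i \<sigma>) (\<epsilon>(i := 1)) + S (insert i \<sigma>) (\<epsilon>(i := -1))) / 2)"
      by (intro sum.cong refl) (simp add: S_upd s)
    finally show "(\<Sum>i\<in>?I. SUP \<phi>\<in>T. G \<sigma> \<epsilon> \<phi> + \<bar>\<phi> i\<bar>) \<le>
      (\<Sum>i\<in>?I. (S (insert i \<sigma>) (\<epsilon>(i := 1)) + S (insert i \<sigma>) (\<epsilon>(i := -1))) / 2)" .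
  qed simp
  also have "\<dots> = (\<Sum>\<sigma>\<in>selections k (Suc r). (\<Sum>\<epsilon>\<in>signs \<sigma>. S \<sigma> \<epsilon>) / 2 ^ Suc r)"
  proof -
    have "(\<Sum>\<epsilon>\<in>signs (insert i \<sigma>). S (insert i \<sigma>) \<epsilon>) =
      (\<Sum>\<epsilon>\<in>signs \<sigma>. S (insert i \<sigma>) (\<epsilon>(i := 1)) + S (insert i \<sigma>) (\<epsilon>(i := -1)))"
      if "i \<in> ?I" "\<sigma> \<in> selections k r" for i \<sigma>
      using that selections_subset[of \<sigma> k r] by (intro sum_signs_insert) (auto intro: finite_subset)
    hence "(\<Sum>\<sigma>\<in>selections k (Suc r). (\<Sum>\<epsilon>\<in>signs \<sigma>. S \<sigma> \<epsilon>) / 2 ^ Suc r)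
      = (\<Sum>i\<in>?I. \<Sum>\<sigma>\<in>selections k r. (\<Sum>\<epsilon>\<in>signs \<sigma>. S (insert i \<sigma>) (\<epsilon>(i := 1)) + S (insert i \<sigma>) (\<epsilon>(i := -1))) / 2 ^ Suc r)"
      unfolding sum_selections_Suc by (intro sum.cong refl) simp
    thus ?thesis
      unfolding sum_swap_average by (simp add: sum_divide_distrib[symmetric])
  qed
  finally show ?case unfolding S_def .
qed

text \<open>A sign vector is the midpoint of its two extensions by one more sign, so by convexity
  further signs can only raise the average. This passes from the \<open>k\<close> indices of a
  selection to all \<open>k * k\<close>.\<close>

lemma signs_average_mono:
  fixes N :: "(nat \<Rightarrow> real) \<Rightarrow> real"
  assumes "even_sublinear N" "finite B" "A \<subseteq> B"
  shows "(\<Sum>\<epsilon>\<in>signs A. N \<epsilon>) / 2 ^ card A \<le> (\<Sum>\<epsilon>\<in>signs B. N \<epsilon>) / 2 ^ card B"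
proof -
  interpret even_sublinear N by fact
  have "(\<Sum>\<epsilon>\<in>signs A. N \<epsilon>) / 2 ^ card A \<le> (\<Sum>\<epsilon>\<in>signs (A \<union> D). N \<epsilon>) / 2 ^ card (A \<union> D)"
    if "finite D" "finite A" "D \<inter> A = {}" for D
    using that
  proof (induction D rule: finite_induct)
    case (insert i D)
    let ?B = "A \<union> D"
    have B: "finite ?B" "i \<notin> ?B" using insert by auto
    have "(\<Sum>\<epsilon>\<in>signs ?B. N \<epsilon>) \<le> (\<Sum>\<epsilon>\<in>signs ?B. (N (\<epsilon>(i := 1)) + N (\<epsilon>(i := -1))) / 2)"
    proof (rule sum_mono)
      fix \<epsilon> assume "\<epsilon> \<in> signs ?B"
      hence "2 *\<^sub>R \<epsilon> = \<epsilon>(i := 1) + \<epsilon>(i := -1)" using B(2) by (auto simp: signs_def fun_eq_iff)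
      thus "N \<epsilon> \<le> (N (\<epsilon>(i := 1)) + N (\<epsilon>(i := -1))) / 2"
        using triangle[of "\<epsilon>(i := 1)" "\<epsilon>(i := -1)"] scale[of 2 \<epsilon>] by simp
    qed
    also have "\<dots> = (\<Sum>\<epsilon>\<in>signs (insert i ?B). N \<epsilon>) / 2"
      using sum_signs_insert[OF B, of N] by (simp add: sum_divide_distrib)
    finally have "(\<Sum>\<epsilon>\<in>signs ?B. N \<epsilon>) / 2 ^ card ?B
      \<le> (\<Sum>\<epsilon>\<in>signs (insert i ?B). N \<epsilon>) / 2 ^ card (insert i ?B)"
      using B by (simp add: field_simps)
    thus ?case using insert by auto
  qed simp
  from this[of "B - A"] show ?thesis using assms by (auto simp: Un_absorb1 intro: finite_subset)
qed

text \<open>The Euclidean bound makes \<open>N\<close> blind to coordinates from \<open>n\<close>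
  on. This reconciles functionals on all sequences with functions of \<open>n\<close>
  variables.\<close>

lemma eq_of_L2_bounded:
  assumes "sublinear N" "\<And>a. N a \<le> C * L2_set a {..<n}" "\<And>i. i < n \<Longrightarrow> a i = b i"
  shows "N a = N b"
proof -
  interpret sublinear N by fact
  have "L2_set (a - b) {..<n} = 0" "L2_set (b - a) {..<n} = 0"
    using assms(3) unfolding L2_set_def by simp_all
  hence "N (a - b) \<le> 0" "N (b - a) \<le> 0" using assms(2)[of "a - b"] assms(2)[of "b - a"] by simp_all
  thus ?thesis using le_add_diff[of a b] le_add_diff[of b a] by simp
qed

lemma sum_unit_seq_apply: "(\<Sum>i<n. c i *\<^sub>R unit_seq i) j = (if j < n then c j else 0)"
proof -
  have "(\<Sum>i<n. c i *\<^sub>R unit_seq i) j = (\<Sum>i<n. if i = j then c i else 0)"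
    unfolding sum_fun_apply by (rule sum.cong) (simp_all add: unit_seq_def)
  thus ?thesis by simp
qed

lemma ex_supporting_functional:
  fixes N :: "(nat \<Rightarrow> real) \<Rightarrow> real"
  assumes "sublinear N" "\<And>a. N a \<le> C * L2_set a {..<n}"
  shows "\<exists>\<phi>. (\<forall>a. (\<Sum>i<n. \<phi> i * a i) \<le> N a) \<and> (\<forall>i\<ge>n. \<phi> i = 0) \<and> (\<Sum>i<n. \<phi> i * b i) = N b"
proof -
  interpret sublinear N by fact
  \<comment> \<open>The vector \<open>b\<close> comes first because the functional is norming there;
    the coefficients at the unit vectors that follow are the functional itself.\<close>
  define v where "v i = (case i of 0 \<Rightarrow> b | Suc j \<Rightarrow> unit_seq j)" for i
  obtain c where c: "c 0 = N b" "\<And>a. (\<Sum>i\<le>n. a i * c i) \<le> N (\<Sum>i\<le>n. a i *\<^sub>R v i)"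
    using ex_dominated_coeffs[of v n] by (auto simp: v_def)
  define \<phi> where "\<phi> i = (if i < n then c (Suc i) else 0)" for i
  have dom: "t * N b + (\<Sum>i<n. \<phi> i * a i) \<le> N (t *\<^sub>R b + a)" for t a
  proof -
    define \<alpha> where "\<alpha> i = (case i of 0 \<Rightarrow> t | Suc j \<Rightarrow> a j)" for i
    have "t * N b + (\<Sum>i<n. \<phi> i * a i) = (\<Sum>i\<le>n. \<alpha> i * c i)"
      unfolding sum.atMost_shift by (simp add: \<alpha>_def \<phi>_def c(1) mult.commute)
    also have "\<dots> \<le> N (\<Sum>i\<le>n. \<alpha> i *\<^sub>R v i)" by (rule c(2))
    also have "(\<Sum>i\<le>n. \<alpha> i *\<^sub>R v i) = t *\<^sub>R b + (\<Sum>i<n. a i *\<^sub>R unit_seq i)"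
      unfolding sum.atMost_shift by (simp add: \<alpha>_def v_def)
    also have "N \<dots> = N (t *\<^sub>R b + a)"
      by (rule eq_of_L2_bounded[OF assms]) (simp add: sum_unit_seq_apply)
    finally show ?thesis .
  qed
  \<comment> \<open>The family is dependent: \<open>b\<close> minus its expansion is invisible to
    \<open>N\<close>. The bound for this relation and for its negative forces the functional to take
    the value \<open>N b\<close> at \<open>b\<close>.\<close>
  have "N b - (\<Sum>i<n. \<phi> i * b i) \<le> 0" "- N b + (\<Sum>i<n. \<phi> i * b i) \<le> 0"
    using dom[of 1 "-b"] dom[of "-1" b] by (simp_all add: sum_negf)
  thus ?thesis using dom[of 0] by (intro exI[of _ \<phi>]) (auto simp: \<phi>_def)
qed

text \<open>By duality \<open>N\<close> of a combination with coefficients in the cube is at most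
  the supremum of \<open>\<Sum>i\<in>\<sigma>. \<bar>\<phi> i\<bar>\<close> over the dual ball
  \<open>T\<close>. Its average over selections is a mean term plus twice a sign average, and some
  selection does no worse than the average.\<close>

lemma exists_cube_of_small_sign_average:
  assumes N: "even_sublinear N" and k: "0 < k" and L2: "\<And>a. N a \<le> L2_set a {..<k * k}"
    and M: "(\<Sum>\<epsilon>\<in>signs {..<k * k}. N \<epsilon>) / 2 ^ (k * k) \<le> M"
  shows "\<exists>f. (\<forall>b<k. f b < k * k) \<and> cube_bounded N k (\<lambda>b. unit_seq (f b)) (1 + 2 * M)"
proof -
  interpret even_sublinear N by fact
  define n where "n = k * k"
  define T where "T = {\<phi>. (\<forall>a. (\<Sum>i<n. \<phi> i * a i) \<le> N a) \<and> (\<forall>i\<ge>n. \<phi> i = 0)}"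
  have support: "\<exists>\<phi>\<in>T. (\<Sum>i<n. \<phi> i * b i) = N b" for b
    using ex_supporting_functional[OF sublinear_axioms, of 1 n b] L2 by (auto simp: T_def n_def)
  hence T: "T \<noteq> {}" by blast
  have TL2: "L2_set \<phi> {..<n} \<le> 1" if "\<phi> \<in> T" for \<phi>
  proof -
    have "(L2_set \<phi> {..<n})\<^sup>2 = (\<Sum>i<n. \<phi> i * \<phi> i)"
      by (simp add: L2_set_def sum_nonneg power2_eq_square)
    also have "\<dots> \<le> L2_set \<phi> {..<n}" using that L2[of \<phi>] by (auto simp: T_def n_def intro: order_trans)
    finally have "L2_set \<phi> {..<n} * (L2_set \<phi> {..<n} - 1)
      \<le> 0" by (simp add: power2_eq_square algebra_simps)
    thus ?thesis using L2_set_nonneg[of \<phi> "{..<n}"] by (auto simp: mult_le_0_iff)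
  qed
  have T1: "\<bar>\<phi> i\<bar> \<le> 1" if "\<phi> \<in> T" for \<phi> i
  proof (cases "i < n")
    case True
    have "\<bar>\<phi> i\<bar> \<le> L2_set (\<lambda>i. \<bar>\<phi> i\<bar>) {..<n}" using True by (intro member_le_L2_set) auto
    also have "\<dots> = L2_set \<phi> {..<n}" by (simp add: L2_set_def)
    finally show ?thesis using TL2[OF that] by simp
  qed (use that in \<open>simp add: T_def\<close>)
  \<comment> \<open>The dual ball lies in the Euclidean ball, so Cauchy-Schwarz bounds the sum of
    moduli by \<open>sqrt n = k\<close>. Division by the block length \<open>k\<close> makes the
    mean term at most 1; this is why \<open>k\<close> vectors are chosen from
    \<open>k * k\<close>.\<close>
  have Tsum: "(\<Sum>j<n. \<bar>\<phi> j\<bar>) \<le> k" if "\<phi> \<in> T" for \<phi>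
  proof -
    have "(\<Sum>j<n. \<bar>\<phi> j\<bar>) = (\<Sum>j<n. \<bar>\<phi> j\<bar> * \<bar>1\<bar>)" by simp
    also have "\<dots> \<le> L2_set \<phi> {..<n} * L2_set (\<lambda>_. 1) {..<n}" by (rule L2_set_mult_ineq)
    also have "L2_set (\<lambda>_. 1) {..<n} = k" by (simp add: L2_set_def n_def)
    also have "L2_set \<phi> {..<n} * real k \<le> 1 * real k" using TL2[OF that] by (intro mult_right_mono) auto
    finally show ?thesis by simp
  qed
  have le: "(SUP \<phi>\<in>T. 0 + (\<Sum>j<k * k. \<bar>\<phi> j\<bar>) / k + 2 * (\<Sum>i\<in>\<sigma>. \<epsilon> i * \<phi> i)) \<le> 1 + 2 * N \<epsilon>"
    if s: "\<sigma> \<in> selections k k" and e: "\<epsilon> \<in> signs \<sigma>" for \<sigma> \<epsilon>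
  proof (rule cSUP_least[OF T])
    fix \<phi> assume p: "\<phi> \<in> T"
    have "(\<Sum>i\<in>\<sigma>. \<epsilon> i * \<phi> i) = (\<Sum>i<n. \<phi> i * \<epsilon> i)"
      using selections_subset[OF s] e
      by (intro sum.mono_neutral_cong_left) (auto simp: n_def signs_def)
    also have "\<dots> \<le> N \<epsilon>" using p by (simp add: T_def)
    finally have "(\<Sum>i\<in>\<sigma>. \<epsilon> i * \<phi> i) \<le> N \<epsilon>" .
    moreover have "(\<Sum>j<k * k. \<bar>\<phi> j\<bar>) / k \<le> 1" using Tsum[OF p] k by (simp add: n_def)
    ultimately show "0 + (\<Sum>j<k * k. \<bar>\<phi> j\<bar>) / k + 2 * (\<Sum>i\<in>\<sigma>. \<epsilon> i * \<phi> i) \<le> 1 + 2 * N \<epsilon>" by simp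
  qed
  have "(\<Sum>\<sigma>\<in>selections k k. SUP \<phi>\<in>T. 0 + (\<Sum>i\<in>\<sigma>. \<bar>\<phi> i\<bar>)) \<le>
    (\<Sum>\<sigma>\<in>selections k k. (\<Sum>\<epsilon>\<in>signs \<sigma>. SUP \<phi>\<in>T. 0 + (\<Sum>j<k * k. \<bar>\<phi> j\<bar>) / k + 2 * (\<Sum>i\<in>\<sigma>. \<epsilon> i * \<phi> i)) / 2 ^ k)"
    by (rule sum_SUP_selections_le[where H = 0 and U = 1, OF T]) (rule T1, assumption, simp)
  also have "\<dots> \<le> (\<Sum>\<sigma>\<in>selections k k. 1 + 2 * M)"
  proof (rule sum_mono)
    fix \<sigma> assume s: "\<sigma> \<in> selections k k"
    have sig: "\<sigma> \<subseteq> {..<k * k}" "card \<sigma> = k" "finite \<sigma>"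
      using selections_subset[OF s] card_selection[OF s] by (auto intro: finite_subset)
    have "(\<Sum>\<epsilon>\<in>signs \<sigma>. SUP \<phi>\<in>T. 0 + (\<Sum>j<k * k. \<bar>\<phi> j\<bar>) / k + 2 * (\<Sum>i\<in>\<sigma>. \<epsilon> i * \<phi> i)) / 2 ^ k
      \<le> (\<Sum>\<epsilon>\<in>signs \<sigma>. 1 + 2 * N \<epsilon>) / 2 ^ k"
      by (intro divide_right_mono sum_mono le s) auto
    also have "\<dots> = 1 + 2 * ((\<Sum>\<epsilon>\<in>signs \<sigma>. N \<epsilon>) / 2 ^ card \<sigma>)"
      using sig by (simp add: sum.distrib card_signs sum_distrib_left[symmetric] add_divide_distrib)
    also have "\<dots> \<le> 1 + 2 * M"
      using signs_average_mono[OF N _ sig(1)] M by simp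
    finally show "(\<Sum>\<epsilon>\<in>signs \<sigma>. SUP \<phi>\<in>T. 0 + (\<Sum>j<k * k. \<bar>\<phi> j\<bar>) / k + 2 * (\<Sum>i\<in>\<sigma>. \<epsilon> i * \<phi> i)) / 2 ^ k \<le> 1
      + 2 * M" .
  qed
  finally obtain \<sigma> where s: "\<sigma> \<in> selections k k" "(SUP \<phi>\<in>T. 0 + (\<Sum>i\<in>\<sigma>. \<bar>\<phi> i\<bar>)) \<le> 1 + 2 * M"
    using sum_strict_mono[of "selections k k" "\<lambda>_. 1 + 2 * M" "\<lambda>\<sigma>. SUP \<phi>\<in>T. 0 + (\<Sum>i\<in>\<sigma>. \<bar>\<phi> i\<bar>)"]
      finite_selections selections_nonempty[OF k] by (meson not_le)
  have sig: "\<sigma> \<subseteq> {..<k * k}" "card \<sigma> = k" "finite \<sigma>"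
    using selections_subset[OF s(1)] card_selection[OF s(1)] by (auto intro: finite_subset)
  obtain f where f: "bij_betw f {..<k} \<sigma>"
    using ex_bij_betw_nat_finite[OF sig(3)] sig(2) by (auto simp: lessThan_atLeast0)
  have "N (\<Sum>b<k. a b *\<^sub>R unit_seq (f b)) \<le> 1 + 2 * M" if a: "\<forall>b<k. \<bar>a b\<bar> \<le> 1" for a
  proof -
    define x where "x = (\<Sum>b<k. a b *\<^sub>R unit_seq (f b))"
    obtain \<phi> where p: "\<phi> \<in> T" "(\<Sum>i<n. \<phi> i * x i) = N x" using support by blast
    have "(\<Sum>i<n. \<phi> i * x i) = (\<Sum>i<n. \<Sum>b<k. if i = f b then \<phi> i * a b else 0)"
      unfolding x_def sum_fun_apply sum_distrib_left
      by (intro sum.cong refl) (auto simp: unit_seq_def)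
    also have "\<dots> = (\<Sum>b<k. \<Sum>i<n. if i = f b then \<phi> i * a b else 0)" by (rule sum.swap)
    also have "\<dots> = (\<Sum>b<k. \<phi> (f b) * a b)"
      using f sig(1) by (intro sum.cong) (auto simp: bij_betw_def n_def)
    also have "\<dots> \<le> (\<Sum>b<k. \<bar>\<phi> (f b)\<bar>)"
    proof (rule sum_mono)
      fix b assume "b \<in> {..<k}"
      hence "\<bar>\<phi> (f b)\<bar> * \<bar>a b\<bar> \<le> \<bar>\<phi> (f b)\<bar> * 1" using a by (intro mult_left_mono) auto
      thus "\<phi> (f b) * a b \<le> \<bar>\<phi> (f b)\<bar>" by (metis abs_ge_self abs_mult mult.right_neutral order_trans)
    qed
    also have "\<dots> = 0 + (\<Sum>i\<in>\<sigma>. \<bar>\<phi> i\<bar>)" using sum.reindex_bij_betw[OF f, of "\<lambda>i. \<bar>\<phi> i\<bar>"] by simp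
    also have "\<dots> \<le> (SUP \<phi>\<in>T. 0 + (\<Sum>i\<in>\<sigma>. \<bar>\<phi> i\<bar>))"
    proof (rule cSUP_upper[OF p(1)])
      show "bdd_above ((\<lambda>\<phi>. 0 + (\<Sum>i\<in>\<sigma>. \<bar>\<phi> i\<bar>)) ` T)"
        using T1 by (intro bdd_aboveI2[where M = "\<Sum>i\<in>\<sigma>. 1"]) (auto intro!: sum_mono simp del: sum_constant)
    qed
    finally show ?thesis using s(2) p(2) by (simp add: x_def)
  qed
  thus ?thesis using f sig(1) by (intro exI[of _ f]) (auto simp: cube_bounded_def bij_betw_def)
qed

section \<open>Gaussian concentration\<close>

abbreviation gauss :: "real measure"
  where "gauss \<equiv> density lborel (\<lambda>x. ennreal (std_normal_density x))"

lemma prob_space_gauss: "prob_space gauss"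
  by (rule prob_space_normal_density) simp

section \<open>Level sets on the line\<close>

lemma nn_integral_layer_min:
  fixes g :: ennreal
  assumes c: "0 < c"
  shows "(\<integral>\<^sup>+t. indicator {0<..<1} t * indicator {t. ennreal (c * t) < g} t \<partial>lborel)
    = min 1 (g / ennreal c)"
proof -
  have "{0<..<1} \<inter> {t. ennreal (c * t) < g} = {0<..<enn2real (min 1 (g / ennreal c))}"
  proof (cases g)
    case (real r)
    have "(ennreal (c * t) < g) = (t < r / c)" if "0 < t" for t
      using that c real by (simp add: ennreal_less_iff field_simps)
    moreover have "min 1 (g / ennreal c) = ennreal (min 1 (r / c))"
      using c real by (simp add: divide_ennreal min_def)
    moreover have "0 \<le> min 1 (r / c)" using c real by simp
    ultimately show ?thesis by auto
  next
    case top
    thus ?thesis using c by (auto simp: ennreal_top_divide)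
  qed
  moreover have "(\<integral>\<^sup>+t. indicator {0<..<1} t * indicator {t. ennreal (c * t) < g} t \<partial>lborel)
    = (\<integral>\<^sup>+t. indicator ({0<..<1} \<inter> {t. ennreal (c * t) < g}) t \<partial>lborel)"
    by (intro nn_integral_cong) (auto simp: indicator_def)
  moreover have "min 1 (g / ennreal c) < Orderings.top"
    by (rule le_less_trans[OF min.cobounded1 ennreal_one_less_top])
  ultimately show ?thesis by (simp add: ennreal_enn2real_if)
qed

text \<open>The layer cake formula up to height \<open>c\<close>. The minimum appears because only
  levels below \<open>c\<close> are counted: it is inert for a function bounded by \<open>c\<close>
  and is estimated away for the Gaussian.\<close>

lemma nn_integral_level_sets:
  fixes f :: "real \<Rightarrow> ennreal"
  assumes [measurable]: "f \<in> borel_measurable borel" and c: "0 < c"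
  shows "(\<integral>\<^sup>+t. indicator {0<..<1} t * emeasure lborel {x. ennreal (c * t) < f x} \<partial>lborel)
    = (\<integral>\<^sup>+x. min 1 (f x / ennreal c) \<partial>lborel)"
proof -
  have "(\<integral>\<^sup>+t. indicator {0<..<1} t * emeasure lborel {x. ennreal (c * t) < f x} \<partial>lborel)
    = (\<integral>\<^sup>+t. (\<integral>\<^sup>+x. indicator {0<..<1} t * indicator {x. ennreal (c * t) < f x} x \<partial>lborel) \<partial>lborel)"
  proof (intro nn_integral_cong)
    fix t :: real
    have [measurable]: "{x. ennreal (c * t) < f x} \<in> sets borel" by measurable
    show "indicator {0<..<1} t * emeasure lborel {x. ennreal (c * t) < f x} =
      (\<integral>\<^sup>+x. indicator {0<..<1} t * indicator {x. ennreal (c * t) < f x} x \<partial>lborel)"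
      by (subst nn_integral_cmult) auto
  qed
  also have "\<dots> = (\<integral>\<^sup>+x. (\<integral>\<^sup>+t. indicator {0<..<1} t
    * indicator {x. ennreal (c * t) < f x} x \<partial>lborel) \<partial>lborel)"
    by (rule lborel_pair.Fubini') measurable
  also have "\<dots> = (\<integral>\<^sup>+x. (\<integral>\<^sup>+t. indicator {0<..<1} t
    * indicator {t. ennreal (c * t) < f x} t \<partial>lborel) \<partial>lborel)"
    by (intro nn_integral_cong) (simp add: indicator_def)
  finally show ?thesis using nn_integral_layer_min[OF c] by simp
qed

text \<open>Brunn-Minkowski on the line for a sumset contained in an interval of length
  \<open>4 * \<rho>\<close>. Replacing both sets by the intervals between their infima and suprema
  preserves the constraint and avoids measuring the sumset.\<close>

lemma emeasure_add_le_of_sum_bounded: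
  fixes A B :: "real set"
  assumes [measurable]: "A \<in> sets borel" "B \<in> sets borel" and ne: "A \<noteq> {}" "B \<noteq> {}"
    and le: "\<And>x y. x \<in> A \<Longrightarrow> y \<in> B \<Longrightarrow> \<bar>x + y\<bar> \<le> 2 * \<rho>"
  shows "emeasure lborel A + emeasure lborel B \<le> 2 * ennreal (2 * \<rho>)"
proof -
  obtain x0 y0 where xy: "x0 \<in> A" "y0 \<in> B" using ne by blast
  have bA: "bdd_above A" "bdd_below A"
    using le[OF _ xy(2)] by (auto intro!: bdd_aboveI[of _ "2 * \<rho> - y0"] bdd_belowI[of _ "-2 * \<rho>
      - y0"]) (smt (verit))+
  have bB: "bdd_above B" "bdd_below B"
    using le[OF xy(1)] by (auto intro!: bdd_aboveI[of _ "2 * \<rho> - x0"] bdd_belowI[of _ "-2 * \<rho>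
      - x0"]) (smt (verit))+
  have em: "emeasure lborel S \<le> ennreal (Sup S - Inf S)" "Inf S \<le> Sup S"
    if "S \<in> sets borel" "S \<noteq> {}" "bdd_above S" "bdd_below S" for S :: "real set"
  proof -
    show *: "Inf S \<le> Sup S" using that by (intro cInf_le_cSup)
    have "S \<subseteq> {Inf S..Sup S}" using that by (auto intro: cInf_lower cSup_upper)
    hence "emeasure lborel S \<le> emeasure lborel {Inf S..Sup S}" by (intro emeasure_mono) auto
    thus "emeasure lborel S \<le> ennreal (Sup S - Inf S)" using * by simp
  qed
  have "Sup A \<le> 2 * \<rho> - Sup B"
  proof (intro cSup_least ne)
    fix x assume x: "x \<in> A"
    have "Sup B \<le> 2 * \<rho> - x" using le[OF x] by (intro cSup_least ne) (smt (verit))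
    thus "x \<le> 2 * \<rho> - Sup B" by simp
  qed
  moreover have "- 2 * \<rho> - Inf B \<le> Inf A"
  proof (intro cInf_greatest ne)
    fix x assume x: "x \<in> A"
    have "- 2 * \<rho> - x \<le> Inf B" using le[OF x] by (intro cInf_greatest ne) (smt (verit))
    thus "- 2 * \<rho> - Inf B \<le> x" by simp
  qed
  ultimately have "(Sup A - Inf A) + (Sup B - Inf B) \<le> 2 * (2 * \<rho>)" by simp
  moreover have "emeasure lborel A + emeasure lborel B \<le> ennreal (Sup A - Inf A)
    + ennreal (Sup B - Inf B)"
    using em[OF _ ne(1) bA] em[OF _ ne(2) bB] by (intro add_mono) auto
  moreover have "ennreal (Sup A - Inf A) + ennreal (Sup B - Inf B)
    = ennreal ((Sup A - Inf A) + (Sup B - Inf B))"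
    using em[OF _ ne(1) bA] em[OF _ ne(2) bB] by (simp add: ennreal_plus)
  moreover have "0 \<le> \<rho>" using le[OF xy] by linarith
  ultimately show ?thesis
    by (metis (no_types, lifting) ennreal_leI ennreal_mult' ennreal_numeral order_trans zero_le_numeral mult_nonneg_nonneg)
qed

lemma mult_le_of_add_le:
  fixes P Q H :: ennreal
  assumes "P + Q \<le> 2 * H" "H < Orderings.top"
  shows "P * Q \<le> H * H"
proof -
  have "2 * H < Orderings.top" using assms(2) by (simp add: ennreal_mult_less_top)
  hence "P < Orderings.top" "Q
    < Orderings.top" using assms(1) by (auto intro: le_less_trans[OF _ le_less_trans[OF assms(1)]])
  then obtain p q h where r: "P = ennreal p" "Q = ennreal q" "H = ennreal h" "0 \<le> p" "0 \<le> q" "0 \<le> h"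
    using assms(2) by (metis ennreal_cases less_irrefl)
  have "p + q \<le> 2 * h"
    using assms(1) r by (simp flip: ennreal_plus ennreal_mult' ennreal_numeral add: ennreal_le_iff)
  moreover have "4 * (p * q) \<le> (p + q) * (p + q)"
    using zero_le_square[of "p - q"] by (simp add: algebra_simps)
  moreover have "(p + q) * (p + q) \<le> (2 * h) * (2 * h)"
    using r calculation by (intro mult_mono) auto
  ultimately have "p * q \<le> h * h" by simp
  thus ?thesis using r by (simp flip: ennreal_mult')
qed

text \<open>The one-dimensional Prekopa-Leindler inequality against the Gaussian, whose level sets are
  intervals: the level sets of the two functions, normalised to supremum 1, satisfy the trivial
  Brunn-Minkowski inequality on the line.\<close>

lemma prekopa_leindler_gaussian:
  fixes \<phi> \<psi> :: "real \<Rightarrow> ennreal"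
  assumes [measurable]: "\<phi> \<in> borel_measurable borel" "\<psi> \<in> borel_measurable borel"
    and le: "\<And>x y. \<phi> x * \<psi> y \<le> ennreal (exp (- (x + y)\<^sup>2 / 4))"
    and fin: "(\<integral>\<^sup>+x. ennreal (exp (- x\<^sup>2 / 2)) \<partial>lborel) < Orderings.top"
  shows "(\<integral>\<^sup>+x. \<phi> x \<partial>lborel) * (\<integral>\<^sup>+x. \<psi> x \<partial>lborel) \<le>
    (\<integral>\<^sup>+x. ennreal (exp (- x\<^sup>2 / 2)) \<partial>lborel) * (\<integral>\<^sup>+x. ennreal (exp (- x\<^sup>2 / 2)) \<partial>lborel)"
proof -
  define a b where "a = (SUP x. \<phi> x)" and "b = (SUP x. \<psi> x)"
  define H where "H = (\<integral>\<^sup>+x. ennreal (exp (- x\<^sup>2 / 2)) \<partial>lborel)"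
  have up: "\<phi> x \<le> a" "\<psi> x \<le> b" for x by (auto simp: a_def b_def intro: SUP_upper)
  have "a * b \<le> 1"
  proof -
    have "\<phi> x * b \<le> 1" for x
      unfolding b_def SUP_mult_left_ennreal
    proof (rule SUP_least)
      fix y
      have "exp (- (x + y)\<^sup>2 / 4) \<le> 1" by simp
      hence "ennreal (exp (- (x + y)\<^sup>2 / 4)) \<le> 1" by (metis ennreal_1 ennreal_leI)
      thus "\<phi> x * \<psi> y \<le> 1" using le order_trans by blast
    qed
    thus ?thesis unfolding a_def SUP_mult_right_ennreal by (intro SUP_least)
  qed
  show ?thesis
  proof (cases "a = 0 \<or> b = 0")
    case True
    hence "(\<forall>x. \<phi> x = 0) \<or> (\<forall>x. \<psi> x = 0)" using up by (metis le_zero_eq)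
    hence "(\<integral>\<^sup>+x. \<phi> x \<partial>lborel) = 0 \<or> (\<integral>\<^sup>+x. \<psi> x \<partial>lborel) = 0" by auto
    thus ?thesis by auto
  next
    case False
    hence "a < Orderings.top" "b < Orderings.top" using \<open>a * b \<le> 1\<close>
      by (auto simp: less_top[symmetric] ennreal_top_mult ennreal_mult_top top_unique)
    then obtain \<alpha> \<beta> where ab: "a = ennreal \<alpha>" "b = ennreal \<beta>" "0 < \<alpha>" "0 < \<beta>"
      using False by (metis ennreal_cases less_irrefl ennreal_0 order_le_less)
    define P Q where "P = (\<integral>\<^sup>+x. \<phi> x \<partial>lborel) / a" and "Q = (\<integral>\<^sup>+x. \<psi> x \<partial>lborel) / b"
    \<comment> \<open>The geometric mean of the two suprema is the right normalisation of the
      Gaussian: if \<phi> exceeds \<open>\<alpha> * t\<close> at \<open>x\<close> and \<psi> exceeds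
      \<open>\<beta> * t\<close> at \<open>y\<close>, then \<open>exp (- z\<^sup>2 / 2)\<close> is
      at least \<open>g * t\<close> at the midpoint \<open>z\<close> of \<open>x\<close> and
      \<open>y\<close>.\<close>
    define g where "g = sqrt (\<alpha> * \<beta>)"
    have g: "0 < g" "g * g = \<alpha> * \<beta>" using ab by (simp_all add: g_def)
    have level: "(\<integral>\<^sup>+t. indicator {0<..<1} t * emeasure lborel {x. ennreal (c * t) < f x} \<partial>lborel)
      = (\<integral>\<^sup>+x. f x \<partial>lborel) / ennreal c"
      if [measurable]: "f \<in> borel_measurable borel" and "0 < c" "\<And>x. f x
        \<le> ennreal c" for f :: "real \<Rightarrow> ennreal" and c
    proof -
      have "f x / ennreal c \<le> 1" for x
        using that(2) that(3)[of x] by (simp add: divide_le_posI_ennreal)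
      hence "(\<integral>\<^sup>+x. min 1 (f x / ennreal c) \<partial>lborel) = (\<integral>\<^sup>+x. f x / ennreal c \<partial>lborel)"
        by (intro nn_integral_cong) (simp add: min_def antisym)
      thus ?thesis using nn_integral_level_sets[of f c] that by (simp add: nn_integral_divide)
    qed
    have Peq: "P = (\<integral>\<^sup>+t. indicator {0<..<1} t * emeasure lborel {x. ennreal (\<alpha> * t) < \<phi> x} \<partial>lborel)"
      using ab up level[of \<phi> \<alpha>] by (simp add: P_def)
    have Qeq: "Q = (\<integral>\<^sup>+t. indicator {0<..<1} t * emeasure lborel {x. ennreal (\<beta> * t) < \<psi> x} \<partial>lborel)"
      using ab up level[of \<psi> \<beta>] by (simp add: Q_def)
    have point: "emeasure lborel {x. ennreal (\<alpha> * t) < \<phi> x} + emeasure lborel {x. ennreal (\<beta> * t) < \<psi> x}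
      \<le> 2 * emeasure lborel {x. ennreal (g * t) < ennreal (exp (- x\<^sup>2 / 2))}" if t: "0 < t" "t < 1" for t
    proof -
      define \<tau> where "\<tau> = g * t"
      have tau: "0 < \<tau>" using g t by (simp add: \<tau>_def)
      \<comment> \<open>Half the length of the Gaussian level set at height \<tau>;
        \<open>max 0\<close> makes it visibly nonnegative.\<close>
      define \<rho> where "\<rho> = sqrt (max 0 (- 2 * ln \<tau>))"
      have "ennreal (\<alpha> * t) < a" using ab t by (simp add: ennreal_less_iff)
      hence A: "{x. ennreal (\<alpha> * t) < \<phi> x} \<noteq> {}" unfolding a_def less_SUP_iff by auto
      have "ennreal (\<beta> * t) < b" using ab t by (simp add: ennreal_less_iff)
      hence B: "{x. ennreal (\<beta> * t) < \<psi> x} \<noteq> {}" unfolding b_def less_SUP_iff by auto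
      have bound: "\<bar>x + y\<bar> \<le> 2 * \<rho>" "\<tau> \<le> 1" if x: "ennreal (\<alpha> * t) < \<phi> x" and y: "ennreal (\<beta> * t)
        < \<psi> y" for x y
      proof -
        have "ennreal (\<tau> * \<tau>) = ennreal (\<alpha> * t) * ennreal (\<beta> * t)"
          using ab t g by (simp flip: ennreal_mult' add: \<tau>_def algebra_simps)
        also have "\<dots> \<le> \<phi> x * \<psi> y" using x y by (intro mult_mono) auto
        also have "\<dots> \<le> ennreal (exp (- (x + y)\<^sup>2 / 4))" by (rule le)
        finally have *: "\<tau> * \<tau> \<le> exp (- (x + y)\<^sup>2 / 4)" by (simp add: ennreal_le_iff)
        have "2 * ln \<tau> = ln (\<tau> * \<tau>)" using tau by (simp add: ln_mult)
        also have "\<dots> \<le> - (x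
          + y)\<^sup>2 / 4" using * tau by (metis ln_exp ln_le_cancel_iff exp_gt_zero mult_pos_pos)
        finally have **: "(x + y)\<^sup>2 \<le> 4 * (- 2 * ln \<tau>)" by simp
        have "\<bar>x + y\<bar>\<^sup>2 \<le> 4 * max 0 (- 2 * ln \<tau>)"
          unfolding power2_abs by (rule order_trans[OF **]) simp
        hence "\<bar>x + y\<bar> \<le> sqrt (4 * max 0 (- 2 * ln \<tau>))" by (rule real_le_rsqrt)
        thus "\<bar>x + y\<bar> \<le> 2 * \<rho>" by (simp add: \<rho>_def real_sqrt_mult)
        have "0 \<le> - 2 * ln \<tau>" using ** zero_le_power2[of "x + y"] by linarith
        thus "\<tau> \<le> 1" using tau by simp
      qed
      have "emeasure lborel {x. ennreal (\<alpha> * t) < \<phi> x} + emeasure lborel {x. ennreal (\<beta> * t) < \<psi> x} \<le> 2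
        * ennreal (2 * \<rho>)"
        using bound by (intro emeasure_add_le_of_sum_bounded A B) auto
      also have "ennreal (2 * \<rho>) = emeasure lborel {- \<rho><..<\<rho>}" by (simp add: \<rho>_def)
      also have "\<dots> \<le> emeasure lborel {x. ennreal (g * t) < ennreal (exp (- x\<^sup>2 / 2))}"
      proof (rule emeasure_mono)
        show "{- \<rho><..<\<rho>} \<subseteq> {x. ennreal (g * t) < ennreal (exp (- x\<^sup>2 / 2))}"
        proof safe
          fix x assume "x \<in> {- \<rho><..<\<rho>}"
          hence "\<bar>x\<bar> < sqrt (max 0 (- 2 * ln \<tau>))" by (auto simp: \<rho>_def)
          hence "x\<^sup>2 < max 0 (- 2 * ln \<tau>)"
            by (metis abs_ge_zero power2_abs real_sqrt_abs real_sqrt_less_iff)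
          hence "x\<^sup>2 < - 2 * ln \<tau>" by (smt (verit) zero_le_power2)
          hence "ln \<tau> < - x\<^sup>2 / 2" by simp
          hence "\<tau> < exp (- x\<^sup>2 / 2)" using tau by (metis exp_less_cancel_iff exp_ln)
          thus "ennreal (g * t)
            < ennreal (exp (- x\<^sup>2 / 2))" using tau by (simp add: \<tau>_def ennreal_less_iff)
        qed
      qed simp
      finally show ?thesis by (simp add: mult_left_mono)
    qed
    have "P + Q = (\<integral>\<^sup>+t. indicator {0<..<1} t * emeasure lborel {x. ennreal (\<alpha> * t) < \<phi> x} +
      indicator {0<..<1} t * emeasure lborel {x. ennreal (\<beta> * t) < \<psi> x} \<partial>lborel)"
      unfolding Peq Qeq by (rule nn_integral_add[symmetric]) measurable
    also have "\<dots> \<le> (\<integral>\<^sup>+t. 2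
      * (indicator {0<..<1} t
      * emeasure lborel {x. ennreal (g * t) < ennreal (exp (- x\<^sup>2 / 2))}) \<partial>lborel)"
      using point by (intro nn_integral_mono) (auto simp: indicator_def)
    also have "\<dots> = 2
      * (\<integral>\<^sup>+t. indicator {0<..<1} t
      * emeasure lborel {x. ennreal (g * t) < ennreal (exp (- x\<^sup>2 / 2))} \<partial>lborel)"
      by (rule nn_integral_cmult) measurable
    also have "\<dots> = 2 * (\<integral>\<^sup>+x. min 1 (ennreal (exp (- x\<^sup>2 / 2)) / ennreal g) \<partial>lborel)"
      using g by (subst nn_integral_level_sets) auto
    also have "\<dots> \<le> 2 * (\<integral>\<^sup>+x. ennreal (exp (- x\<^sup>2 / 2)) / ennreal g \<partial>lborel)"
      by (intro mult_left_mono nn_integral_mono) auto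
    also have "\<dots> = 2 * (H / ennreal g)" by (simp add: nn_integral_divide H_def)
    finally have "P + Q \<le> 2 * (H / ennreal g)" .
    moreover have "H / ennreal g \<noteq> Orderings.top"
      using fin g unfolding H_def[symmetric] by (auto simp: ennreal_divide_eq_top_iff)
    \<comment> \<open>The arithmetic-geometric mean inequality turns the additive bound from the
      level sets into a multiplicative one. The normalisations then cancel because
      \<open>\<alpha> * \<beta> = g * g\<close>.\<close>
    ultimately have "P * Q \<le> (H / ennreal g) * (H / ennreal g)"
      by (intro mult_le_of_add_le) (auto simp: less_top)
    have cancel: "z = ennreal c * (z / ennreal c)" if "0 < c" for z and c :: real
      unfolding ennreal_times_divide mult.commute[of "ennreal c"] using that by (simp add: mult_divide_eq_ennreal)
    have fa: "(\<integral>\<^sup>+x. \<phi> x \<partial>lborel) = a * P" "(\<integral>\<^sup>+x. \<psi> x \<partial>lborel) = b * Q"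
      unfolding P_def Q_def ab(1,2) by (rule cancel[OF ab(3)], rule cancel[OF ab(4)])
    have Hg: "H = ennreal g * (H / ennreal g)"
      by (rule cancel[OF g(1)])
    have "(\<integral>\<^sup>+x. \<phi> x \<partial>lborel) * (\<integral>\<^sup>+x. \<psi> x \<partial>lborel) = ennreal (g * g) * (P * Q)"
      unfolding fa g(2) using ab by (simp add: ennreal_mult' algebra_simps)
    also have "\<dots> \<le> ennreal (g * g) * ((H / ennreal g) * (H / ennreal g))"
      using \<open>P * Q \<le> _\<close> by (intro mult_left_mono) auto
    also have "\<dots> = (ennreal g * (H / ennreal g)) * (ennreal g * (H / ennreal g))"
      using g(1) by (simp only: ennreal_mult less_imp_le mult_ac)
    also have "\<dots> = H * H" unfolding Hg[symmetric] ..
    finally show ?thesis by (simp add: H_def)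
  qed
qed

section \<open>Property tau for Gaussian measures\<close>

lemma borel_measurable_gauss [simp]: "borel_measurable gauss = borel_measurable borel"
  by (rule measurable_cong_sets) auto

text \<open>Multiplying both functions by \<open>exp (- x\<^sup>2 / 2)\<close> turns the assumption
  into that of the Prekopa-Leindler inequality, since \<open>(x - y)\<^sup>2 / 4 - x\<^sup>2 / 2 -
  y\<^sup>2 / 2 = - (x + y)\<^sup>2 / 4\<close>.\<close>

lemma gauss_tau_property:
  fixes F G :: "real \<Rightarrow> ennreal"
  assumes [measurable]: "F \<in> borel_measurable borel" "G \<in> borel_measurable borel"
    and le: "\<And>x y. F x * G y \<le> ennreal (exp ((x - y)\<^sup>2 / 4))"
  shows "(\<integral>\<^sup>+x. F x \<partial>gauss) * (\<integral>\<^sup>+x. G x \<partial>gauss) \<le> 1"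
proof -
  let ?h = "\<lambda>x::real. ennreal (exp (- x\<^sup>2 / 2))"
  define c where "c = ennreal (1 / sqrt (2 * pi))"
  have dens: "ennreal (std_normal_density x) = c * ?h x" for x
    by (simp add: std_normal_density_def c_def ennreal_mult[symmetric])
  have int: "(\<integral>\<^sup>+x. f x \<partial>gauss) = c * (\<integral>\<^sup>+x. f x * ?h x \<partial>lborel)"
    if [measurable]: "f \<in> borel_measurable borel" for f :: "real \<Rightarrow> ennreal"
  proof -
    have "(\<integral>\<^sup>+x. f x \<partial>gauss) = (\<integral>\<^sup>+x. c * (f x * ?h x) \<partial>lborel)"
      by (subst nn_integral_density) (auto simp: dens mult_ac intro!: nn_integral_cong)
    also have "\<dots> = c * (\<integral>\<^sup>+x. f x * ?h x \<partial>lborel)" by (rule nn_integral_cmult) measurable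
    finally show ?thesis .
  qed
  interpret prob_space gauss by (rule prob_space_gauss)
  have one: "c * (\<integral>\<^sup>+x. ?h x \<partial>lborel) = 1"
    using int[of "\<lambda>_. 1"] emeasure_space_1 by simp
  have "c \<noteq> 0" by (simp add: c_def)
  hence fin: "(\<integral>\<^sup>+x. ?h x \<partial>lborel) < Orderings.top"
    using one by (metis ennreal_mult_eq_top_iff ennreal_one_neq_top less_top)
  have "(\<integral>\<^sup>+x. F x * ?h x \<partial>lborel) * (\<integral>\<^sup>+x. G x * ?h x \<partial>lborel) \<le>
    (\<integral>\<^sup>+x. ?h x \<partial>lborel) * (\<integral>\<^sup>+x. ?h x \<partial>lborel)"
  proof (rule prekopa_leindler_gaussian[OF _ _ _ fin])
    fix x y :: real
    have "(F x * ?h x) * (G y * ?h y) = (F x * G y) * (?h x * ?h y)" by (simp add: mult_ac)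
    also have "\<dots> \<le> ennreal (exp ((x - y)\<^sup>2 / 4)) * (?h x * ?h y)" by (intro mult_right_mono le) auto
    also have "\<dots> = ennreal (exp ((x - y)\<^sup>2 / 4) * (exp (- x\<^sup>2 / 2) * exp (- y\<^sup>2 / 2)))"
      by (simp add: ennreal_mult')
    also have "exp ((x - y)\<^sup>2 / 4) * (exp (- x\<^sup>2 / 2) * exp (- y\<^sup>2 / 2)) = exp (- (x + y)\<^sup>2 / 4)"
      unfolding exp_add[symmetric] by (rule arg_cong[where f = exp]) (simp add: power2_eq_square field_simps)
    finally show "(F x * ?h x) * (G y * ?h y) \<le> ennreal (exp (- (x + y)\<^sup>2 / 4))" .
  qed measurable
  hence "(c * c) * ((\<integral>\<^sup>+x. F x * ?h x \<partial>lborel) * (\<integral>\<^sup>+x. G x * ?h x \<partial>lborel)) \<le>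
    (c * c) * ((\<integral>\<^sup>+x. ?h x \<partial>lborel) * (\<integral>\<^sup>+x. ?h x \<partial>lborel))" by (rule mult_left_mono) simp
  also have "\<dots> = (c * (\<integral>\<^sup>+x. ?h x \<partial>lborel)) * (c * (\<integral>\<^sup>+x. ?h x \<partial>lborel))" by (simp add: mult_ac)
  also have "\<dots> = 1" unfolding one by simp
  finally show ?thesis by (simp add: int mult_ac)
qed

abbreviation gauss_PiM :: "'i set \<Rightarrow> ('i \<Rightarrow> real) measure"
  where "gauss_PiM I \<equiv> PiM I (\<lambda>_. gauss)"

lemma prob_space_gauss_PiM: "prob_space (gauss_PiM I)"
  by (intro prob_space_PiM prob_space_gauss)

lemma product_sigma_finite_gauss: "product_sigma_finite (\<lambda>_. gauss)"
proof
  interpret prob_space gauss by (rule prob_space_gauss)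
  show "\<exists>A::real set set. countable A \<and> A \<subseteq> sets gauss \<and> \<Union>A = space gauss
    \<and> (\<forall>a\<in>A. emeasure gauss a \<noteq> \<infinity>)"
    by (rule sigma_finite_countable)
qed

text \<open>Tensorization: for fixed remaining coordinates the one-dimensional inequality shows that
  the integrals over one coordinate again satisfy the assumption, with the squared distance of the
  remaining coordinates.\<close>

lemma gauss_PiM_tau_property:
  fixes F G :: "('i \<Rightarrow> real) \<Rightarrow> ennreal"
  assumes "finite I" "F \<in> borel_measurable (gauss_PiM I)" "G \<in> borel_measurable (gauss_PiM I)"
    and "\<And>x y. F x * G y \<le> ennreal (exp ((\<Sum>i\<in>I. (x i - y i)\<^sup>2) / 4))"
  shows "(\<integral>\<^sup>+x. F x \<partial>gauss_PiM I) * (\<integral>\<^sup>+x. G x \<partial>gauss_PiM I) \<le> 1"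
  using assms
proof (induction I arbitrary: F G rule: finite_induct)
  case empty
  interpret product_sigma_finite "\<lambda>_::'i. gauss" by (rule product_sigma_finite_gauss)
  \<comment> \<open>The empty product is the point mass at
    \<open>\<lambda>_. undefined\<close>.\<close>
  show ?case using empty.prems(3)[of "\<lambda>_. undefined" "\<lambda>_. undefined"]
    by (simp add: PiM_empty nn_integral_count_space_finite)
next
  case (insert i I)
  interpret product_sigma_finite "\<lambda>_::'i. gauss" by (rule product_sigma_finite_gauss)
  note [measurable] = insert.prems(1,2)
  define D where "D x y = (\<Sum>j\<in>I. (x j - y j)\<^sup>2)" for x y :: "'i \<Rightarrow> real"
  have D: "(\<Sum>j\<in>insert i I. ((x(i := s)) j - (y(i := t)) j)\<^sup>2) = (s - t)\<^sup>2 + D x y" for x y s t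
  proof -
    have "(\<Sum>j\<in>I. ((x(i := s)) j - (y(i := t)) j)\<^sup>2) = D x y"
      unfolding D_def using insert(2) by (intro sum.cong) auto
    thus ?thesis using insert(1,2) by simp
  qed
  have meas: "(\<lambda>s. H (x(i := s))) \<in> borel_measurable borel"
    if "H \<in> borel_measurable (gauss_PiM (insert i I))" "x
      \<in> space (gauss_PiM I)" for H :: "('i \<Rightarrow> real) \<Rightarrow> ennreal" and x
  proof -
    have "(\<lambda>s. x(i := s)) \<in> measurable gauss (gauss_PiM (insert i I))"
      by (rule measurable_component_update[OF that(2) insert(2)])
    from measurable_compose[OF this that(1)] show ?thesis by simp
  qed
  \<comment> \<open>The assumption is made for all pairs of functions, but sections are measurable
    only at points of the product space; the value 0 elsewhere keeps the product bound true
    everywhere.\<close>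
  define U V where "U x = (if x \<in> space (gauss_PiM I) then \<integral>\<^sup>+s. F (x(i := s)) \<partial>gauss else 0)"
    and "V x = (if x \<in> space (gauss_PiM I) then \<integral>\<^sup>+s. G (x(i := s)) \<partial>gauss else 0)" for x
  have mU: "U \<in> borel_measurable (gauss_PiM I)" "V \<in> borel_measurable (gauss_PiM I)"
  proof -
    have "(\<lambda>(x, s). H (x(i := s))) \<in> borel_measurable (gauss_PiM I \<Otimes>\<^sub>M gauss)"
      if "H \<in> borel_measurable (gauss_PiM (insert i I))" for H :: "('i \<Rightarrow> real) \<Rightarrow> ennreal"
      using measurable_compose[OF measurable_add_dim that] by (simp add: case_prod_unfold)
    hence "(\<lambda>x. \<integral>\<^sup>+s. H (x(i := s)) \<partial>gauss) \<in> borel_measurable (gauss_PiM I)"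
      if "H \<in> borel_measurable (gauss_PiM (insert i I))" for H :: "('i \<Rightarrow> real) \<Rightarrow> ennreal"
      using that by (intro sigma_finite_measure.borel_measurable_nn_integral[OF sigma_finite_measures]) auto
    thus "U \<in> borel_measurable (gauss_PiM I)" "V \<in> borel_measurable (gauss_PiM I)"
      using insert.prems(1,2) unfolding U_def V_def
      by (auto cong: measurable_cong)
  qed
  have "U x * V y \<le> ennreal (exp (D x y / 4))" for x y
  proof (cases "x \<in> space (gauss_PiM I) \<and> y \<in> space (gauss_PiM I)")
    case True
    \<comment> \<open>This factor removes the distance of the fixed coordinates, so that only
      \<open>(s - t)\<^sup>2 / 4\<close> is left for the one-dimensional inequality.\<close>
    define e where "e = ennreal (exp (- (D x y / 4)))"
    have "(\<integral>\<^sup>+s. e * F (x(i := s)) \<partial>gauss) * (\<integral>\<^sup>+t. G (y(i := t)) \<partial>gauss) \<le> 1"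
    proof (rule gauss_tau_property)
      fix s t
      have "e * F (x(i := s)) * G (y(i := t)) \<le> e
        * ennreal (exp ((\<Sum>j\<in>insert i I. ((x(i := s)) j - (y(i := t)) j)\<^sup>2) / 4))"
        unfolding mult.assoc by (intro mult_left_mono insert.prems(3)) auto
      also have "\<dots> = ennreal (exp ((s - t)\<^sup>2 / 4))"
        unfolding D e_def by (simp add: ennreal_mult'[symmetric] exp_add[symmetric] add_divide_distrib)
      finally show "e * F (x(i := s)) * G (y(i := t)) \<le> ennreal (exp ((s - t)\<^sup>2 / 4))" .
    qed (use meas True insert.prems in auto)
    also have "(\<integral>\<^sup>+s. e * F (x(i := s)) \<partial>gauss) = e * (\<integral>\<^sup>+s. F (x(i := s)) \<partial>gauss)"
      using meas[OF insert.prems(1)] True by (intro nn_integral_cmult) auto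
    finally have *: "e * (U x * V y) \<le> 1" using True by (simp add: U_def V_def mult.assoc fun_upd_def)
    have "ennreal (exp (D x y / 4)) * (e * (U x * V y)) \<le> ennreal (exp (D x y / 4)) * 1"
      using * by (rule mult_left_mono) simp
    thus ?thesis
      by (simp add: e_def mult.assoc[symmetric] ennreal_mult'[symmetric] exp_add[symmetric])
  qed (auto simp: U_def V_def)
  hence "(\<integral>\<^sup>+x. U x \<partial>gauss_PiM I) * (\<integral>\<^sup>+x. V x \<partial>gauss_PiM I) \<le> 1"
    unfolding D_def by (rule insert.IH[OF mU])
  moreover have "(\<integral>\<^sup>+x. F x \<partial>gauss_PiM (insert i I)) = (\<integral>\<^sup>+x. U x \<partial>gauss_PiM I)"
    "(\<integral>\<^sup>+x. G x \<partial>gauss_PiM (insert i I)) = (\<integral>\<^sup>+x. V x \<partial>gauss_PiM I)"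
    using insert(1,2) insert.prems(1,2)
    by (simp_all add: product_nn_integral_insert U_def V_def cong: nn_integral_cong)
  ultimately show ?case by simp
qed

section \<open>Concentration of Lipschitz functions\<close>

locale gauss_lipschitz =
  fixes I :: "'i set" and f :: "('i \<Rightarrow> real) \<Rightarrow> real" and L :: real
  assumes fin: "finite I" and meas [measurable]: "f \<in> borel_measurable (gauss_PiM I)"
    and L: "0 < L" and lip: "f x - f y \<le> L * L2_set (\<lambda>i. x i - y i) I"
begin

sublocale prob_space "gauss_PiM I"
  by (rule prob_space_gauss_PiM)

text \<open>Property tau for \<open>exp (l * f - l\<^sup>2 * L\<^sup>2)\<close> and
  \<open>exp (- l * f)\<close>: with \<open>r\<close> the distance of two points,
  \<open>\<bar>l\<bar> * L * r \<le> l\<^sup>2 * L\<^sup>2 + r\<^sup>2 / 4\<close>. Working with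
  extended nonnegative integrals, this presupposes no integrability.\<close>

lemma nn_exp_moments:
  "(\<integral>\<^sup>+x. ennreal (exp (l * f x)) \<partial>gauss_PiM I) * (\<integral>\<^sup>+x. ennreal (exp (- l * f x)) \<partial>gauss_PiM I)
    \<le> ennreal (exp (l\<^sup>2 * L\<^sup>2))"
proof -
  have "(\<integral>\<^sup>+x. ennreal (exp (l * f x - l\<^sup>2 * L\<^sup>2)) \<partial>gauss_PiM I)
    * (\<integral>\<^sup>+x. ennreal (exp (- l * f x)) \<partial>gauss_PiM I) \<le> 1"
  proof (rule gauss_PiM_tau_property[OF fin])
    fix x y
    define r where "r = L2_set (\<lambda>i. x i - y i) I"
    have r: "0 \<le> r" "r\<^sup>2 = (\<Sum>i\<in>I. (x i - y i)\<^sup>2)" "L2_set (\<lambda>i. y i - x i) I = r"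
      by (simp_all add: r_def L2_set_def sum_nonneg power2_commute[of "y _"])
    have "\<bar>f x - f y\<bar> \<le> L * r" using lip[of x y] lip[of y x] r by (simp add: r_def abs_le_iff)
    hence "l * (f x - f y) \<le> \<bar>l\<bar> * (L * r)"
      by (metis abs_ge_self abs_ge_zero abs_mult mult_left_mono order_trans)
    also have "\<dots> \<le> l\<^sup>2 * L\<^sup>2 + r\<^sup>2 / 4"
      using zero_le_power2[of "\<bar>l\<bar> * L
        - r / 2"] by (simp add: power2_diff power_mult_distrib field_simps)
    finally have "l * f x - l\<^sup>2 * L\<^sup>2 + - l * f y \<le> r\<^sup>2 / 4" by (simp add: algebra_simps)
    thus "ennreal (exp (l * f x - l\<^sup>2 * L\<^sup>2)) * ennreal (exp (- l * f y))
      \<le> ennreal (exp ((\<Sum>i\<in>I. (x i - y i)\<^sup>2) / 4))"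
      by (simp add: ennreal_mult'[symmetric] exp_add[symmetric] r(2)[symmetric] ennreal_leI)
  qed measurable
  hence "ennreal (exp (l\<^sup>2 * L\<^sup>2)) * ((\<integral>\<^sup>+x. ennreal (exp (l * f x - l\<^sup>2 * L\<^sup>2)) \<partial>gauss_PiM I) * (\<integral>\<^sup>+x. ennreal (exp (- l * f x)) \<partial>gauss_PiM I))
     \<le> ennreal (exp (l\<^sup>2 * L\<^sup>2)) * 1" by (rule mult_left_mono) simp
  moreover have "ennreal (exp (l\<^sup>2 * L\<^sup>2)) * (\<integral>\<^sup>+x. ennreal (exp (l * f x - l\<^sup>2 * L\<^sup>2)) \<partial>gauss_PiM I)
    = (\<integral>\<^sup>+x. ennreal (exp (l * f x)) \<partial>gauss_PiM I)"
    by (subst nn_integral_cmult[symmetric]) (auto simp: ennreal_mult'[symmetric] exp_add[symmetric])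
  ultimately show ?thesis by (simp add: mult.assoc[symmetric])
qed

lemma nn_exp_pos: "(\<integral>\<^sup>+x. ennreal (exp (l * f x)) \<partial>gauss_PiM I) \<noteq> 0"
proof
  assume "(\<integral>\<^sup>+x. ennreal (exp (l * f x)) \<partial>gauss_PiM I) = 0"
  hence "AE x in gauss_PiM I. ennreal (exp (l * f x)) = 0"
    by (subst (asm) nn_integral_0_iff_AE) measurable
  hence "AE x in gauss_PiM I. False" by simp
  thus False using AE_False by (simp add: emeasure_space_1)
qed

text \<open>The moment bound gives integrability for free: the product of the two moments is finite
  and neither factor is 0, so both are finite.\<close>

lemma integrable_exp: "integrable (gauss_PiM I) (\<lambda>x. exp (l * f x))"
proof (rule integrableI_nonneg)
  have "(\<integral>\<^sup>+x. ennreal (exp (l * f x)) \<partial>gauss_PiM I) * (\<integral>\<^sup>+x. ennreal (exp (- l * f x)) \<partial>gauss_PiM I)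
    < Orderings.top"
    using nn_exp_moments[of l] by (rule le_less_trans) simp
  thus "(\<integral>\<^sup>+x. ennreal (exp (l * f x)) \<partial>gauss_PiM I) < \<infinity>"
    using nn_exp_pos[of "-l"] by (metis ennreal_mult_eq_top_iff infinity_ennreal_def less_top)
qed auto

lemma integrable_self: "integrable (gauss_PiM I) f"
proof (rule Bochner_Integration.integrable_bound)
  show "integrable (gauss_PiM I) (\<lambda>x. exp (1 * f x) + exp (- 1 * f x))"
    by (intro Bochner_Integration.integrable_add integrable_exp)
  show "AE x in gauss_PiM I. norm (f x) \<le> norm (exp (1 * f x) + exp (- 1 * f x))"
  proof (rule AE_I2)
    fix x
    have "f x \<le> exp (f x)" "- f x \<le> exp (- f x)" "0 < exp (f x)" "0 < exp (- f x)"
      using exp_ge_add_one_self[of "f x"] exp_ge_add_one_self[of "- f x"] by (linarith, linarith, simp_all)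
    hence "\<bar>f x\<bar> \<le> exp (f x) + exp (- f x)" by linarith
    thus "norm (f x) \<le> norm (exp (1 * f x) + exp (- 1 * f x))" by simp
  qed
qed measurable

text \<open>Jensen's inequality, through the tangent of the exponential at the mean, bounds the
  second moment in the product from below by \<open>exp (- l * expectation f)\<close>; dividing by
  it leaves the first.\<close>

lemma expectation_exp_le: "expectation (\<lambda>x. exp (l * f x)) \<le> exp (l\<^sup>2 * L\<^sup>2 + l * expectation f)"
proof -
  have nn: "(\<integral>\<^sup>+x. ennreal (exp (l * f x)) \<partial>gauss_PiM I)
    = ennreal (expectation (\<lambda>x. exp (l * f x)))" for l
    by (intro nn_integral_eq_integral integrable_exp) auto
  have prod: "expectation (\<lambda>x. exp (l * f x)) * expectation (\<lambda>x. exp (- l * f x)) \<le> exp (l\<^sup>2 * L\<^sup>2)"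
    using nn_exp_moments[of l] unfolding nn
    by (simp add: ennreal_mult'[symmetric] integral_nonneg_AE ennreal_le_iff)
  have "expectation (\<lambda>x. exp (- l * expectation f) * (1 - l * (f x - expectation f)))
    \<le> expectation (\<lambda>x. exp (- l * f x))"
  proof (rule integral_mono)
    show "integrable (gauss_PiM I) (\<lambda>x. exp (- l * expectation f) * (1 - l * (f x - expectation f)))"
      using integrable_self by simp
    show "integrable (gauss_PiM I) (\<lambda>x. exp (- l * f x))" by (rule integrable_exp)
    fix x
    have "1 - l * (f x - expectation f) \<le> exp (- l * (f x - expectation f))"
      using exp_ge_add_one_self[of "- l * (f x - expectation f)"] by simp
    hence "exp (- l * expectation f) * (1 - l * (f x - expectation f)) \<le> exp (- l * expectation f)
      * exp (- l * (f x - expectation f))"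
      by (intro mult_left_mono) auto
    thus "exp (- l * expectation f) * (1 - l * (f x - expectation f)) \<le> exp (- l * f x)"
      by (simp add: exp_add[symmetric] algebra_simps)
  qed
  also have "expectation (\<lambda>x. exp (- l * expectation f) * (1 - l * (f x - expectation f)))
    = exp (- l * expectation f)"
    using integrable_self by (simp add: prob_space)
  finally have "expectation (\<lambda>x. exp (l * f x)) * exp (- l * expectation f)
    \<le> expectation (\<lambda>x. exp (l * f x)) * expectation (\<lambda>x. exp (- l * f x))"
    by (intro mult_left_mono) (auto intro: integral_nonneg_AE)
  hence "expectation (\<lambda>x. exp (l * f x)) * exp (- l * expectation f) * exp (l * expectation f)
    \<le> exp (l\<^sup>2 * L\<^sup>2) * exp (l * expectation f)"
    using prod by (intro mult_right_mono) auto
  thus ?thesis by (simp add: mult.assoc exp_add[symmetric])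
qed

lemma tail_ge:
  assumes s: "0 < s"
  shows "prob {x \<in> space (gauss_PiM I). expectation f + s \<le> f x} \<le> exp (- s\<^sup>2 / (4 * L\<^sup>2))"
    and "prob {x \<in> space (gauss_PiM I). f x \<le> expectation f - s} \<le> exp (- s\<^sup>2 / (4 * L\<^sup>2))"
proof -
  \<comment> \<open>The minimiser of \<open>l\<^sup>2 * L\<^sup>2 - l * s\<close> in the Chernoff
    bound.\<close>
  define l where "l = s / (2 * L\<^sup>2)"
  have l: "0 < l" using s L by (simp add: l_def)
  have eq: "l\<^sup>2 * L\<^sup>2 - l * s = - s\<^sup>2 / (4 * L\<^sup>2)"
    using L by (simp add: l_def field_simps power2_eq_square)
  have si: "set_integrable (gauss_PiM I) (space (gauss_PiM I)) (\<lambda>x. exp (l * f x))" for l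
    unfolding set_integrable_def by (rule integrable_mult_indicator) (auto intro: integrable_exp)
  have sl: "(\<integral>x\<in>space (gauss_PiM I). exp (l * f x) \<partial>gauss_PiM I)
    = expectation (\<lambda>x. exp (l * f x))" for l
    by (rule set_integral_space) (rule integrable_exp)
  have "prob {x \<in> space (gauss_PiM I). expectation f + s \<le> f x} \<le> exp (- l * (expectation f + s))
    * expectation (\<lambda>x. exp (l * f x))"
    using Chernoff_ineq_ge[OF l si] sl by simp
  also have "\<dots> \<le> exp (- l * (expectation f + s)) * exp (l\<^sup>2 * L\<^sup>2 + l * expectation f)"
    by (intro mult_left_mono expectation_exp_le) auto
  also have "\<dots> = exp (- s\<^sup>2 / (4 * L\<^sup>2))"
    unfolding exp_add[symmetric] eq[symmetric] by (simp add: algebra_simps)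
  finally show "prob {x \<in> space (gauss_PiM I). expectation f + s \<le> f x} \<le> exp (- s\<^sup>2 / (4 * L\<^sup>2))" .
  have "prob {x \<in> space (gauss_PiM I). f x \<le> expectation f - s} \<le> exp (l * (expectation f - s))
    * expectation (\<lambda>x. exp (- l * f x))"
    using Chernoff_ineq_le[OF l si[of "-l"]] sl[of "-l"] by simp
  also have "\<dots> \<le> exp (l * (expectation f - s)) * exp ((-l)\<^sup>2 * L\<^sup>2 + (-l) * expectation f)"
    by (intro mult_left_mono expectation_exp_le) auto
  also have "\<dots> = exp (- s\<^sup>2 / (4 * L\<^sup>2))"
    unfolding exp_add[symmetric] eq[symmetric] by (simp add: algebra_simps)
  finally show "prob {x \<in> space (gauss_PiM I). f x \<le> expectation f - s} \<le> exp (- s\<^sup>2 / (4 * L\<^sup>2))" .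
qed

end

section \<open>Gaussian matrices\<close>

text \<open>Points of a finite product measure are \<open>undefined\<close> off the index set.
  Truncation turns them into members of \<open>coord_space n\<close>.\<close>

definition trunc :: "nat \<Rightarrow> (nat \<Rightarrow> real) \<Rightarrow> nat \<Rightarrow> real"
  where "trunc n x = (\<lambda>i. if i < n then x i else 0)"

lemma linear_trunc: "linear (trunc n)"
  by (intro linearI) (auto simp: trunc_def fun_eq_iff)

lemma borel_measurable_of_lipschitz_L2:
  fixes q :: "(nat \<Rightarrow> real) \<Rightarrow> real"
  assumes "\<And>a b. q a - q b \<le> L2_set (\<lambda>i. a i - b i) {..<n}"
  shows "q \<in> borel_measurable borel"
proof (rule borel_measurable_continuous_onI)
  have "(q \<longlongrightarrow> q a) (at a)" for a
  proof -
    have "continuous_on UNIV (\<lambda>x. L2_set (\<lambda>i. x i - a i) {..<n})"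
      unfolding L2_set_def by (intro continuous_intros continuous_on_product_coordinates)
    from this[unfolded continuous_on_def, rule_format, of a]
    have lim: "((\<lambda>x. L2_set (\<lambda>i. x i - a i) {..<n}) \<longlongrightarrow> 0) (at a)"
      by (simp add: L2_set_constant)
    have "\<bar>q x - q a\<bar> \<le> L2_set (\<lambda>i. x i - a i) {..<n}" for x
      using assms[of x a] assms[of a x] by (simp add: L2_set_def power2_commute[of "a _"] abs_le_iff)
    hence "((\<lambda>x. q x - q a) \<longlongrightarrow> 0) (at a)"
      by (intro Lim_null_comparison[OF _ lim]) simp
    thus ?thesis by (rule LIM_zero_cancel)
  qed
  thus "continuous_on UNIV q" by (simp add: continuous_on_def)
qed

lemma measurable_into_sequences:
  fixes X :: "'a \<Rightarrow> nat \<Rightarrow> real"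
  assumes "\<And>i. (\<lambda>\<omega>. X \<omega> i) \<in> borel_measurable M"
  shows "X \<in> measurable M borel"
proof -
  have "X \<in> measurable M (PiM UNIV (\<lambda>_. borel))"
    by (rule measurable_PiM_single') (use assms in auto)
  thus ?thesis using measurable_cong_sets[OF refl sets_PiM_equal_borel] by blast
qed

lemma indep_vars_gauss_coordinates:
  assumes "I \<noteq> {}"
  shows "prob_space.indep_vars (gauss_PiM I) (\<lambda>_. borel) (\<lambda>p \<omega>. \<omega> p) I"
proof -
  interpret prob_space "gauss_PiM I" by (rule prob_space_gauss_PiM)
  have sets: "sets (PiM I (\<lambda>_. borel)) = sets (gauss_PiM I)" by (intro sets_PiM_cong) auto
  have "distr (gauss_PiM I) (PiM I (\<lambda>_. borel)) (\<lambda>\<omega>. \<lambda>p\<in>I. \<omega> p)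
    = distr (gauss_PiM I) (gauss_PiM I) (\<lambda>\<omega>. \<omega>)"
    by (intro distr_cong sets) (auto simp: space_PiM PiE_restrict)
  also have "\<dots> = gauss_PiM I" by (rule distr_id2) simp
  also have "\<dots> = PiM I (\<lambda>p. distr (gauss_PiM I) borel (\<lambda>\<omega>. \<omega> p))"
  proof (intro PiM_cong refl)
    fix p assume p: "p \<in> I"
    have "distr (gauss_PiM I) borel (\<lambda>\<omega>. \<omega> p) = distr (gauss_PiM I) gauss (\<lambda>\<omega>. \<omega> p)"
      by (intro distr_cong) auto
    also have "\<dots> = gauss" by (intro distr_PiM_component prob_space_gauss p)
    finally show "gauss = distr (gauss_PiM I) borel (\<lambda>\<omega>. \<omega> p)" ..
  qed
  finally show ?thesis
    by (subst indep_vars_iff_distr_eq_PiM'[OF assms]) auto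
qed

lemma distributed_gauss_coordinate:
  assumes p: "p \<in> I"
  shows "distributed (gauss_PiM I) lborel (\<lambda>\<omega>. \<omega> p) std_normal_density"
proof -
  have "distr (gauss_PiM I) lborel (\<lambda>\<omega>. \<omega> p) = distr (gauss_PiM I) gauss (\<lambda>\<omega>. \<omega> p)"
    by (intro distr_cong) auto
  also have "\<dots> = gauss" by (intro distr_PiM_component prob_space_gauss p)
  finally have "distr (gauss_PiM I) lborel (\<lambda>\<omega>. \<omega> p) = gauss" .
  moreover have "(\<lambda>\<omega>. \<omega> p) \<in> borel_measurable (gauss_PiM I)"
    using measurable_component_singleton[OF p, of "\<lambda>_. gauss"] by simp
  ultimately show ?thesis unfolding distributed_def by auto
qed

text \<open>Rotation invariance of the Gaussian. Distinct \<open>i\<close> use disjoint sets of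
  coordinates, hence independence; each sum is normal with variance 1. The coefficients may depend
  on \<open>i\<close>, so that sign changes of a Gaussian vector are the case
  \<open>m = 1\<close>.\<close>

lemma distr_gauss_combination:
  fixes m n :: nat and t :: "nat \<Rightarrow> nat \<Rightarrow> real"
  assumes n: "0 < n" and t: "\<And>i. i < n \<Longrightarrow> (\<Sum>j<m. (t j i)\<^sup>2) = 1"
  shows "distr (gauss_PiM ({..<m} \<times> {..<n})) (PiM {..<n} (\<lambda>_. borel)) (\<lambda>\<omega>. \<lambda>i\<in>{..<n}. \<Sum>j<m. t j i * \<omega> (j, i))
    = gauss_PiM {..<n}"
proof -
  define I where "I = {..<m} \<times> {..<n}"
  have m: "0 < m" using t[OF n] by (cases m) auto
  have I: "I \<noteq> {}" using n m by (auto simp: I_def)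
  interpret prob_space "gauss_PiM I" by (rule prob_space_gauss_PiM)
  note indep = indep_vars_gauss_coordinates[OF I]
  define X where "X i \<omega> = (\<Sum>j<m. t j i * \<omega> (j, i))" for i and \<omega> :: "nat \<times> nat \<Rightarrow> real"
  have cm: "(\<lambda>\<omega>. \<omega> p) \<in> borel_measurable (gauss_PiM I)" if "p \<in> I" for p
    using measurable_component_singleton[OF that, of "\<lambda>_. gauss"] by simp
  have mX: "X i \<in> borel_measurable (gauss_PiM I)" if "i < n" for i
    unfolding X_def using that by (intro borel_measurable_sum borel_measurable_times cm) (auto simp: I_def)
  have indX: "indep_vars (\<lambda>_. borel) X {..<n}"
  proof -
    define K where "K i = {..<m} \<times> {i}" for i :: nat
    have "indep_vars (\<lambda>i. PiM (K i) (\<lambda>_. borel)) (\<lambda>i \<omega>. restrict (\<lambda>p. \<omega> p) (K i)) {..<n}"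
      by (rule indep_vars_restrict[OF indep]) (auto simp: K_def I_def disjoint_family_on_def)
    hence "indep_vars (\<lambda>_. borel) (\<lambda>i \<omega>. (\<lambda>x. \<Sum>j<m. t j i
      * x (j, i)) (restrict (\<lambda>p. \<omega> p) (K i))) {..<n}"
    proof (rule indep_vars_compose2)
      fix i
      show "(\<lambda>x. \<Sum>j<m. t j i * x (j, i)) \<in> measurable (PiM (K i) (\<lambda>_. borel)) borel"
        by (intro borel_measurable_sum borel_measurable_times borel_measurable_const
            measurable_component_singleton) (auto simp: K_def)
    qed
    moreover have "(\<lambda>i \<omega>. (\<lambda>x. \<Sum>j<m. t j i * x (j, i)) (restrict (\<lambda>p. \<omega> p) (K i))) = X"
      by (auto simp: fun_eq_iff X_def K_def)
    ultimately show ?thesis by simp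
  qed
  have distX: "distr (gauss_PiM I) borel (X i) = gauss" if i: "i < n" for i
  proof -
    \<comment> \<open>Terms with coefficient 0 are dropped, since a normal density needs a positive
      standard deviation.\<close>
    define J where "J = {p \<in> {..<m} \<times> {i}. t (fst p) i \<noteq> 0}"
    have J: "finite J" by (simp add: J_def)
    have sumJ: "(\<Sum>p\<in>J. f p) = (\<Sum>j<m. f (j, i))" if "\<And>p. t (fst p) i = 0 \<Longrightarrow> f p
      = 0" for f :: "nat \<times> nat \<Rightarrow> real"
    proof -
      have "(\<Sum>p\<in>J. f p) = (\<Sum>p\<in>{..<m} \<times> {i}. f p)"
        using that by (intro sum.mono_neutral_left) (auto simp: J_def)
      also have "\<dots> = (\<Sum>j<m. \<Sum>k\<in>{i}. f (j, k))" by (subst sum.cartesian_product) (simp add: case_prod_unfold)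
      finally show ?thesis by simp
    qed
    have sq: "(\<Sum>p\<in>J. (\<bar>t (fst p) i\<bar> * 1)\<^sup>2) = 1" using t[OF i] sumJ[of "\<lambda>p. (t (fst p) i)\<^sup>2"] by simp
    hence ne: "J \<noteq> {}" by auto
    have "indep_vars (\<lambda>_. borel) (\<lambda>p \<omega>. \<omega> p) J"
      by (rule indep_vars_subset[OF indep]) (use i in \<open>auto simp: J_def I_def\<close>)
    hence "indep_vars (\<lambda>_. borel) (\<lambda>p \<omega>. 0 + t (fst p) i * \<omega> p) J"
      by (rule indep_vars_compose2[where Y = "\<lambda>p x. 0 + t (fst p) i * x"]) auto
    moreover have "distributed (gauss_PiM I) lborel (\<lambda>\<omega>. 0 + t (fst p) i
      * \<omega> p) (normal_density (0 + t (fst p) i * 0) (\<bar>t (fst p) i\<bar> * 1))"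
      if "p \<in> J" for p
      using that i by (intro normal_density_affine distributed_gauss_coordinate) (auto simp: J_def I_def)
    ultimately have "distributed (gauss_PiM I) lborel (\<lambda>\<omega>. \<Sum>p\<in>J. 0 + t (fst p) i * \<omega> p)
      (normal_density (\<Sum>p\<in>J. 0 + t (fst p) i * 0) (sqrt (\<Sum>p\<in>J. (\<bar>t (fst p) i\<bar> * 1)\<^sup>2)))"
      by (intro sum_indep_normal[OF J ne]) (auto simp: J_def)
    moreover have "(\<lambda>\<omega>. \<Sum>p\<in>J. 0 + t (fst p) i * \<omega> p) = X i"
    proof
      fix \<omega>
      show "(\<Sum>p\<in>J. 0 + t (fst p) i * \<omega> p) = X i \<omega>"
        using sumJ[of "\<lambda>p. 0 + t (fst p) i * \<omega> p"] by (simp add: X_def)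
    qed
    ultimately have "distr (gauss_PiM I) lborel (X i) = gauss"
      unfolding sq by (auto simp: distributed_def)
    moreover have "distr (gauss_PiM I) borel (X i) = distr (gauss_PiM I) lborel (X i)"
      by (intro distr_cong) auto
    ultimately show ?thesis by simp
  qed
  have "distr (gauss_PiM I) (PiM {..<n} (\<lambda>_. borel)) (\<lambda>\<omega>. \<lambda>i\<in>{..<n}. X i \<omega>)
    = PiM {..<n} (\<lambda>i. distr (gauss_PiM I) borel (X i))"
    using indX n by (subst (asm) indep_vars_iff_distr_eq_PiM') (auto intro: mX)
  also have "\<dots> = gauss_PiM {..<n}" by (intro PiM_cong distX) auto
  finally show ?thesis unfolding I_def X_def .
qed

definition gauss_mean :: "nat \<Rightarrow> ((nat \<Rightarrow> real) \<Rightarrow> real) \<Rightarrow> real"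
  where "gauss_mean n q = (\<integral>x. q (trunc n x) \<partial>gauss_PiM {..<n})"

lemma gauss_mean_combination:
  fixes m n :: nat and t :: "nat \<Rightarrow> nat \<Rightarrow> real"
  assumes n: "0 < n" and t: "\<And>i. i < n \<Longrightarrow> (\<Sum>j<m. (t j i)\<^sup>2) = 1"
    and q [measurable]: "q \<in> borel_measurable borel"
  shows "(\<integral>\<omega>. q (trunc n (\<lambda>i. \<Sum>j<m. t j i * \<omega> (j, i))) \<partial>gauss_PiM ({..<m} \<times> {..<n})) = gauss_mean n q"
    and "integrable (gauss_PiM {..<n}) (\<lambda>x. q (trunc n x)) \<Longrightarrow>
      integrable (gauss_PiM ({..<m} \<times> {..<n})) (\<lambda>\<omega>. q (trunc n (\<lambda>i. \<Sum>j<m. t j i * \<omega> (j, i))))"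
proof -
  let ?M = "gauss_PiM ({..<m} \<times> {..<n})" and ?N = "PiM {..<n} (\<lambda>_. borel) :: (nat \<Rightarrow> real) measure"
  let ?X = "\<lambda>\<omega>. \<lambda>i\<in>{..<n}. \<Sum>j<m. t j i * \<omega> (j, i)"
  have D: "distr ?M ?N ?X = gauss_PiM {..<n}" by (rule distr_gauss_combination[OF n t])
  have mX: "?X \<in> measurable ?M ?N"
  proof (rule measurable_restrict)
    fix i assume i: "i \<in> {..<n}"
    show "(\<lambda>\<omega>. \<Sum>j<m. t j i * \<omega> (j, i)) \<in> borel_measurable ?M"
    proof (intro borel_measurable_sum borel_measurable_times borel_measurable_const)
      fix j assume "j \<in> {..<m}"
      thus "(\<lambda>\<omega>. \<omega> (j, i)) \<in> borel_measurable ?M"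
        using i measurable_component_singleton[of "(j, i)" "{..<m} \<times> {..<n}" "\<lambda>_. gauss"] by simp
    qed
  qed
  have "trunc n \<in> measurable ?N borel"
  proof (rule measurable_into_sequences)
    fix i show "(\<lambda>\<omega>. trunc n \<omega> i) \<in> borel_measurable ?N"
      by (cases "i < n") (auto simp: trunc_def intro!: measurable_component_singleton)
  qed
  hence mq: "(\<lambda>x. q (trunc n x)) \<in> borel_measurable ?N" using q by (rule measurable_compose)
  have tX: "trunc n (?X \<omega>) = trunc n (\<lambda>i. \<Sum>j<m. t j i * \<omega> (j, i))" for \<omega>
    by (auto simp: trunc_def)
  have "gauss_mean n q = (\<integral>x. q (trunc n x) \<partial>distr ?M ?N ?X)"
    unfolding gauss_mean_def D ..
  also have "\<dots> = (\<integral>\<omega>. q (trunc n (?X \<omega>)) \<partial>?M)" by (rule integral_distr[OF mX mq])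
  also have "\<dots> = (\<integral>\<omega>. q (trunc n (\<lambda>i. \<Sum>j<m. t j i * \<omega> (j, i))) \<partial>?M)" unfolding tX ..
  finally show "(\<integral>\<omega>. q (trunc n (\<lambda>i. \<Sum>j<m. t j i * \<omega> (j, i))) \<partial>?M) = gauss_mean n q" ..
  assume "integrable (gauss_PiM {..<n}) (\<lambda>x. q (trunc n x))"
  hence "integrable (distr ?M ?N ?X) (\<lambda>x. q (trunc n x))"
    unfolding D .
  from integrable_distr[OF mX this]
  show "integrable ?M (\<lambda>\<omega>. q (trunc n (\<lambda>i. \<Sum>j<m. t j i * \<omega> (j, i))))"
    unfolding tX .
qed

section \<open>Nearly Euclidean subspaces\<close>

lemma L2_set_abs_mono:
  assumes "\<And>i. i \<in> A \<Longrightarrow> \<bar>f i\<bar> \<le> \<bar>g i\<bar>"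
  shows "L2_set f A \<le> L2_set g A"
  unfolding L2_set_def using assms by (intro real_sqrt_le_mono sum_mono) (simp add: abs_le_square_iff)

lemma L2_set_scaleR: "L2_set (c *\<^sub>R a) A = \<bar>c\<bar> * L2_set a A"
  by (simp add: L2_set_def power_mult_distrib sum_distrib_left[symmetric] real_sqrt_mult)

lemma L2_set_uminus: "L2_set (- a) A = L2_set a A"
  by (simp add: L2_set_def)

lemma sublinear_lipschitz:
  fixes q :: "(nat \<Rightarrow> real) \<Rightarrow> real"
  assumes "sublinear q" "\<And>a. q a \<le> L2_set a {..<n}"
  shows "q a - q b \<le> L2_set (\<lambda>i. a i - b i) {..<n}"
proof -
  interpret sublinear q by fact
  have "q a - q b \<le> q (a - b)" using le_add_diff[of a b] by simp
  also have "\<dots> \<le> L2_set (a - b) {..<n}" by (rule assms)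
  finally show ?thesis by (simp add: fun_diff_def)
qed

lemma sublinear_measurable:
  fixes q :: "(nat \<Rightarrow> real) \<Rightarrow> real"
  assumes "sublinear q" "\<And>a. q a \<le> L2_set a {..<n}"
  shows "q \<in> borel_measurable borel"
  by (rule borel_measurable_of_lipschitz_L2) (rule sublinear_lipschitz[OF assms])

definition matrix_image :: "nat \<Rightarrow> nat \<Rightarrow> (nat \<times> nat \<Rightarrow> real) \<Rightarrow> (nat \<Rightarrow> real) \<Rightarrow> nat \<Rightarrow> real"
  where "matrix_image m n \<omega> t = trunc n (\<lambda>i. \<Sum>j<m. t j * \<omega> (j, i))"

lemma linear_matrix_image: "linear (matrix_image m n \<omega>)"
  by (intro linearI)
    (auto simp: matrix_image_def trunc_def fun_eq_iff sum.distrib algebra_simps sum_distrib_left)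

text \<open>The Hilbert-Schmidt bound. As the expression is bilinear it serves twice: as a Lipschitz
  constant in the matrix for a fixed vector, and as an a priori bound in the vector for a fixed
  matrix.\<close>

lemma L2_matrix_image_le:
  "L2_set (matrix_image m n \<omega> t) {..<n} \<le> L2_set t {..<m} * L2_set \<omega> ({..<m} \<times> {..<n})"
proof -
  have "(\<Sum>i<n. (matrix_image m n \<omega> t i)\<^sup>2) \<le> (\<Sum>i<n. (\<Sum>j<m. (t j)\<^sup>2) * (\<Sum>j<m. (\<omega> (j, i))\<^sup>2))"
    using Cauchy_Schwarz_ineq_sum[of t _ "{..<m}"]
    by (intro sum_mono) (simp add: matrix_image_def trunc_def)
  also have "\<dots> = (\<Sum>j<m. (t j)\<^sup>2) * (\<Sum>i<n. \<Sum>j<m. (\<omega> (j, i))\<^sup>2)"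
    by (simp add: sum_distrib_left)
  also have "(\<Sum>i<n. \<Sum>j<m. (\<omega> (j, i))\<^sup>2) = (\<Sum>p\<in>{..<m} \<times> {..<n}. (\<omega> p)\<^sup>2)"
    by (subst sum.swap) (simp add: sum.cartesian_product)
  finally show ?thesis
    unfolding L2_set_def real_sqrt_mult[symmetric] by (rule real_sqrt_le_mono)
qed

lemma gauss_lipschitz_matrix_image:
  assumes q: "sublinear q" "\<And>a. q a \<le> L2_set a {..<n}" and t: "0 < L2_set t {..<m}"
  shows "gauss_lipschitz ({..<m} \<times> {..<n}) (\<lambda>\<omega>. q (matrix_image m n \<omega> t)) (L2_set t {..<m})"
proof
  let ?I = "{..<m} \<times> {..<n}"
  have "(\<lambda>\<omega>. matrix_image m n \<omega> t) \<in> measurable (gauss_PiM ?I) borel"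
  proof (rule measurable_into_sequences)
    fix i
    have "(\<lambda>\<omega>. \<Sum>j<m. t j * \<omega> (j, i)) \<in> borel_measurable (gauss_PiM ?I)" if "i < n"
    proof (intro borel_measurable_sum borel_measurable_times borel_measurable_const)
      fix j assume "j \<in> {..<m}"
      thus "(\<lambda>\<omega>. \<omega> (j, i)) \<in> borel_measurable (gauss_PiM ?I)"
        using that measurable_component_singleton[of "(j, i)" ?I "\<lambda>_. gauss"] by simp
    qed
    thus "(\<lambda>\<omega>. matrix_image m n \<omega> t i) \<in> borel_measurable (gauss_PiM ?I)"
      by (cases "i < n") (auto simp: matrix_image_def trunc_def)
  qed
  thus "(\<lambda>\<omega>. q (matrix_image m n \<omega> t)) \<in> borel_measurable (gauss_PiM ?I)"
    using sublinear_measurable[OF q] by (rule measurable_compose)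
  fix \<omega> \<omega>' :: "nat \<times> nat \<Rightarrow> real"
  have "q (matrix_image m n \<omega> t) - q (matrix_image m n \<omega>' t)
    \<le> L2_set (\<lambda>i. matrix_image m n \<omega> t i - matrix_image m n \<omega>' t i) {..<n}"
    by (rule sublinear_lipschitz[OF q])
  also have "(\<lambda>i. matrix_image m n \<omega> t i - matrix_image m n \<omega>' t i)
    = matrix_image m n (\<lambda>p. \<omega> p - \<omega>' p) t"
    by (auto simp: matrix_image_def trunc_def fun_eq_iff sum_subtractf algebra_simps)
  also have "L2_set \<dots> {..<n} \<le> L2_set t {..<m} * L2_set (\<lambda>p. \<omega> p - \<omega>' p) ?I"
    by (rule L2_matrix_image_le)
  finally show "q (matrix_image m n \<omega> t) - q (matrix_image m n \<omega>' t) \<le> L2_set t {..<m}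
    * L2_set (\<lambda>p. \<omega> p - \<omega>' p) ?I" .
qed (use t in auto)

lemma expectation_matrix_image:
  assumes q: "sublinear q" "\<And>a. q a \<le> L2_set a {..<n}" and n: "0 < n" and t: "0 < L2_set t {..<m}"
  shows "(\<integral>\<omega>. q (matrix_image m n \<omega> t) \<partial>gauss_PiM ({..<m} \<times> {..<n})) = L2_set t {..<m} * gauss_mean n q"
proof -
  interpret sublinear q by fact
  define r where "r = L2_set t {..<m}"
  have r: "0 < r" using t by (simp add: r_def)
  have sq: "(\<Sum>j<m. (t j / r)\<^sup>2) = 1"
  proof -
    have "(\<Sum>j<m. (t j / r)\<^sup>2) = (\<Sum>j<m. (t j)\<^sup>2) / r\<^sup>2" by (simp add: power_divide sum_divide_distrib)
    moreover have "r\<^sup>2 = (\<Sum>j<m. (t j)\<^sup>2)" by (simp add: r_def L2_set_def sum_nonneg)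
    ultimately show ?thesis using r by auto
  qed
  have "q (matrix_image m n \<omega> t) = r * q (trunc n (\<lambda>i. \<Sum>j<m. t j / r * \<omega> (j, i)))" for \<omega>
  proof -
    have "matrix_image m n \<omega> t = r *\<^sub>R trunc n (\<lambda>i. \<Sum>j<m. t j / r * \<omega> (j, i))"
      using r by (auto simp: matrix_image_def trunc_def fun_eq_iff sum_distrib_left)
    thus ?thesis using r by (simp add: scale)
  qed
  thus ?thesis
    using gauss_mean_combination(1)[where m = m and t = "\<lambda>j i. t j / r", OF n sq sublinear_measurable[OF q]]
    by (simp add: r_def)
qed

text \<open>Closeness on a net of the unit ball is extended to all vectors. The assumed bound with
  \<open>C\<close> is only qualitative: it makes the supremum \<open>A\<close> over the ball finite,
  so that \<open>\<delta> * A\<close> can be absorbed, after which \<open>C\<close>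
  disappears.\<close>

lemma near_isometry_of_net:
  fixes F :: "(nat \<Rightarrow> real) \<Rightarrow> real"
  assumes F: "sublinear F" and C: "\<And>t. F t \<le> C * L2_set t {..<m}"
    and \<delta>: "0 < \<delta>" "\<delta> \<le> 1 / 4" and \<mu>: "0 \<le> \<mu>"
    and net: "\<And>t. L2_set t {..<m} \<le> 1 \<Longrightarrow> \<exists>s. L2_set s {..<m} \<le> 1 \<and> L2_set (t - s) {..<m} \<le> \<delta> \<and>
      \<bar>F s - L2_set s {..<m} * \<mu>\<bar> \<le> \<delta> * \<mu>"
  shows "(1 - 4 * \<delta>) * \<mu> * L2_set t {..<m} \<le> F t" "F t \<le> (1 + 3 * \<delta>) * \<mu> * L2_set t {..<m}"
proof -
  interpret sublinear F by fact
  let ?n = "\<lambda>t. L2_set t {..<m}"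
  define A where "A = (SUP t\<in>{t. ?n t \<le> 1}. F t)"
  have C1: "F t \<le> \<bar>C\<bar>" if "?n t \<le> 1" for t
  proof -
    have "C * ?n t \<le> \<bar>C\<bar> * 1" using that by (intro mult_mono) auto
    thus ?thesis using C[of t] by simp
  qed
  have A: "F t \<le> A" if "?n t \<le> 1" for t
    unfolding A_def using that C1 by (intro cSUP_upper bdd_aboveI2[where M = "\<bar>C\<bar>"]) auto
  have A\<delta>: "F t \<le> \<delta> * A" if "?n t \<le> \<delta>" for t
  proof -
    have "?n ((1 / \<delta>) *\<^sub>R t) \<le> 1" unfolding L2_set_scaleR using that \<delta> by simp
    hence "F ((1 / \<delta>) *\<^sub>R t) \<le> A" by (rule A)
    hence "F t / \<delta> \<le> A" using \<delta> by (simp add: scale)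
    thus ?thesis using \<delta> by (simp add: field_simps)
  qed
  have s\<mu>: "?n s * \<mu> \<le> \<mu>" if "?n s \<le> 1" for s
    using mult_right_mono[OF that \<mu>] by simp
  have "A \<le> (1 + \<delta>) * \<mu> + \<delta> * A"
    unfolding A_def
  proof (rule cSUP_least)
    show "{t. ?n t \<le> 1} \<noteq> {}" by (auto intro!: exI[of _ "\<lambda>_. 0"] simp: L2_set_def)
    fix t assume "t \<in> {t. ?n t \<le> 1}"
    then obtain s where s: "?n s \<le> 1" "?n (t - s) \<le> \<delta>" "\<bar>F s - ?n s * \<mu>\<bar> \<le> \<delta> * \<mu>" using net by auto
    have "F t \<le> F s + F (t - s)" by (rule le_add_diff)
    also have "\<dots> \<le> (\<mu> + \<delta> * \<mu>) + \<delta> * A"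
      using s(3) s\<mu>[OF s(1)] A\<delta>[OF s(2)] by linarith
    finally show "F t \<le> (1 + \<delta>) * \<mu> + \<delta> * (SUP t\<in>{t. ?n t \<le> 1}. F t)"
      by (simp add: A_def algebra_simps)
  qed
  hence "(1 - \<delta>) * A \<le> (1 + \<delta>) * \<mu>" by (simp add: algebra_simps)
  also have "\<dots> \<le> (1 - \<delta>) * ((1 + 3 * \<delta>) * \<mu>)"
  proof -
    have "1 + \<delta> \<le> (1 - \<delta>) * (1 + 3 * \<delta>)"
      using mult_left_mono[of "3 * \<delta>" 1 \<delta>] \<delta> by (simp add: algebra_simps)
    from mult_right_mono[OF this \<mu>] show ?thesis by (simp add: mult.assoc)
  qed
  finally have A3: "A \<le> (1 + 3 * \<delta>) * \<mu>" using \<delta> by simp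
  have low1: "(1 - 4 * \<delta>) * \<mu> \<le> F t" if t: "?n t = 1" for t
  proof -
    obtain s where s: "?n s \<le> 1" "?n (t - s) \<le> \<delta>" "\<bar>F s - ?n s * \<mu>\<bar> \<le> \<delta> * \<mu>" using net t by force
    \<comment> \<open>As \<open>F\<close> need not be even, the lower bound uses the reversed
      difference \<open>s - t\<close>. The losses are \<delta> from the length of \<open>s\<close>,
      \<delta> from the net estimate and \<open>2 * \<delta>\<close> from the difference.\<close>
    have "?n (s - t) \<le> \<delta>" using s(2) L2_set_uminus[of "t - s" "{..<m}"] by simp
    hence "F (s - t) \<le> \<delta> * A" by (rule A\<delta>)
    also have "\<dots> \<le> \<delta> * ((1 + 3 * \<delta>) * \<mu>)" using A3 \<delta> by (intro mult_left_mono) auto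
    also have "\<dots> \<le> \<delta> * (2 * \<mu>)" using \<delta> \<mu> by (intro mult_left_mono mult_right_mono) auto
    finally have 1: "F (s - t) \<le> 2 * \<delta> * \<mu>" by simp
    have "1 \<le> ?n s + ?n (t - s)"
      using L2_set_triangle_ineq[of s "t - s" "{..<m}"] t by simp
    hence "1 - \<delta> \<le> ?n s" using s(2) by simp
    hence "(1 - \<delta>) * \<mu> \<le> ?n s * \<mu>" using \<mu> by (rule mult_right_mono)
    moreover have "F s \<le> F t + F (s - t)" by (rule le_add_diff)
    ultimately show ?thesis using 1 s(3) by (simp add: algebra_simps abs_le_iff)
  qed
  have "(1 - 4 * \<delta>) * \<mu> * ?n t \<le> F t \<and> F t \<le> (1 + 3 * \<delta>) * \<mu> * ?n t"
  proof (cases "?n t = 0")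
    case True
    thus ?thesis using C[of t] nonneg[of t] by simp
  next
    case False
    hence pos: "0 < ?n t" using L2_set_nonneg[of t "{..<m}"] by linarith
    define u where "u = (1 / ?n t) *\<^sub>R t"
    have u: "?n u = 1" unfolding u_def L2_set_scaleR using pos by simp
    have "t = ?n t *\<^sub>R u" using pos by (simp add: u_def)
    hence Ft: "F t = ?n t * F u" using pos by (metis scale less_imp_le)
    have "(1 - 4 * \<delta>) * \<mu> \<le> F u" "F u \<le> (1 + 3 * \<delta>) * \<mu>"
      using low1[OF u] A[of u] A3 u by auto
    thus ?thesis unfolding Ft using pos by (auto simp: mult.commute[of _ "?n t"] intro: mult_left_mono)
  qed
  thus "(1 - 4 * \<delta>) * \<mu> * ?n t \<le> F t" "F t \<le> (1 + 3 * \<delta>) * \<mu> * ?n t" by auto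
qed

text \<open>A cubical net. Its resolution \<open>N\<close> grows with \<open>m\<close>, so its size
  exceeds an exponential in \<open>m\<close> by a logarithmic factor in the exponent. This is
  harmless, as the Gaussian mean will exceed a suitable power of \<open>m\<close>.\<close>

definition grid :: "nat \<Rightarrow> nat \<Rightarrow> (nat \<Rightarrow> real) set"
  where "grid m N = (\<lambda>k j. if j
    < m then real_of_int (k j) / N else 0) ` PiE {..<m} (\<lambda>_. {- int N..int N})"

lemma finite_grid: "finite (grid m N)"
  unfolding grid_def by (intro finite_imageI finite_PiE) auto

lemma card_grid_le: "card (grid m N) \<le> (2 * N + 1) ^ m"
proof -
  have "card (grid m N) \<le> card (PiE {..<m} (\<lambda>_. {- int N..int N}))"
    unfolding grid_def by (intro card_image_le finite_PiE) auto
  also have "\<dots> = (2 * N + 1) ^ m" by (simp add: card_PiE nat_add_distrib nat_mult_distrib)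
  finally show ?thesis .
qed

lemma grid_is_net:
  assumes t: "L2_set t {..<m} \<le> 1" and N: "0 < N" "sqrt m \<le> \<delta> * N"
  shows "\<exists>s\<in>grid m N. L2_set s {..<m} \<le> 1 \<and> L2_set (t - s) {..<m} \<le> \<delta>"
proof -
  \<comment> \<open>Coordinates are rounded towards 0, so the net point is no longer than
    \<open>t\<close> and stays in the unit ball.\<close>
  define k where "k = (\<lambda>j\<in>{..<m}. if 0 \<le> t j then \<lfloor>N * t j\<rfloor> else - \<lfloor>N * - t j\<rfloor>)"
  define s where "s j = (if j < m then real_of_int (k j) / N else 0)" for j
  have t1: "\<bar>t j\<bar> \<le> 1" if "j < m" for j
  proof -
    have "\<bar>t j\<bar> \<le> L2_set (\<lambda>j. \<bar>t j\<bar>) {..<m}" using that by (intro member_le_L2_set) auto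
    also have "\<dots> = L2_set t {..<m}" by (simp add: L2_set_def)
    finally show ?thesis using t by simp
  qed
  have kb: "k j \<in> {- int N..int N}" if j: "j < m" for j
  proof -
    have "real N * \<bar>t j\<bar> \<le> real N * 1" using t1[OF j] by (intro mult_left_mono) auto
    hence 1: "\<lfloor>N * \<bar>t j\<bar>\<rfloor> \<le> int N" by linarith
    have 2: "0 \<le> \<lfloor>N * \<bar>t j\<bar>\<rfloor>" by simp
    have "k j = \<lfloor>N * \<bar>t j\<bar>\<rfloor> \<or> k j = - \<lfloor>N * \<bar>t j\<bar>\<rfloor>" using j by (simp add: k_def)
    thus ?thesis using 1 2 unfolding atLeastAtMost_iff by linarith
  qed
  have sj: "\<bar>s j\<bar> \<le> \<bar>t j\<bar> \<and> \<bar>t j - s j\<bar> \<le> 1 / N" if j: "j < m" for j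
  proof -
    have *: "0 \<le> real_of_int \<lfloor>N * x\<rfloor> / N" "real_of_int \<lfloor>N * x\<rfloor> / N \<le> x" "x - real_of_int \<lfloor>N * x\<rfloor> / N
      \<le> 1 / N"
      if "0 \<le> x" for x :: real
    proof -
      show "0 \<le> real_of_int \<lfloor>N * x\<rfloor> / N" using that by simp
      show "real_of_int \<lfloor>N * x\<rfloor> / N \<le> x" using N(1) of_int_floor_le[of "N
        * x"] by (simp add: field_simps)
      have "N * x \<le> real_of_int \<lfloor>N * x\<rfloor> + 1" by linarith
      hence "x \<le> (real_of_int \<lfloor>N * x\<rfloor> + 1) / N" using N(1) by (simp add: pos_le_divide_eq mult.commute)
      thus "x - real_of_int \<lfloor>N * x\<rfloor> / N \<le> 1 / N" by (simp add: add_divide_distrib)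
    qed
    show ?thesis
    proof (cases "0 \<le> t j")
      case True
      thus ?thesis using *[OF True] j by (simp add: s_def k_def)
    next
      case False
      thus ?thesis using *[of "- t j"] j by (auto simp: s_def k_def)
    qed
  qed
  have "s \<in> grid m N"
    unfolding grid_def
  proof (rule image_eqI)
    show "s = (\<lambda>j. if j < m then real_of_int (k j) / N else 0)" by (simp add: s_def fun_eq_iff)
    show "k \<in> PiE {..<m} (\<lambda>_. {- int N..int N})" using kb by (auto simp: k_def)
  qed
  moreover have "L2_set s {..<m} \<le> 1"
    using t sj by (intro order_trans[OF L2_set_abs_mono[of "{..<m}" s t]]) auto
  moreover have "L2_set (t - s) {..<m} \<le> \<delta>"
  proof -
    have "L2_set (t - s) {..<m} \<le> L2_set (\<lambda>_. 1 / N) {..<m}"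
      using sj by (intro L2_set_abs_mono) auto
    also have "\<dots> = sqrt m / N" by (simp add: L2_set_constant)
    also have "\<dots> \<le> \<delta>" using N by (simp add: divide_le_eq)
    finally show ?thesis .
  qed
  ultimately show ?thesis by blast
qed

text \<open>A union bound. At a net point of norm at most 1 the value is Lipschitz in the matrix
  with constant at most 1 and has mean \<mu> times the norm, so it deviates by
  \<open>\<delta> * \<mu>\<close> with probability at most
  \<open>2 * exp (- (\<delta> * \<mu>)\<^sup>2 / 4)\<close>. The assumption \<open>big\<close> says
  that these probabilities sum to less than 1.\<close>

theorem dvoretzky_of_gauss_mean:
  assumes q: "sublinear q" "\<And>a. q a \<le> L2_set a {..<n}" and n: "0 < n"
    and \<delta>: "0 < \<delta>" "\<delta> \<le> 1 / 4" and N: "0 < N" "sqrt m \<le> \<delta> * N" and \<mu>: "0 < gauss_mean n q"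
    and big: "2 * (2 * real N + 1) ^ m < exp ((\<delta> * gauss_mean n q)\<^sup>2 / 4)"
  shows "\<exists>W. linear W \<and> (\<forall>t. (1 - 4 * \<delta>) * gauss_mean n q * L2_set t {..<m} \<le> q (W t) \<and>
    q (W t) \<le> (1 + 3 * \<delta>) * gauss_mean n q * L2_set t {..<m})"
proof -
  interpret q: sublinear q by fact
  define \<mu> where "\<mu> = gauss_mean n q"
  have \<mu>0: "0 < \<mu>" using \<mu> by (simp add: \<mu>_def)
  let ?I = "{..<m} \<times> {..<n}"
  let ?M = "gauss_PiM ?I"
  let ?n = "\<lambda>t. L2_set t {..<m}"
  interpret prob_space ?M by (rule prob_space_gauss_PiM)
  \<comment> \<open>Points of norm 0 are left out because concentration needs a positive Lipschitz
    constant; there the value is 0 for every matrix.\<close>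
  define S where "S = {t \<in> grid m N. 0 < ?n t \<and> ?n t \<le> 1}"
  have S: "finite S" "card S \<le> (2 * N + 1) ^ m"
    using finite_grid[of m N] card_grid_le[of m N] card_mono[OF finite_grid, of S m N] unfolding S_def by auto
  define f where "f t \<omega> = q (matrix_image m n \<omega> t)" for t \<omega>
  define e where "e = exp (- (\<delta> * \<mu>)\<^sup>2 / 4)"
  define B where "B t
    = {\<omega> \<in> space ?M. ?n t * \<mu> + \<delta> * \<mu> \<le> f t \<omega>} \<union> {\<omega> \<in> space ?M. f t \<omega> \<le> ?n t * \<mu> - \<delta> * \<mu>}" for t
  have B: "B t \<in> events \<and> prob (B t) \<le> 2 * e" if t: "t \<in> S" for t
  proof -
    have t': "0 < ?n t" "?n t \<le> 1" using t by (auto simp: S_def)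
    interpret gl: gauss_lipschitz ?I "f t" "?n t"
      unfolding f_def using gauss_lipschitz_matrix_image[OF q t'(1)] by simp
    have ex: "expectation (f t) = ?n t * \<mu>"
      unfolding f_def \<mu>_def by (rule expectation_matrix_image[OF q n t'(1)])
    have "- (\<delta> * \<mu>)\<^sup>2 / (4 * (?n t)\<^sup>2) \<le> - (\<delta> * \<mu>)\<^sup>2 / 4"
    proof -
      have "(?n t)\<^sup>2 \<le> 1" using t' by (simp add: power_le_one)
      hence "(\<delta> * \<mu>)\<^sup>2 / 4 \<le> (\<delta> * \<mu>)\<^sup>2 / (4 * (?n t)\<^sup>2)"
        using t' by (intro divide_left_mono) auto
      thus ?thesis by simp
    qed
    hence e: "exp (- (\<delta> * \<mu>)\<^sup>2 / (4 * (?n t)\<^sup>2)) \<le> e" by (simp add: e_def)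
    have s: "0 < \<delta> * \<mu>" using \<delta> \<mu>0 by simp
    have ev: "{\<omega> \<in> space ?M. ?n t * \<mu> + \<delta> * \<mu> \<le> f t \<omega>}
      \<in> events" "{\<omega> \<in> space ?M. f t \<omega> \<le> ?n t * \<mu> - \<delta> * \<mu>} \<in> events"
      using gl.meas by measurable
    have "prob (B t) \<le> prob {\<omega> \<in> space ?M. ?n t * \<mu> + \<delta> * \<mu> \<le> f t \<omega>}
      + prob {\<omega> \<in> space ?M. f t \<omega> \<le> ?n t * \<mu> - \<delta> * \<mu>}"
      unfolding B_def by (rule measure_Un_le[OF ev])
    also have "\<dots> \<le> e + e"
      using gl.tail_ge[OF s] e unfolding ex by linarith
    finally show ?thesis using ev by (simp add: B_def)
  qed
  have "prob (\<Union>t\<in>S. B t) \<le> (\<Sum>t\<in>S. prob (B t))"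
    using B S(1) by (intro measure_UNION_le) auto
  also have "\<dots> \<le> (\<Sum>t\<in>S. 2 * e)" using B by (intro sum_mono) auto
  also have "\<dots> = card S * (2 * e)" by simp
  also have "\<dots> \<le> real ((2 * N + 1) ^ m) * (2 * e)"
    using S(2) by (intro mult_right_mono of_nat_mono) (auto simp: e_def)
  also have "\<dots> = 2 * (2 * real N + 1) ^ m * e" by (simp add: add.commute)
  also have "\<dots> < exp ((\<delta> * \<mu>)\<^sup>2 / 4) * e"
    using big by (intro mult_strict_right_mono) (auto simp: \<mu>_def e_def)
  also have "\<dots> = 1" by (simp add: e_def exp_add[symmetric])
  finally have "prob (\<Union>t\<in>S. B t) < 1" .
  hence "(\<Union>t\<in>S. B t) \<noteq> space ?M" using prob_space by auto
  moreover have "(\<Union>t\<in>S. B t) \<subseteq> space ?M" by (auto simp: B_def)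
  ultimately obtain \<omega> where \<omega>: "\<omega> \<in> space ?M" "\<And>t. t \<in> S \<Longrightarrow> \<omega> \<notin> B t" by blast
  define W where "W = matrix_image m n \<omega>"
  have W: "linear W" unfolding W_def by (rule linear_matrix_image)
  have good: "\<bar>q (W s) - ?n s * \<mu>\<bar> \<le> \<delta> * \<mu>" if s: "s \<in> grid m N" "?n s \<le> 1" for s
  proof (cases "0 < ?n s")
    case True
    thus ?thesis using \<omega>(1) \<omega>(2)[of s] s by (auto simp: S_def B_def f_def W_def abs_le_iff)
  next
    case False
    hence z: "?n s = 0" using L2_set_nonneg[of s "{..<m}"] by linarith
    have "q (W s) \<le> L2_set (W s) {..<n}" by (rule q(2))
    also have "\<dots> \<le> 0" using L2_matrix_image_le[of m n \<omega> s] z by (simp add: W_def)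
    finally have "q (W s) = 0" using q.nonneg[of "W s"] by simp
    thus ?thesis using z \<delta> \<mu>0 by simp
  qed
  have sub: "sublinear (\<lambda>t. q (W t))" by (rule q.sublinear_compose[OF W])
  have C: "q (W t) \<le> L2_set \<omega> ?I * ?n t" for t
  proof -
    have "q (W t) \<le> L2_set (W t) {..<n}" by (rule q(2))
    also have "\<dots> \<le> L2_set \<omega> ?I * ?n t"
      using L2_matrix_image_le[of m n \<omega> t] by (simp add: W_def mult.commute)
    finally show ?thesis .
  qed
  have net: "\<exists>s. ?n s \<le> 1 \<and> ?n (t - s) \<le> \<delta> \<and> \<bar>q (W s) - ?n s * \<mu>\<bar> \<le> \<delta> * \<mu>" if "?n t \<le> 1" for t
    using grid_is_net[OF that N] good by blast
  have "\<forall>t. (1 - 4 * \<delta>) * \<mu> * ?n t \<le> q (W t) \<and> q (W t) \<le> (1 + 3 * \<delta>) * \<mu> * ?n t"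
    using near_isometry_of_net[OF sub C \<delta> _ net] \<mu>0 by simp
  thus ?thesis using W unfolding \<mu>_def by blast
qed

section \<open>Sign averages and Gaussian means\<close>

lemma gauss_mean_uminus:
  assumes q: "sublinear q" "\<And>a. q a \<le> L2_set a {..<n}" and n: "0 < n"
  shows "gauss_mean n (\<lambda>x. q (- x)) = gauss_mean n q"
proof -
  have m: "q \<in> borel_measurable borel" "(\<lambda>x. q (- x)) \<in> borel_measurable borel"
  proof -
    show "q \<in> borel_measurable borel" by (rule sublinear_measurable[OF q])
    have "sublinear (\<lambda>x. q (- x))"
      by (rule sublinear.sublinear_compose[OF q(1)]) (simp add: linear_iff)
    moreover have "q (- a) \<le> L2_set a {..<n}" for a using q(2)[of "-a"] by (simp add: L2_set_uminus)
    ultimately show "(\<lambda>x. q (- x)) \<in> borel_measurable borel" by (rule sublinear_measurable)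
  qed
  have "- trunc n (\<lambda>i. \<Sum>j<1. - 1 * \<omega> (j, i))
    = trunc n (\<lambda>i. \<Sum>j<1. 1 * \<omega> (j, i))" for \<omega> :: "nat \<times> nat \<Rightarrow> real"
    by (auto simp: trunc_def fun_eq_iff)
  thus ?thesis
    using gauss_mean_combination(1)[where m = 1 and t = "\<lambda>j i. -1", OF n _ m(2)]
      gauss_mean_combination(1)[where m = 1 and t = "\<lambda>j i. 1", OF n _ m(1)] by simp
qed

lemma integrable_gauss_mean:
  assumes q: "sublinear q" "\<And>a. q a \<le> L2_set a {..<n}"
  shows "integrable (gauss_PiM {..<n}) (\<lambda>x. q (trunc n x))"
proof -
  have tm: "trunc n \<in> measurable (gauss_PiM {..<n}) borel"
  proof (rule measurable_into_sequences)
    fix i show "(\<lambda>\<omega>. trunc n \<omega> i) \<in> borel_measurable (gauss_PiM {..<n})"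
      using measurable_component_singleton[of i "{..<n}" "\<lambda>_. gauss"]
      by (cases "i < n") (auto simp: trunc_def)
  qed
  interpret gauss_lipschitz "{..<n}" "\<lambda>x. q (trunc n x)" 1
  proof
    show "(\<lambda>x. q (trunc n x)) \<in> borel_measurable (gauss_PiM {..<n})"
      using tm sublinear_measurable[OF q] by (rule measurable_compose)
    fix x y
    have "L2_set (\<lambda>i. trunc n x i - trunc n y i) {..<n} = L2_set (\<lambda>i. x i - y i) {..<n}"
      by (intro L2_set_cong) (auto simp: trunc_def)
    thus "q (trunc n x) - q (trunc n y) \<le> 1 * L2_set (\<lambda>i. x i - y i) {..<n}"
      using sublinear_lipschitz[OF q, of "trunc n x" "trunc n y"] by simp
  qed auto
  show ?thesis by (rule integrable_self)
qed

text \<open>A maximum is at most the sum, and both summands have the same mean since the Gaussian is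
  symmetric. Lack of evenness thus costs only a factor 2.\<close>

lemma gauss_mean_symmetrize_le:
  assumes q: "sublinear q" "\<And>a. q a \<le> L2_set a {..<n}" and n: "0 < n"
  shows "gauss_mean n (symmetrize q) \<le> 2 * gauss_mean n q"
proof -
  interpret sublinear q by fact
  have s: "sublinear (symmetrize q)" using even_sublinear_symmetrize by (simp add: even_sublinear_def)
  have q': "sublinear (\<lambda>x. q (- x))" "q (- a) \<le> L2_set a {..<n}" for a
    using sublinear_compose[of uminus] q(2)[of "- a"] by (auto simp: linear_iff L2_set_uminus)
  have "gauss_mean n (symmetrize q) \<le> (\<integral>x. q (trunc n x) + q (- trunc n x) \<partial>gauss_PiM {..<n})"
    unfolding gauss_mean_def
  proof (rule integral_mono)
    show "integrable (gauss_PiM {..<n}) (\<lambda>x. symmetrize q (trunc n x))"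
      using q(2) q'(2) by (intro integrable_gauss_mean[OF s]) (simp add: symmetrize_def)
    show "integrable (gauss_PiM {..<n}) (\<lambda>x. q (trunc n x) + q (- trunc n x))"
      using integrable_gauss_mean[OF q] integrable_gauss_mean[OF q'] by simp
  qed (auto simp: symmetrize_def nonneg)
  also have "\<dots> = gauss_mean n q + gauss_mean n (\<lambda>x. q (- x))"
    unfolding gauss_mean_def
    by (rule Bochner_Integration.integral_add[OF integrable_gauss_mean[OF q] integrable_gauss_mean[OF q']])
  also have "\<dots> = 2 * gauss_mean n q" using gauss_mean_uminus[OF q n] by simp
  finally show ?thesis .
qed

lemma sum_signs_abs:
  fixes h :: "(nat \<Rightarrow> real) \<Rightarrow> real"
  shows "(\<Sum>\<epsilon>\<in>signs A. h (\<lambda>i. \<epsilon> i * x i)) = (\<Sum>\<epsilon>\<in>signs A. h (\<lambda>i. \<epsilon> i * \<bar>x i\<bar>))"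
proof -
  define s where "s i = (if x i < 0 then -1 else 1 :: real)" for i
  have s: "s i * s i = 1" "\<bar>x i\<bar> = s i * x i" for i by (auto simp: s_def)
  have "bij_betw (\<lambda>\<epsilon> i. \<epsilon> i * s i) (signs A) (signs A)"
    by (rule bij_betw_byWitness[where f' = "\<lambda>\<epsilon> i. \<epsilon> i
      * s i"]) (auto simp: s signs_def mult.assoc, auto simp: s_def)
  from sum.reindex_bij_betw[OF this, of "\<lambda>\<epsilon>. h (\<lambda>i. \<epsilon> i * x i)"]
  show ?thesis by (simp add: s(2) mult.assoc)
qed

lemma integral_abs_gauss_coordinate:
  assumes "p \<in> I"
  shows "integrable (gauss_PiM I) (\<lambda>\<omega>. \<bar>\<omega> p\<bar>)" "(\<integral>\<omega>. \<bar>\<omega> p\<bar> \<partial>gauss_PiM I) = sqrt (2 / pi)"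
proof -
  have d: "distributed (gauss_PiM I) lborel (\<lambda>\<omega>. \<omega> p) std_normal_density"
    by (rule distributed_gauss_coordinate[OF assms])
  have hb: "has_bochner_integral lborel (\<lambda>x. std_normal_density x * \<bar>x\<bar>) (sqrt (2 / pi))"
    using std_normal_moment_abs_odd[of 0] by simp
  show "integrable (gauss_PiM I) (\<lambda>\<omega>. \<bar>\<omega> p\<bar>)"
    using hb distributed_integrable[OF d, of abs] by (simp add: has_bochner_integral_iff)
  show "(\<integral>\<omega>. \<bar>\<omega> p\<bar> \<partial>gauss_PiM I) = sqrt (2 / pi)"
    using hb distributed_integral[OF d, of abs] by (simp add: has_bochner_integral_iff)
qed

text \<open>A Gaussian vector is a random sign vector times independent moduli. A functional
  supporting \<open>N\<close> at \<epsilon> shows, as in Jensen's inequality, that replacing the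
  moduli by their mean \<open>sqrt (2 / pi) \<ge> 1 / 2\<close> does not increase the
  expectation.\<close>

lemma sign_average_le_gauss_mean:
  assumes N: "even_sublinear N" and L2: "\<And>a. N a \<le> L2_set a {..<n}" and n: "0 < n"
  shows "(\<Sum>\<epsilon>\<in>signs {..<n}. N \<epsilon>) / 2 ^ n \<le> 2 * gauss_mean n N"
proof -
  interpret even_sublinear N by fact
  define c where "c = sqrt (2 / pi)"
  have c: "1 / 2 \<le> c"
  proof -
    have "(1 / 2 :: real)\<^sup>2 \<le> 2 / 4" by (simp add: power2_eq_square)
    also have "2 / 4 \<le> 2 / pi" using pi_less_4 by (intro divide_left_mono) auto
    finally show ?thesis unfolding c_def by (rule real_le_rsqrt)
  qed
  let ?M = "gauss_PiM ({..<1::nat} \<times> {..<n})"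
  have meas: "N \<in> borel_measurable borel" by (rule sublinear_measurable[OF sublinear_axioms L2])
  define Z where "Z \<epsilon> \<omega> = N (trunc n (\<lambda>i. \<epsilon> i * \<omega> (0, i)))" for \<epsilon> and \<omega> :: "nat \<times> nat \<Rightarrow> real"
  have EZ: "(\<integral>\<omega>. Z \<epsilon> \<omega> \<partial>?M) = gauss_mean n N" if "\<epsilon> \<in> signs {..<n}" for \<epsilon>
  proof -
    have "(\<Sum>j<1::nat. (\<epsilon> i)\<^sup>2) = 1" if "i < n" for i
      using \<open>\<epsilon> \<in> signs {..<n}\<close> that by (auto simp: signs_def) (metis power2_minus power_one lessThan_iff)
    from gauss_mean_combination(1)[OF n this meas] show ?thesis by (simp add: Z_def)
  qed
  have iZ: "integrable ?M (Z \<epsilon>)" if "\<epsilon> \<in> signs {..<n}" for \<epsilon>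
  proof -
    have "(\<Sum>j<1::nat. (\<epsilon> i)\<^sup>2) = 1" if "i < n" for i
      using \<open>\<epsilon> \<in> signs {..<n}\<close> that by (auto simp: signs_def) (metis power2_minus power_one lessThan_iff)
    from gauss_mean_combination(2)[OF n this meas integrable_gauss_mean[OF sublinear_axioms L2]]
    show ?thesis by (simp add: Z_def[abs_def])
  qed
    define Y where "Y \<epsilon> \<omega> = N (trunc n (\<lambda>i. \<epsilon> i * \<bar>\<omega> (0, i)\<bar>))" for \<epsilon> and \<omega> :: "nat \<times> nat \<Rightarrow> real"
  have YZ: "(\<Sum>\<epsilon>\<in>signs {..<n}. Z \<epsilon> \<omega>) = (\<Sum>\<epsilon>\<in>signs {..<n}. Y \<epsilon> \<omega>)" for \<omega>
    unfolding Y_def Z_def by (rule sum_signs_abs)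
  have "\<exists>\<phi>. (\<forall>a. (\<Sum>i<n. \<phi> i * a i) \<le> N a) \<and> (\<Sum>i<n. \<phi> i * \<epsilon> i) = N \<epsilon>" for \<epsilon>
    using ex_supporting_functional[OF sublinear_axioms, of 1 n \<epsilon>] L2 by auto
  then obtain \<phi> where phi: "\<And>\<epsilon> a. (\<Sum>i<n. \<phi> \<epsilon> i * a i) \<le> N a" "\<And>\<epsilon>. (\<Sum>i<n. \<phi> \<epsilon> i * \<epsilon> i) = N \<epsilon>" by metis
  define X where "X \<epsilon> \<omega> = (\<Sum>i<n. \<phi> \<epsilon> i * \<epsilon> i * \<bar>\<omega> (0, i)\<bar>)" for \<epsilon> and \<omega> :: "nat \<times> nat \<Rightarrow> real"
  have XY: "X \<epsilon> \<omega> \<le> Y \<epsilon> \<omega>" for \<epsilon> \<omega>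
  proof -
    have "X \<epsilon> \<omega> = (\<Sum>i<n. \<phi> \<epsilon> i * trunc n (\<lambda>i. \<epsilon> i * \<bar>\<omega> (0, i)\<bar>) i)"
      by (auto simp: X_def trunc_def mult.assoc intro!: sum.cong)
    also have "\<dots> \<le> Y \<epsilon> \<omega>" unfolding Y_def by (rule phi)
    finally show ?thesis .
  qed
  have int1: "integrable ?M (\<lambda>\<omega>. \<bar>\<omega> (0, i)\<bar>)" "(\<integral>\<omega>. \<bar>\<omega> (0, i)\<bar> \<partial>?M) = c" if "i < n" for i
    using integral_abs_gauss_coordinate[of "(0, i)" "{..<1::nat} \<times> {..<n}"] that by (auto simp: c_def)
  have iX: "integrable ?M (X \<epsilon>)" for \<epsilon>
    unfolding X_def using int1 by (intro Bochner_Integration.integrable_sum integrable_mult_right) auto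
  have EX: "(\<integral>\<omega>. X \<epsilon> \<omega> \<partial>?M) = c * N \<epsilon>" for \<epsilon>
  proof -
    have "(\<integral>\<omega>. X \<epsilon> \<omega> \<partial>?M) = (\<Sum>i<n. (\<integral>\<omega>. \<phi> \<epsilon> i * \<epsilon> i * \<bar>\<omega> (0, i)\<bar> \<partial>?M))"
      unfolding X_def using int1 by (intro Bochner_Integration.integral_sum integrable_mult_right) auto
    also have "\<dots> = (\<Sum>i<n. \<phi> \<epsilon> i * \<epsilon> i * c)" using int1 by (intro sum.cong) auto
    finally show ?thesis by (simp add: phi(2)[symmetric] sum_distrib_left mult_ac)
  qed
  have "(\<Sum>\<epsilon>\<in>signs {..<n}. c * N \<epsilon>) = (\<integral>\<omega>. (\<Sum>\<epsilon>\<in>signs {..<n}. X \<epsilon> \<omega>) \<partial>?M)"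
    unfolding EX[symmetric] by (rule Bochner_Integration.integral_sum[symmetric]) (rule iX)
  also have "\<dots> \<le> (\<integral>\<omega>. (\<Sum>\<epsilon>\<in>signs {..<n}. Z \<epsilon> \<omega>) \<partial>?M)"
  proof (rule integral_mono)
    show "integrable ?M (\<lambda>\<omega>. \<Sum>\<epsilon>\<in>signs {..<n}. X \<epsilon> \<omega>)" using iX by (intro Bochner_Integration.integrable_sum)
    show "integrable ?M (\<lambda>\<omega>. \<Sum>\<epsilon>\<in>signs {..<n}. Z \<epsilon> \<omega>)" using iZ by (intro Bochner_Integration.integrable_sum)
  qed (auto simp: YZ intro!: sum_mono XY)
  also have "\<dots> = (\<Sum>\<epsilon>\<in>signs {..<n}. \<integral>\<omega>. Z \<epsilon> \<omega> \<partial>?M)"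
    by (rule Bochner_Integration.integral_sum) (rule iZ)
  also have "\<dots> = (\<Sum>\<epsilon>\<in>signs {..<n}. gauss_mean n N)" by (rule sum.cong[OF refl]) (rule EZ)
  also have "\<dots> = 2 ^ n * gauss_mean n N" by (simp add: card_signs)
  finally have "c * ((\<Sum>\<epsilon>\<in>signs {..<n}. N \<epsilon>) / 2 ^ n) \<le> gauss_mean n N"
    by (simp add: sum_distrib_left[symmetric] field_simps)
  moreover have "1 / 2 * ((\<Sum>\<epsilon>\<in>signs {..<n}. N \<epsilon>) / 2 ^ n) \<le> c * ((\<Sum>\<epsilon>\<in>signs {..<n}. N \<epsilon>) / 2 ^ n)"
    using c by (intro mult_right_mono) (auto intro!: divide_nonneg_pos sum_nonneg nonneg)
  ultimately show ?thesis by simp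
qed

section \<open>Nearly maximal determinants\<close>

definition family_det :: "nat \<Rightarrow> (nat \<Rightarrow> nat \<Rightarrow> real) \<Rightarrow> real"
  where "family_det d u = Determinant.det (Matrix.mat d d (\<lambda>(k, i). u k i))"

lemma family_det_bounded:
  assumes "\<And>k i. k < d \<Longrightarrow> i < d \<Longrightarrow> \<bar>u k i\<bar> \<le> b"
  shows "\<bar>family_det d u\<bar> \<le> fact d * b ^ d"
proof -
  let ?P = "{p. p permutes {0..<d}}"
  have less: "p i < d" if "p permutes {0..<d}" "i < d" for p i
    using permutes_in_image[OF that(1), of i] that(2) by simp
  have "family_det d u = (\<Sum>p\<in>?P. signof p * (\<Prod>i = 0..<d. u i (p i)))"
    unfolding family_det_def Determinant.det_def
    by (auto intro!: sum.cong prod.cong simp: less)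
  also have "\<bar>\<dots>\<bar> \<le> (\<Sum>p\<in>?P. b ^ d)"
  proof (rule order_trans[OF sum_abs sum_mono])
    fix p assume p: "p \<in> ?P"
    have "\<bar>signof p * (\<Prod>i = 0..<d. u i (p i))\<bar> = (\<Prod>i = 0..<d. \<bar>u i (p i)\<bar>)"
      by (simp add: abs_mult abs_prod sign_def)
    also have "\<dots> \<le> (\<Prod>i = 0..<d. b)"
      using p assms by (intro prod_mono) (auto simp: less)
    finally show "\<bar>signof p * (\<Prod>i = 0..<d. u i (p i))\<bar> \<le> b ^ d" by simp
  qed
  also have "\<dots> = fact d * b ^ d" by (simp add: card_permutations[of _ d])
  finally show ?thesis .
qed

lemma family_det_mult:
  "family_det d (\<lambda>k i. \<Sum>l<d. c k l * u l i) = family_det d c * family_det d u"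
proof -
  have "Matrix.mat d d (\<lambda>(k, i). \<Sum>l<d. c k l * u l i) =
    Matrix.mat d d (\<lambda>(k, i). c k i) * Matrix.mat d d (\<lambda>(k, i). u k i)"
    by (rule eq_matI) (auto simp: scalar_prod_def lessThan_atLeast0 intro!: sum.cong)
  thus ?thesis unfolding family_det_def by (simp add: Determinant.det_mult[of _ d])
qed

lemma family_det_diagonal:
  "family_det d (\<lambda>k i. if k = i then D k else 0) = (\<Prod>k<d. D k)"
proof -
  let ?A = "Matrix.mat d d (\<lambda>(k, i). if k = i then D k else 0)"
  have "Determinant.det ?A = prod_list (diag_mat ?A)"
    by (rule det_upper_triangular[of _ d]) auto
  also have "\<dots> = (\<Prod>k<d. D k)"
    unfolding diag_mat_def by (auto simp: prod.list_conv_set_nth lessThan_atLeast0 intro!: prod.cong)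
  finally show ?thesis by (simp add: family_det_def)
qed

lemma family_det_scale: "family_det d (\<lambda>k i. D k * v k i) = (\<Prod>k<d. D k) * family_det d v"
proof -
  have "family_det d (\<lambda>k i. \<Sum>l<d. (if k = l then D k else 0) * v l i) = (\<Prod>k<d. D k) * family_det d v"
    unfolding family_det_mult family_det_diagonal ..
  moreover have "Matrix.mat d d (\<lambda>(k, i). \<Sum>l<d. (if k = l then D k else 0) * v l i)
    = Matrix.mat d d (\<lambda>(k, i). D k * v k i)"
    by (rule eq_matI) (auto simp: if_distrib[of "\<lambda>x. x * _"] cong: if_cong)
  ultimately show ?thesis by (simp add: family_det_def)
qed

definition orthonormal :: "nat \<Rightarrow> nat \<Rightarrow> (nat \<Rightarrow> nat \<Rightarrow> real) \<Rightarrow> bool"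
  where "orthonormal d j v \<longleftrightarrow>
    (\<forall>i<j. \<forall>k<j. (\<Sum>l<d. v i l * v k l) = (if i = k then 1 else 0))"

lemma family_det_orthonormal:
  assumes "orthonormal d d v"
  shows "\<bar>family_det d v\<bar> = 1"
proof -
  let ?A = "Matrix.mat d d (\<lambda>(k, i). v k i)"
  have "?A * transpose_mat ?A = 1\<^sub>m d"
    using assms by (intro eq_matI) (auto simp: scalar_prod_def lessThan_atLeast0 orthonormal_def)
  hence "Determinant.det ?A * Determinant.det (transpose_mat ?A) = 1"
    by (metis Determinant.det_mult det_one mat_carrier transpose_carrier_mat)
  hence "family_det d v * family_det d v = 1"
    by (simp add: family_det_def Determinant.det_transpose[of _ d])
  thus ?thesis by (metis abs_mult abs_one power2_eq_square power2_abs abs_square_eq_1)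
qed

lemma L2_orthonormal_combination:
  assumes v: "orthonormal d j v" and S: "S \<subseteq> {..<j}"
  shows "L2_set (\<lambda>l. \<Sum>k\<in>S. c k * v k l) {..<d} = L2_set c S"
proof -
  have fin: "finite S" using S finite_subset by blast
  have "(\<Sum>l<d. (\<Sum>k\<in>S. c k * v k l)\<^sup>2) = (\<Sum>l<d. \<Sum>k\<in>S. \<Sum>i\<in>S. (c k * v k l) * (c i * v i l))"
    by (simp add: power2_eq_square sum_product)
  also have "\<dots> = (\<Sum>k\<in>S. \<Sum>l<d. \<Sum>i\<in>S. (c k * v k l) * (c i * v i l))"
    by (rule sum.swap)
  also have "\<dots> = (\<Sum>k\<in>S. \<Sum>i\<in>S. \<Sum>l<d. (c k * v k l) * (c i * v i l))"
    by (rule sum.cong[OF refl]) (rule sum.swap)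
  also have "\<dots> = (\<Sum>k\<in>S. \<Sum>i\<in>S. c k * c i * (\<Sum>l<d. v k l * v i l))"
    by (simp add: sum_distrib_left mult_ac)
  also have "\<dots> = (\<Sum>k\<in>S. \<Sum>i\<in>S. if i = k then (c k)\<^sup>2 else 0)"
    using v S by (intro sum.cong refl) (auto simp: orthonormal_def power2_eq_square subset_iff)
  also have "\<dots> = (\<Sum>k\<in>S. (c k)\<^sup>2)" using fin by simp
  finally show ?thesis by (simp add: L2_set_def)
qed

lemma ex_orthogonal_unit_vector:
  fixes v :: "nat \<Rightarrow> nat \<Rightarrow> real"
  assumes "j < d"
  shows "\<exists>w\<in>coord_space d. L2_set w {..<d} = 1 \<and> (\<forall>i<j. (\<Sum>l<d. v i l * w l) = 0)"
proof -
  define f where "f w = (\<lambda>i. if i < j then \<Sum>l<d. v i l * w l else 0)" for w :: "nat \<Rightarrow> real"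
  have lin: "linear f"
    by (intro linearI) (auto simp: f_def fun_eq_iff sum.distrib algebra_simps sum_distrib_left)
  have "\<not> inj_on f (coord_space d)"
  proof
    assume inj: "inj_on f (coord_space d)"
    let ?B = "unit_seq ` {..<d}"
    have "independent (f ` ?B)"
      using inj independent_unit_seq
      by (intro linear_independent_injective_image[OF lin]) (auto simp: coord_space_eq_span)
    moreover have "f ` ?B \<subseteq> span (unit_seq ` {..<j})"
      unfolding coord_space_eq_span[symmetric] by (auto simp: f_def topspace_Euclidean_space)
    ultimately have "card (f ` ?B) \<le> card (unit_seq ` {..<j})"
      by (intro conjunct2[OF independent_span_bound]) auto
    also have "\<dots> \<le> j" using card_image_le[of "{..<j}" unit_seq] by simp
    finally have "card (f ` ?B) \<le> j" .
    moreover have "card (f ` ?B) = card ?B"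
      by (rule card_image, rule inj_on_subset[OF inj]) (auto simp: coord_space_eq_span intro: span_base)
    moreover have "card ?B = d" by (simp add: card_image inj_on_subset[OF inj_unit_seq])
    ultimately show False using assms by simp
  qed
  then obtain w where w: "w \<in> coord_space d" "f w = 0" "w \<noteq> 0"
    using linear_inj_on_iff_eq_0[OF lin subspace_coord_space] by blast
  have pos: "0 < L2_set w {..<d}"
  proof -
    obtain i where "w i \<noteq> 0" using w(3) by (auto simp: fun_eq_iff)
    moreover from this have "i
      < d" using w(1) by (auto simp: topspace_Euclidean_space not_le[symmetric])
    ultimately have "L2_set w {..<d} \<noteq> 0" by (auto simp: L2_set_eq_0_iff)
    thus ?thesis using L2_set_nonneg[of w "{..<d}"] by linarith
  qed
  define u where "u = (1 / L2_set w {..<d}) *\<^sub>R w"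
  have "L2_set u {..<d} = 1" unfolding u_def L2_set_scaleR using pos by simp
  moreover have "u \<in> coord_space d" unfolding u_def by (intro subspace_scale subspace_coord_space w)
  moreover have "(\<Sum>l<d. v i l * u l) = 0" if "i < j" for i
  proof -
    have "(\<Sum>l<d. v i l * w l) = 0" using fun_cong[OF w(2), of i] that by (simp add: f_def)
    thus ?thesis by (simp add: u_def sum_divide_distrib[symmetric])
  qed
  ultimately show ?thesis by blast
qed

text \<open>A greedy choice: each vector nearly maximises \<open>L\<close> on the unit sphere of the
  orthogonal complement of the earlier ones. Accepting half of the supremum avoids showing that it
  is attained.\<close>

lemma ex_orthonormal_near_maximal:
  fixes L :: "(nat \<Rightarrow> real) \<Rightarrow> real"
  assumes L: "\<And>w. 0 \<le> L w" "\<And>w. L w \<le> L2_set w {..<d}" and j: "j \<le> d"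
  shows "\<exists>v. orthonormal d j v \<and> (\<forall>i<j. v i \<in> coord_space d \<and>
    (\<forall>w\<in>coord_space d. L2_set w {..<d} = 1 \<longrightarrow> (\<forall>k<i. (\<Sum>l<d. v k l * w l) = 0) \<longrightarrow> L w \<le> 2 * L (v i)))"
  using j
proof (induction j)
  case (Suc j)
  then obtain v where V: "orthonormal d j v" "\<forall>i<j. v i \<in> coord_space d \<and>
    (\<forall>w\<in>coord_space d. L2_set w {..<d} = 1 \<longrightarrow> (\<forall>k<i. (\<Sum>l<d. v k l * w l) = 0) \<longrightarrow> L w \<le> 2 * L (v i))"
    using Suc_leD by blast
  have v: "orthonormal d j v" "\<And>i. i < j \<Longrightarrow> v i \<in> coord_space d"
    "\<And>i w. i < j \<Longrightarrow> w \<in> coord_space d \<Longrightarrow> L2_set w {..<d} = 1 \<Longrightarrow> (\<And>k. k < i \<Longrightarrow> (\<Sum>l<d. v k l * w l) = 0) \<Longrightarrow> L w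
      \<le> 2 * L (v i)"
    using V by simp_all
  define W where "W = {w \<in> coord_space d. L2_set w {..<d} = 1 \<and> (\<forall>i<j. (\<Sum>l<d. v i l * w l) = 0)}"
  have W: "W \<noteq> {}" using ex_orthogonal_unit_vector[of j d v] Suc.prems by (auto simp: W_def)
  have "L x \<le> 1" if "x \<in> W" for x using L(2)[of x] that by (simp add: W_def)
  hence bdd: "bdd_above (L ` W)" by (rule bdd_aboveI2)
  obtain x where x: "x \<in> W" "\<And>w. w \<in> W \<Longrightarrow> L w \<le> 2 * L x"
  proof (cases "(SUP w\<in>W. L w) > 0")
    case True
    hence "(SUP w\<in>W. L w) / 2 < (SUP w\<in>W. L w)" by simp
    then obtain x where x: "x \<in> W" "(SUP w\<in>W. L w) / 2 < L x"
      using less_cSUP_iff[OF W bdd] by blast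
    have "L w \<le> 2 * L x" if "w \<in> W" for w using cSUP_upper[OF that bdd] x(2) by simp
    thus ?thesis using that x(1) by blast
  next
    \<comment> \<open>The supremum is not positive, so \<open>L\<close> vanishes on the whole sphere
      and any point will do.\<close>
    case False
    obtain x where "x \<in> W" using W by blast
    moreover have "L w \<le> 2 * L x" if "w \<in> W" for w
      using cSUP_upper[OF that bdd] False L(1)[of x] by simp
    ultimately show ?thesis using that by blast
  qed
  define v' where "v' = v(j := x)"
  have xx: "(\<Sum>l<d. x l * x l) = 1"
  proof -
    have "(L2_set x {..<d})\<^sup>2 = 1" using x(1) by (simp add: W_def)
    thus ?thesis by (simp add: L2_set_def sum_nonneg power2_eq_square)
  qed
  have "orthonormal d (Suc j) v'"
    using v(1) x(1) xx by (auto simp: orthonormal_def v'_def less_Suc_eq W_def mult.commute)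
  moreover have "v' i \<in> coord_space d" if "i < Suc j" for i
    using that v(2) x(1) by (auto simp: v'_def W_def less_Suc_eq)
  moreover have "L w \<le> 2 * L (v' i)"
    if "i < Suc j" "w \<in> coord_space d" "L2_set w {..<d} = 1" "\<And>k. k < i \<Longrightarrow> (\<Sum>l<d. v' k l * w l)
      = 0" for i w
  proof (cases "i = j")
    case True
    have "w \<in> W" using that True by (auto simp: W_def v'_def)
    thus ?thesis using x(2) True by (simp add: v'_def)
  next
    case False
    hence i: "i < j" using that by simp
    have "(\<Sum>l<d. v k l * w l) = 0" if "k < i" for k
      using \<open>\<And>k. k < i \<Longrightarrow> (\<Sum>l<d. v' k l * w l) = 0\<close>[OF that] that i by (simp add: v'_def)
    thus ?thesis using v(3)[OF i that(2,3)] i by (simp add: v'_def)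
  qed
  ultimately show ?case by (intro exI[of _ v'] conjI allI impI ballI) simp_all
qed (simp add: orthonormal_def)

text \<open>If the functional were small on the orthogonal complement of few \<open>v i\<close>, then expanding by
  \<open>3 / sqrt 2\<close> there and contracting by \<open>1 / sqrt 2\<close> on the span would more than double the
  determinant.\<close>

theorem dvoretzky_rogers:
  assumes N: "even_sublinear N" and d: "0 < d"
    and R: "\<And>a. N a \<le> R * L2_set a {..<d}" and r: "0 < r" "\<And>a i. i < d \<Longrightarrow> r * \<bar>a i\<bar> \<le> N a"
  shows "\<exists>x. (\<forall>i. x i \<in> coord_space d) \<and> (\<forall>a. N (\<Sum>i<(d + 1) div 2. a i *\<^sub>R x i) \<le> L2_set a {..<(d + 1) div 2}) \<and>
    (\<forall>i<(d + 1) div 2. 1 / 6 \<le> N (x i))"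
proof -
  interpret even_sublinear N by fact
  define comb where "comb u a = (\<Sum>k<d. a k *\<^sub>R u k)" for u :: "nat \<Rightarrow> nat \<Rightarrow> real" and a :: "nat \<Rightarrow> real"
  \<comment> \<open>The linear maps from the Euclidean ball into the unit ball of \<open>N\<close>.
    Maximising the determinant is maximising the volume of an inscribed ellipsoid.\<close>
  define U where "U = {u. (\<forall>k. u k \<in> coord_space d) \<and> (\<forall>a. N (comb u a) \<le> L2_set a {..<d})}"
  have Ule: "N (comb u a) \<le> L2_set a {..<d}" if "u \<in> U" for u a using that by (simp add: U_def)
  have ub: "\<bar>u k i\<bar> \<le> 1 / r" if "u \<in> U" "k < d" "i < d" for u k i
  proof -
    have "comb u (unit_seq k) = (\<Sum>l<d. if l = k then u k else 0)"
      unfolding comb_def by (intro sum.cong) (auto simp: unit_seq_def)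
    hence "comb u (unit_seq k) = u k" using that by simp
    hence "N (u k) \<le> L2_set (unit_seq k) {..<d}" using Ule[OF that(1), of "unit_seq k"] by simp
    also have "\<dots> = 1"
    proof -
      have "(\<Sum>i<d. (unit_seq k i)\<^sup>2) = (\<Sum>i<d. if i = k then 1 else 0)"
        by (intro sum.cong) (auto simp: unit_seq_def)
      thus ?thesis using that(2) by (simp add: L2_set_def)
    qed
    finally have "r * \<bar>u k i\<bar> \<le> 1" using r(2)[OF that(3), of "u k"] by simp
    thus ?thesis using r(1) by (simp add: field_simps)
  qed
  define s where "s = (SUP u\<in>U. \<bar>family_det d u\<bar>)"
  have bdd: "bdd_above ((\<lambda>u. \<bar>family_det d u\<bar>) ` U)"
    using family_det_bounded[OF ub] by (intro bdd_aboveI2)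
  have s_up: "\<bar>family_det d u\<bar> \<le> s" if "u \<in> U" for u
    unfolding s_def by (rule cSUP_upper[OF that bdd])
  \<comment> \<open>A small multiple of the unit vectors shows that the supremum of determinants is
    positive. \<open>max R 1\<close> makes the multiple positive whatever the sign of
    \<open>R\<close>.\<close>
  define c where "c = 1 / max R 1"
  have c: "0 < c" "R * c \<le> 1" by (auto simp: c_def divide_simps max_def)
  define u0 where "u0 k = (if k < d then c *\<^sub>R unit_seq k else 0)" for k
  have "u0 \<in> U"
  proof -
    have "N (comb u0 a) \<le> L2_set a {..<d}" for a
    proof -
      have eq: "comb u0 a = c *\<^sub>R (\<Sum>k<d. a k *\<^sub>R unit_seq k)"
        unfolding comb_def scaleR_sum_right by (intro sum.cong) (auto simp: u0_def)
      have "N (comb u0 a) = c * N (\<Sum>k<d. a k *\<^sub>R unit_seq k)" unfolding eq using c by (simp add: scale)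
      also have "\<dots> \<le> c * (R * L2_set (\<Sum>k<d. a k *\<^sub>R unit_seq k) {..<d})"
        using c R by (intro mult_left_mono) auto
      also have "L2_set (\<Sum>k<d. a k *\<^sub>R unit_seq k) {..<d} = L2_set a {..<d}"
        by (intro L2_set_cong) (auto simp: sum_unit_seq_apply)
      also have "c * (R * L2_set a {..<d}) = (R * c) * L2_set a {..<d}" by simp
      also have "\<dots> \<le> 1 * L2_set a {..<d}" using c by (intro mult_right_mono) auto
      finally show ?thesis by simp
    qed
    thus ?thesis by (auto simp: U_def u0_def topspace_Euclidean_space unit_seq_def)
  qed
  moreover have "family_det d u0 = c ^ d"
  proof -
    have "Matrix.mat d d (\<lambda>(k, i). u0 k i) = Matrix.mat d d (\<lambda>(k, i). if k = i then c else 0)"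
      by (rule eq_matI) (auto simp: u0_def unit_seq_def)
    thus ?thesis using family_det_diagonal[of d "\<lambda>_. c"] by (simp add: family_det_def)
  qed
  ultimately have s: "0
    < s" and ne: "U \<noteq> {}" using s_up[of u0] c by (auto intro: less_le_trans[of 0 "c ^ d"])
  have "s / 2 < (SUP u\<in>U. \<bar>family_det d u\<bar>)" using s by (simp add: s_def)
  then obtain u where u: "u \<in> U" "s / 2 < \<bar>family_det d u\<bar>" using less_cSUP_iff[OF ne bdd] by blast
  define L where "L a = N (comb u a)" for a
  have lin: "linear (comb u)"
    by (intro linearI) (simp_all add: comb_def scaleR_add_left sum.distrib scaleR_sum_right)
  interpret L: sublinear L unfolding L_def by (rule sublinear_compose[OF lin])
  have Lle: "L a \<le> L2_set a {..<d}" for a using u(1) by (simp add: U_def L_def)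
  obtain v where V: "orthonormal d d v" "\<forall>i<d. v i \<in> coord_space d \<and>
    (\<forall>w\<in>coord_space d. L2_set w {..<d} = 1 \<longrightarrow> (\<forall>k<i. (\<Sum>l<d. v k l * w l) = 0) \<longrightarrow> L w \<le> 2 * L (v i))"
    using ex_orthonormal_near_maximal[of L d d, OF L.nonneg Lle order_refl] by blast
  have v: "orthonormal d d v" "\<And>i. i < d \<Longrightarrow> v i \<in> coord_space d"
    "\<And>i w. i < d \<Longrightarrow> w \<in> coord_space d \<Longrightarrow> L2_set w {..<d} = 1 \<Longrightarrow> (\<And>k. k < i \<Longrightarrow> (\<Sum>l<d. v k l * w l) = 0) \<Longrightarrow> L w
      \<le> 2 * L (v i)"
    using V by simp_all
  have comb_sum: "comb u (\<lambda>l. \<Sum>k\<in>S. a k * v k l) = (\<Sum>k\<in>S. a k *\<^sub>R comb u (v k))" if "finite S" for S a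
  proof -
    have "(\<lambda>l. \<Sum>k\<in>S. a k * v k l) = (\<Sum>k\<in>S. a k *\<^sub>R v k)" by (simp add: fun_eq_iff sum_fun_apply)
    thus ?thesis by (simp add: linear_sum[OF lin] linear_cmul[OF lin])
  qed
  have large: "1 / 6 \<le> L (v j)" if j: "2 * j < d" for j
  proof (rule ccontr)
    assume "\<not> 1 / 6 \<le> L (v j)"
    hence small1: "L w \<le> 1 / 3" if "w \<in> coord_space d" "L2_set w {..<d} = 1" "\<And>k. k < j
      \<Longrightarrow> (\<Sum>l<d. v k l * w l) = 0" for w
      using v(3)[of j w] that j by force
    have small: "L w \<le> L2_set w {..<d} / 3" if w: "w \<in> coord_space d" "\<And>k. k < j \<Longrightarrow> (\<Sum>l<d. v k l * w l)
      = 0" for w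
    proof (cases "L2_set w {..<d} = 0")
      case True
      thus ?thesis using Lle[of w] by simp
    next
      case False
      hence pos: "0 < L2_set w {..<d}" using L2_set_nonneg[of w "{..<d}"] by linarith
      define x where "x = (1 / L2_set w {..<d}) *\<^sub>R w"
      have "L2_set x {..<d} = 1" unfolding x_def L2_set_scaleR using pos by simp
      moreover have "x \<in> coord_space d" unfolding x_def by (intro subspace_scale subspace_coord_space w)
      moreover have "(\<Sum>l<d. v k l * x l) = 0" if "k < j" for k
        using w(2)[OF that] by (simp add: x_def sum_divide_distrib[symmetric])
      ultimately have "L x \<le> 1 / 3" by (intro small1)
      moreover have "w = L2_set w {..<d} *\<^sub>R x" using pos by (simp add: x_def)
      hence "L w = L2_set w {..<d} * L x" using pos by (metis L.scale less_imp_le)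
      ultimately show ?thesis using mult_left_mono[of "L x" "1 / 3" "L2_set w {..<d}"] pos by simp
    qed
    \<comment> \<open>On the complement \<open>L\<close> is at most a third of the norm, which pays
      for the factor 3. The two parts of a vector add up to at most
      \<open>(p + q) / sqrt 2 \<le> sqrt (p\<^sup>2 + q\<^sup>2)\<close>, so the new family is
      admissible.\<close>
    define D where "D k = (if k < j then 1 / sqrt 2 else 3 / sqrt 2 :: real)" for k
    define u' where "u' k = (if k < d then D k *\<^sub>R comb u (v k) else 0)" for k
    have comb_coord: "comb u a \<in> coord_space d" for a
      unfolding comb_def using u(1)
      by (intro subspace_sum subspace_scale subspace_coord_space) (auto simp: U_def)
    have "u' \<in> U"
    proof -
      have "N (comb u' a) \<le> L2_set a {..<d}" for a
      proof -
        define y where "y = (\<lambda>l. \<Sum>k<j. (a k * D k) * v k l)"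
        define z where "z = (\<lambda>l. \<Sum>k\<in>{j..<d}. (a k * D k) * v k l)"
        have dj: "{..<d} = {..<j} \<union> {j..<d}" "{..<j} \<inter> {j..<d} = {}" using j by auto
        have "comb u' a = (\<Sum>k<d. (a k * D k) *\<^sub>R comb u (v k))"
          unfolding comb_def[of u'] by (intro sum.cong) (auto simp: u'_def)
        also have "\<dots> = (\<Sum>k<j. (a k * D k) *\<^sub>R comb u (v k))
          + (\<Sum>k\<in>{j..<d}. (a k * D k) *\<^sub>R comb u (v k))"
          unfolding dj(1) using dj(2) by (intro sum.union_disjoint) auto
        also have "\<dots> = comb u y + comb u z" unfolding y_def z_def by (simp add: comb_sum)
        finally have "N (comb u' a) \<le> L y + L z" using triangle by (simp add: L_def)
        also have "L y \<le> L2_set y {..<d}" by (rule Lle)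
        also have "L2_set y {..<d} = L2_set (\<lambda>k. a k * D k) {..<j}"
          unfolding y_def using j by (intro L2_orthonormal_combination[OF v(1)]) auto
        also have "\<dots> = L2_set (\<lambda>k. a k * (1 / sqrt 2)) {..<j}"
          by (intro L2_set_cong) (auto simp: D_def)
        also have "\<dots> = L2_set a {..<j} * (1 / sqrt 2)" by (rule L2_set_left_distrib[symmetric]) simp
        also have "L z \<le> L2_set z {..<d} / 3"
        proof (rule small)
          show "z \<in> coord_space d"
            using v(2) by (auto simp: z_def topspace_Euclidean_space intro!: sum.neutral)
          fix i assume i: "i < j"
          have "(\<Sum>l<d. v i l * z l) = (\<Sum>k\<in>{j..<d}. (a k * D k) * (\<Sum>l<d. v i l * v k l))"
            unfolding z_def sum_distrib_left by (subst sum.swap) (simp add: mult_ac)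
          also have "\<dots> = 0"
            using v(1) i j by (intro sum.neutral) (auto simp: orthonormal_def)
          finally show "(\<Sum>l<d. v i l * z l) = 0" .
        qed
        also have "L2_set z {..<d} = L2_set (\<lambda>k. a k * D k) {j..<d}"
          unfolding z_def by (intro L2_orthonormal_combination[OF v(1)]) auto
        also have "\<dots> = L2_set (\<lambda>k. a k * (3 / sqrt 2)) {j..<d}"
          by (intro L2_set_cong) (auto simp: D_def)
        also have "\<dots> = L2_set a {j..<d} * (3 / sqrt 2)" by (rule L2_set_left_distrib[symmetric]) simp
        finally have "N (comb u' a) \<le> (L2_set a {..<j} + L2_set a {j..<d}) / sqrt 2"
          by (simp add: add_divide_distrib)
        also have "\<dots> \<le> L2_set a {..<d}"
        proof -
          define p q where "p = L2_set a {..<j}" and "q = L2_set a {j..<d}"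
          have "(L2_set a {..<d})\<^sup>2 = p\<^sup>2 + q\<^sup>2"
            unfolding p_def q_def L2_set_def dj(1)
            by (subst sum.union_disjoint) (auto simp: sum_nonneg)
          moreover have "((p + q) / sqrt 2)\<^sup>2 \<le> p\<^sup>2 + q\<^sup>2"
            using zero_le_power2[of "p - q"] by (simp add: power_divide power2_sum power2_diff)
          ultimately have "((p + q) / sqrt 2)\<^sup>2 \<le> (L2_set a {..<d})\<^sup>2" by simp
          hence "(p + q) / sqrt 2 \<le> L2_set a {..<d}" by (rule power2_le_imp_le) simp
          thus ?thesis unfolding p_def q_def .
        qed
        finally show ?thesis .
      qed
      thus ?thesis using comb_coord
        by (auto simp: U_def u'_def intro!: subspace_scale subspace_coord_space subspace_0)
    qed
    hence "\<bar>family_det d u'\<bar> \<le> s" by (rule s_up)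
    moreover have "\<bar>family_det d u'\<bar> = (\<Prod>k<d. D k) * \<bar>family_det d u\<bar>"
    proof -
      have "Matrix.mat d d (\<lambda>(k, i). u' k i) = Matrix.mat d d (\<lambda>(k, i). \<Sum>l<d. (D k * v k l) * u l i)"
        by (rule eq_matI) (auto simp: u'_def comb_def sum_fun_apply sum_distrib_left mult_ac)
      hence "family_det d u' = family_det d (\<lambda>k i. D k * v k i) * family_det d u"
        using family_det_mult[of d "\<lambda>k i. D k * v k i" u] by (simp add: family_det_def)
      moreover have "0 \<le> (\<Prod>k<d. D k)" by (intro prod_nonneg) (simp add: D_def)
      ultimately show ?thesis
        unfolding family_det_scale by (simp add: abs_mult family_det_orthonormal[OF v(1)])
    qed
    \<comment> \<open>The square is \<open>(9 / 4) ^ j * (9 / 2) ^ (d - 2 * j)\<close>, at least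
      \<open>9 / 2\<close> because \<open>2 * j < d\<close>. This restriction on \<open>j\<close> is
      why the construction stops at \<open>(d + 1) div 2\<close> vectors.\<close>
    moreover have "2 \<le> (\<Prod>k<d. D k)"
    proof -
      have "(\<Prod>k<d. D k)\<^sup>2 = (\<Prod>k<d. (D k)\<^sup>2)" by (simp add: prod_power_distrib)
      also have "\<dots> = (\<Prod>k<j. (D k)\<^sup>2) * (\<Prod>k\<in>{j..<d}. (D k)\<^sup>2)"
      proof -
        have "{..<d} = {..<j} \<union> {j..<d}" using j by auto
        hence "(\<Prod>k<d. (D k)\<^sup>2) = (\<Prod>k\<in>{..<j} \<union> {j..<d}. (D k)\<^sup>2)" by simp
        also have "\<dots> = (\<Prod>k<j. (D k)\<^sup>2) * (\<Prod>k\<in>{j..<d}. (D k)\<^sup>2)"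
          by (rule prod.union_disjoint) auto
        finally show ?thesis .
      qed
      also have "\<dots> = (1 / 2) ^ j * (9 / 2) ^ (d - j)"
        by (simp add: D_def power_divide)
      also have "d - j = j + (d - 2 * j)" using j by simp
      also have "(1 / 2 :: real) ^ j * (9 / 2) ^ (j + (d - 2 * j)) = (9 / 4) ^ j
        * (9 / 2) ^ (d - 2 * j)"
        by (simp add: power_add power_mult_distrib[symmetric])
      finally have sq: "(\<Prod>k<d. D k)\<^sup>2 = (9 / 4) ^ j * (9 / 2) ^ (d - 2 * j)" .
      have "(9 / 2 :: real) ^ 1 \<le> (9 / 2) ^ (d - 2 * j)" using j by (intro power_increasing) auto
      hence "1 * (9 / 2 :: real) \<le> (9 / 4) ^ j * (9 / 2) ^ (d - 2 * j)" by (intro mult_mono) auto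
      hence "2\<^sup>2 \<le> (\<Prod>k<d. D k)\<^sup>2" unfolding sq by simp
      moreover have "0 \<le> (\<Prod>k<d. D k)" by (intro prod_nonneg) (simp add: D_def)
      ultimately show ?thesis by (rule power2_le_imp_le)
    qed
    ultimately show False using u(2) mult_right_mono[of 2 "\<Prod>k<d. D k" "\<bar>family_det d u\<bar>"] by simp
  qed
  define n where "n = (d + 1) div 2"
  define x where "x i = comb u (v i)" for i
  have "N (\<Sum>i<n. a i *\<^sub>R x i) \<le> L2_set a {..<n}" for a
  proof -
    have "N (\<Sum>i<n. a i *\<^sub>R x i) = L (\<lambda>l. \<Sum>i<n. a i * v i l)"
      by (simp add: L_def comb_sum x_def)
    also have "\<dots> \<le> L2_set (\<lambda>l. \<Sum>i<n. a i * v i l) {..<d}" by (rule Lle)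
    also have "\<dots> = L2_set a {..<n}"
      using d by (intro L2_orthonormal_combination[OF v(1)]) (auto simp: n_def)
    finally show ?thesis .
  qed
  moreover have "1 / 6 \<le> N (x i)" if "i < n" for i
    using large[of i] that by (simp add: n_def L_def x_def)
  moreover have "x i \<in> coord_space d" for i
    unfolding x_def comb_def using u(1)
    by (intro subspace_sum subspace_scale subspace_coord_space) (auto simp: U_def)
  ultimately show ?thesis unfolding n_def by blast
qed

section \<open>Gauges and sections of convex bodies\<close>

lemma convex_body_contains_box:
  assumes "0 \<in> Euclidean_space d interior_of K"
  shows "\<exists>\<rho>>0. \<forall>x\<in>coord_space d. (\<forall>i<d. \<bar>x i\<bar> < \<rho>) \<longrightarrow> x \<in> K"
proof -
  obtain T where T: "openin (Euclidean_space d) T" "0 \<in> T" "T \<subseteq> K"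
    using assms by (auto simp: interior_of_def)
  then obtain V where V: "openin (product_topology (\<lambda>i. euclideanreal) UNIV) V" "T
    = V \<inter> {x. \<forall>i\<ge>d. x i = 0}"
    unfolding Euclidean_space_def openin_subtopology by auto
  have "0 \<in> V" using T(2) V(2) by blast
  then obtain U where U: "\<And>i. open (U i)" "0 \<in> PiE UNIV U" "PiE UNIV U \<subseteq> V"
    using V(1) unfolding openin_product_topology_alt by (metis UNIV_I open_openin)
  have "\<exists>\<rho>>0. \<forall>y. \<bar>y\<bar> < \<rho> \<longrightarrow> y \<in> U i" for i
  proof -
    have "0 \<in> U i" using U(2) by (auto simp: PiE_def)
    then obtain e where "e > 0" "ball 0 e \<subseteq> U i" using U(1) open_contains_ball by metis
    thus ?thesis by (intro exI[of _ e]) (auto simp: subset_iff dist_real_def)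
  qed
  then obtain \<rho> where \<rho>: "\<And>i. 0 < \<rho> i" "\<And>i y. \<bar>y\<bar> < \<rho> i \<Longrightarrow> y \<in> U i" by metis
  define r where "r = Min (insert 1 (\<rho> ` {..<d}))"
  have r: "0 < r" "\<And>i. i < d \<Longrightarrow> r \<le> \<rho> i" using \<rho>(1) by (auto simp: r_def Min_gr_iff)
  have "x \<in> K" if x: "x \<in> coord_space d" "\<forall>i<d. \<bar>x i\<bar> < r" for x
  proof -
    have "x i \<in> U i" for i
    proof (cases "i < d")
      case True
      thus ?thesis using x(2) r(2)[OF True] \<rho>(2)[of "x i" i] by force
    next
      case False
      thus ?thesis using x(1) \<rho>(2)[of "x i" i] \<rho>(1)[of i] by (auto simp: topspace_Euclidean_space)
    qed
    hence "x \<in> V" using U(3) by auto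
    thus ?thesis using x(1) V(2) T(3) by (auto simp: topspace_Euclidean_space)
  qed
  thus ?thesis using r(1) by blast
qed

lemma compactin_coordinates_bounded:
  assumes "compactin (Euclidean_space d) K"
  shows "\<exists>R>0. \<forall>x\<in>K. \<forall>i<d. \<bar>x i\<bar> \<le> R"
proof -
  have "\<exists>R. \<forall>x\<in>K. \<bar>x i\<bar> \<le> R" for i
  proof -
    have "continuous_map (Euclidean_space d) euclideanreal (\<lambda>x. x i)"
      unfolding Euclidean_space_def
      by (intro continuous_map_from_subtopology continuous_map_product_projection) auto
    hence "compactin euclideanreal ((\<lambda>x. x i) ` K)" by (rule image_compactin[OF assms])
    hence "compact ((\<lambda>x. x i) ` K)" by simp
    thus ?thesis using compact_imp_bounded by (force simp: bounded_iff)
  qed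
  then obtain R where R: "\<And>i x. x \<in> K \<Longrightarrow> \<bar>x i\<bar> \<le> R i" by metis
  have "\<bar>x i\<bar> \<le> Max (insert 1 (R ` {..<d}))" if "x \<in> K" "i < d" for x i
    using R[OF that(1), of i] that(2) by (intro order_trans[OF _ Max_ge[of _ "R i"]]) auto
  moreover have "0 < Max (insert 1 (R ` {..<d}))" by (auto simp: Max_gr_iff)
  ultimately show ?thesis by blast
qed

lemma trunc_of_coord_space: "x \<in> coord_space d \<Longrightarrow> trunc d x = x"
  by (auto simp: trunc_def topspace_Euclidean_space fun_eq_iff)

lemma trunc_in_coord_space: "trunc d x \<in> coord_space d"
  by (auto simp: trunc_def topspace_Euclidean_space)

text \<open>A gauge of \<open>K\<close>, made total by truncation. Whether a point at gauge 1 belongs to \<open>K\<close> is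
  irrelevant for the distances, which are infima.\<close>

lemma ex_gauge:
  assumes K: "convex_body d K" and int: "0 \<in> Euclidean_space d interior_of K"
  shows "\<exists>p R r. sublinear p \<and> 0 < r \<and> (\<forall>x. p x \<le> R * L2_set x {..<d}) \<and>
    (\<forall>x i. i < d \<longrightarrow> r * \<bar>x i\<bar> \<le> p x) \<and>
    (\<forall>x\<in>coord_space d. p x < 1 \<longrightarrow> x \<in> K) \<and> (\<forall>x\<in>K. p x \<le> 1)"
proof -
  have conv: "convex K" and comp: "compactin (Euclidean_space d) K" using K by (auto simp: convex_body_def)
  have Ksub: "K \<subseteq> coord_space d" using comp by (simp add: compactin_def)
  obtain \<rho> where \<rho>: "0 < \<rho>" "\<And>x. x \<in> coord_space d \<Longrightarrow> (\<And>i. i < d \<Longrightarrow> \<bar>x i\<bar> < \<rho>) \<Longrightarrow> x \<in> K"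
    using convex_body_contains_box[OF int] by blast
  obtain R where R: "0 < R" "\<And>x i. x \<in> K \<Longrightarrow> i < d \<Longrightarrow> \<bar>x i\<bar> \<le> R"
    using compactin_coordinates_bounded[OF comp] by blast
  have 0: "0 \<in> K" by (rule subsetD[OF interior_of_subset int])
  define G where "G x = {r. 0 < r \<and> (1 / r) *\<^sub>R trunc d x \<in> K}" for x
  define p where "p x = Inf (G x)" for x
  have star: "c *\<^sub>R x \<in> K" if "x \<in> K" "0 \<le> c" "c \<le> 1" for x c
    using convexD_alt[OF conv 0 that] by simp
  have bdd: "bdd_below (G x)" for x by (intro bdd_belowI[of _ 0]) (auto simp: G_def)
  have big: "r \<in> G x" if r: "0 < r" "2 * L2_set x {..<d} \<le> \<rho> * r" for x r
  proof -
    have "\<bar>((1 / r) *\<^sub>R trunc d x) i\<bar> < \<rho>" if "i < d" for i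
    proof -
      have "\<bar>x i\<bar> \<le> L2_set (\<lambda>i. \<bar>x i\<bar>) {..<d}" using that by (intro member_le_L2_set) auto
      also have "\<dots> = L2_set x {..<d}" by (simp add: L2_set_def)
      finally have "2 * \<bar>x i\<bar> \<le> \<rho> * r" using r by simp
      moreover have "0 < \<rho> * r" using \<rho> r by simp
      ultimately have "\<bar>x i\<bar> < \<rho> * r" by linarith
      thus ?thesis using r(1) that by (simp add: trunc_def field_simps abs_mult)
    qed
    hence "(1 / r) *\<^sub>R trunc d x \<in> K"
      by (intro \<rho>(2) subspace_scale subspace_coord_space trunc_in_coord_space)
    thus ?thesis using r by (simp add: G_def)
  qed
  \<comment> \<open>The summand \<open>e\<close> is there because members of \<open>G x\<close> are
    positive, while the norm may be 0.\<close>
  have bigG: "2 / \<rho> * L2_set x {..<d} + e \<in> G x" if "0 < e" for x and e :: real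
  proof (rule big)
    have "0 \<le> 2 / \<rho> * L2_set x {..<d}" using \<rho>(1) by simp
    thus "0 < 2 / \<rho> * L2_set x {..<d} + e" using that by linarith
    have "\<rho> * (2 / \<rho> * L2_set x {..<d} + e) = 2 * L2_set x {..<d} + \<rho> * e"
      using \<rho>(1) by (simp add: distrib_left)
    thus "2 * L2_set x {..<d} \<le> \<rho> * (2 / \<rho> * L2_set x {..<d} + e)" using \<rho>(1) that by simp
  qed
  have ne: "G x \<noteq> {}" for x using bigG[of 1 x] by auto
  have le: "p x \<le> r" if "r \<in> G x" for x r unfolding p_def by (rule cInf_lower[OF that bdd])
  have ge: "c \<le> p x" if "\<And>r. r \<in> G x \<Longrightarrow> c
    \<le> r" for x c unfolding p_def by (rule cInf_greatest[OF ne that])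
  have nn: "0 \<le> p x" for x by (rule ge) (simp add: G_def)
  have lt: "trunc d x \<in> K" if px: "p x < 1" for x
  proof -
    obtain r where r: "r \<in> G x" "r < 1" using px cInf_less_iff[OF ne bdd] unfolding p_def by blast
    have "r *\<^sub>R ((1 / r) *\<^sub>R trunc d x) \<in> K" using r by (rule_tac star) (auto simp: G_def)
    thus ?thesis using r by (simp add: G_def)
  qed
  have add: "r + s \<in> G (x + y)" if "r \<in> G x" "s \<in> G y" for r s x y
  proof -
    have rs: "0 < r" "0 < s" "(1 / r) *\<^sub>R trunc d x \<in> K" "(1 / s) *\<^sub>R trunc d y
      \<in> K" using that by (auto simp: G_def)
    have mem: "(r / (r + s)) *\<^sub>R ((1 / r) *\<^sub>R trunc d x) + (s / (r + s)) *\<^sub>R ((1 / s) *\<^sub>R trunc d y)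
      \<in> K"
      using rs by (intro convexD[OF conv]) (auto simp: add_divide_distrib[symmetric])
    have eq: "(r / (r + s)) *\<^sub>R ((1 / r) *\<^sub>R trunc d x) + (s / (r + s)) *\<^sub>R ((1 / s) *\<^sub>R trunc d y)
      = (1 / (r + s)) *\<^sub>R trunc d (x + y)"
      using rs by (simp add: linear_add[OF linear_trunc] scaleR_add_right)
    show ?thesis unfolding G_def mem_Collect_eq
      by (rule conjI[OF add_pos_pos[OF rs(1,2)] mem[unfolded eq]])
  qed
  have "sublinear p"
  proof
    fix x y :: "nat \<Rightarrow> real" and c :: real
    have "p (x + y) - s \<le> p x" if s: "s \<in> G y" for s
    proof (rule ge)
      fix r assume "r \<in> G x"
      thus "p (x + y) - s \<le> r" using le[OF add[OF _ s]] by force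
    qed
    hence "p (x + y) - p x \<le> s" if "s \<in> G y" for s using that by force
    hence "p (x + y) - p x \<le> p y" by (rule ge)
    thus "p (x + y) \<le> p x + p y" by simp
    show "0 \<le> p x" by (rule nn)
    have scale_le: "p (c *\<^sub>R x) \<le> c * p x" if c: "0 < c" for c x
    proof -
      have "p (c *\<^sub>R x) / c \<le> p x"
      proof (rule ge)
        fix r assume r: "r \<in> G x"
        hence "c * r \<in> G (c *\<^sub>R x)" using c by (simp add: G_def linear_cmul[OF linear_trunc])
        from le[OF this] show "p (c *\<^sub>R x) / c \<le> r" using c by (simp add: field_simps)
      qed
      thus ?thesis using c by (simp add: field_simps)
    qed
    have p0: "p 0 = 0"
    proof -
      have "p 0 \<le> e" if "0 < e" for e
        using that 0 by (intro le) (simp add: G_def linear_0[OF linear_trunc])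
      thus ?thesis using nn[of 0] by (meson dense not_le order_antisym)
    qed
    assume "0 \<le> c"
    show "p (c *\<^sub>R x) = c * p x"
    proof (cases "c = 0")
      case False
      hence c: "0 < c" using \<open>0 \<le> c\<close> by simp
      have "p x \<le> (1 / c) * p (c *\<^sub>R x)" using scale_le[of "1 / c" "c *\<^sub>R x"] c by simp
      hence "c * p x \<le> p (c *\<^sub>R x)" using c by (simp add: field_simps)
      thus ?thesis using scale_le[OF c, of x] by simp
    qed (simp add: p0)
  qed
  moreover have "p x \<le> (2 / \<rho>) * L2_set x {..<d}" for x
  proof -
    have "p x \<le> (2 / \<rho>) * L2_set x {..<d} + e" if "0 < e" for e
      by (rule le[OF bigG[OF that]])
    thus ?thesis by (rule field_le_epsilon)
  qed
  moreover have "(1 / R) * \<bar>x i\<bar> \<le> p x" if "i < d" for x i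
  proof (rule ge)
    fix r assume r: "r \<in> G x"
    hence "(1 / r) *\<^sub>R trunc d x \<in> K" by (simp only: G_def mem_Collect_eq)
    hence "\<bar>((1 / r) *\<^sub>R trunc d x) i\<bar> \<le> R" by (rule R(2)[OF _ that])
    thus "(1 / R) * \<bar>x i\<bar> \<le> r" using r R(1) that by (simp add: G_def trunc_def abs_mult field_simps)
  qed
  moreover have "x \<in> K" if "x \<in> coord_space d" "p x < 1" for x
    using lt[OF that(2)] trunc_of_coord_space[OF that(1)] by simp
  moreover have "p x \<le> 1" if "x \<in> K" for x
    using that Ksub trunc_of_coord_space[of x d] by (intro le) (auto simp: G_def)
  ultimately show ?thesis
    using R(1) by (intro exI[of _ p] exI[of _ "2 / \<rho>"] exI[of _ "1 / R"]) auto
qed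

lemma body_dist_le:
  assumes "0 < r" "a \<in> coord_space m" "linear T" "bij_betw T (coord_space m) (coord_space m)"
    "L \<subseteq> T ` ((\<lambda>x. x - a) ` S)" "T ` ((\<lambda>x. x - a) ` S) \<subseteq> (\<lambda>x. r *\<^sub>R x) ` L"
  shows "body_dist m S L \<le> r"
  unfolding body_dist_def
  by (rule cInf_lower) (use assms in \<open>auto intro!: bdd_belowI[of _ 0]\<close>)

lemma bij_betw_scaleR_coord_space: "c \<noteq> 0 \<Longrightarrow> bij_betw ((*\<^sub>R) c) (coord_space m) (coord_space m)"
  by (rule bij_betw_byWitness[where f' = "(*\<^sub>R) (1 / c)"])
     (auto intro!: subspace_scale subspace_coord_space)

definition has_section :: "nat \<Rightarrow> (nat \<Rightarrow> real) set \<Rightarrow> real \<Rightarrow> nat \<Rightarrow> (nat \<Rightarrow> real) set \<Rightarrow> bool"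
  where "has_section d K \<epsilon> m L \<longleftrightarrow>
    (\<exists>H. subspace H \<and> H \<subseteq> coord_space d \<and> dim H = m \<and> section_dist m H K L < 1 + \<epsilon>)"

text \<open>In the coordinates given by \<open>W\<close> the section contains the open \<nu>-ball of
  radius \<open>1 / \<beta>\<close> and lies in the closed one of radius
  \<open>1 / \<alpha>\<close>; a dilation with \<open>a = 0\<close> compares it with
  \<open>L\<close>. The lower bound also makes \<open>W\<close> injective, hence the dimension of
  its range. A general \<nu> covers the Euclidean and the maximum norm at once.\<close>

lemma has_section_of_near_isometry:
  assumes p: "sublinear p" "\<And>x. x \<in> coord_space d \<Longrightarrow> p x < 1 \<Longrightarrow> x \<in> K" "\<And>x. x \<in> K \<Longrightarrow> p x \<le> 1"
    and W: "linear W" "\<And>t. W t \<in> coord_space d"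
    and \<nu>: "\<And>c t. \<nu> (c *\<^sub>R t) = \<bar>c\<bar> * \<nu> t" "\<And>t. t \<in> coord_space m \<Longrightarrow> \<nu> t = 0 \<Longrightarrow> t = 0" "\<And>t. 0 \<le> \<nu> t"
    and near: "\<And>t. \<alpha> * \<nu> t \<le> p (W t)" "\<And>t. p (W t) \<le> \<beta> * \<nu> t"
    and \<alpha>\<beta>: "0 < \<alpha>" "0 < \<beta>" "\<beta> / \<alpha> < 1 + \<epsilon>"
    and L: "L = {t \<in> coord_space m. \<nu> t \<le> 1}"
  shows "has_section d K \<epsilon> m L"
proof -
  interpret sublinear p by (rule p)
  define H where "H = W ` coord_space m"
  have inj: "inj_on W (coord_space m)"
  proof (subst linear_inj_on_iff_eq_0[OF W(1) subspace_coord_space], intro ballI impI)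
    fix t assume t: "t \<in> coord_space m" "W t = 0"
    have "\<alpha> * \<nu> t \<le> 0" using near(1)[of t] t(2) by simp
    hence "\<nu> t = 0" using \<alpha>\<beta>(1) \<nu>(3)[of t] by (simp add: mult_le_0_iff)
    thus "t = 0" using \<nu>(2) t(1) by blast
  qed
  have H: "subspace H" "H \<subseteq> coord_space d"
    using W by (auto simp: H_def intro: linear_subspace_image subspace_coord_space)
  have "dim H = m"
  proof -
    let ?B = "unit_seq ` {..<m}"
    have "independent (W ` ?B)"
      using inj independent_unit_seq
      by (intro linear_independent_injective_image[OF W(1)]) (auto simp: coord_space_eq_span)
    moreover have "H = span (W ` ?B)"
      by (simp add: H_def coord_space_eq_span linear_span_image[OF W(1)])
    moreover have "card (W ` ?B) = m"
    proof -
      have "inj_on W ?B" by (rule inj_on_subset[OF inj]) (auto simp: coord_space_eq_span intro: span_base)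
      thus ?thesis by (simp add: card_image inj_on_subset[OF inj_unit_seq])
    qed
    ultimately show ?thesis by (simp add: dim_span dim_eq_card_independent)
  qed
  obtain J where J: "linear J" "\<And>t. t \<in> coord_space m \<Longrightarrow> J (W t) = t"
    using linear_exists_left_inverse_on[OF W(1) subspace_coord_space inj] by auto
  have iso: "coord_iso m H J"
    unfolding coord_iso_def H_def using J
    by (auto intro!: bij_betw_byWitness[where f' = W])
  define S where "S = J ` (H \<inter> K)"
  have S: "t \<in> S \<longleftrightarrow> t \<in> coord_space m \<and> W t \<in> K" for t
  proof
    assume "t \<in> S"
    then obtain u where "u \<in> coord_space m" "W u \<in> K" "t = J (W u)" unfolding S_def H_def by blast
    thus "t \<in> coord_space m \<and> W t \<in> K" using J(2) by simp
  next
    assume t: "t \<in> coord_space m \<and> W t \<in> K"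
    hence "J (W t) \<in> S" unfolding S_def H_def by blast
    thus "t \<in> S" using J(2) t by simp
  qed
  \<comment> \<open>Slightly more than \<beta>, because only points of gauge strictly below 1 are
    known to lie in \<open>K\<close>. The strict inequality in the assumption leaves the
    room.\<close>
  obtain \<gamma> where \<gamma>: "\<beta> < \<gamma>" "\<gamma> < \<alpha> * (1 + \<epsilon>)"
    using dense[of \<beta> "\<alpha> * (1 + \<epsilon>)"] \<alpha>\<beta> by (auto simp: field_simps)
  have \<gamma>0: "0 < \<gamma>" using \<gamma> \<alpha>\<beta> by simp
  have "body_dist m S L \<le> \<gamma> / \<alpha>"
  proof (rule body_dist_le)
    show "0 < \<gamma> / \<alpha>" using \<gamma>0 \<alpha>\<beta> by simp
    show "0 \<in> coord_space m" by (rule subspace_0[OF subspace_coord_space])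
    show "linear ((*\<^sub>R) \<gamma>)" by (simp add: linear_iff scaleR_add_right)
    show "bij_betw ((*\<^sub>R) \<gamma>) (coord_space m) (coord_space m)" using \<gamma>0 by (intro bij_betw_scaleR_coord_space) simp
    show "L \<subseteq> (*\<^sub>R) \<gamma> ` ((\<lambda>x. x - 0) ` S)"
    proof
      fix t assume t: "t \<in> L"
      let ?u = "(1 / \<gamma>) *\<^sub>R t"
      have "p (W ?u) = (1 / \<gamma>) * p (W t)" using \<gamma>0 by (simp add: linear_cmul[OF W(1)] scale)
      also have "\<dots> \<le> (1 / \<gamma>) * \<beta>"
      proof (rule mult_left_mono)
        have "\<beta> * \<nu> t \<le> \<beta> * 1" using t \<alpha>\<beta> by (intro mult_left_mono) (auto simp: L)
        thus "p (W t) \<le> \<beta>" using near(2)[of t] by simp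
      qed (use \<gamma>0 in simp)
      also have "\<dots> < 1" using \<gamma> \<gamma>0 by simp
      finally have "W ?u \<in> K" using p(2) W(2) by blast
      moreover have "?u
        \<in> coord_space m" using t by (intro subspace_scale subspace_coord_space) (simp add: L)
      ultimately have "?u \<in> S" by (simp add: S)
      moreover have "t = \<gamma> *\<^sub>R ?u" using \<gamma>0 by simp
      ultimately show "t \<in> (*\<^sub>R) \<gamma> ` ((\<lambda>x. x - 0) ` S)" by (metis diff_zero imageI)
    qed
    show "(*\<^sub>R) \<gamma> ` ((\<lambda>x. x - 0) ` S) \<subseteq> (\<lambda>x. (\<gamma> / \<alpha>) *\<^sub>R x) ` L"
    proof
      fix y assume "y \<in> (*\<^sub>R) \<gamma> ` ((\<lambda>x. x - 0) ` S)"
      then obtain s where s: "s \<in> S" "y = \<gamma> *\<^sub>R s" by auto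
      have "\<alpha> * \<nu> s \<le> 1" using near(1)[of s] p(3)[of "W s"] s(1) by (simp add: S)
      hence "\<alpha> *\<^sub>R s \<in> L"
        using s(1) \<alpha>\<beta> \<nu>(1) by (auto simp: L S intro: subspace_scale[OF subspace_coord_space])
      moreover have "y = (\<gamma> / \<alpha>) *\<^sub>R (\<alpha> *\<^sub>R s)" using s(2) \<alpha>\<beta> by simp
      ultimately show "y \<in> (\<lambda>x. (\<gamma> / \<alpha>) *\<^sub>R x) ` L" by blast
    qed
  qed
  also have "\<gamma> / \<alpha> < 1 + \<epsilon>" using \<gamma> \<alpha>\<beta> by (simp add: field_simps)
  finally have "section_dist m H K L < 1 + \<epsilon>"
    using section_dist_eq[OF H(1) iso, of K L] by (simp add: S_def)
  thus ?thesis unfolding has_section_def using H \<open>dim H = m\<close> by blast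
qed

text \<open>Serves the small dimensions: a section by a line is an interval, which a translation
  centres. As \<open>K\<close> is not symmetric, this is where the translation \<open>a\<close> in
  the distance is really used.\<close>

lemma has_section_line:
  assumes p: "sublinear p" "\<And>x. x \<in> coord_space d \<Longrightarrow> p x < 1 \<Longrightarrow> x \<in> K" "\<And>x. x \<in> K \<Longrightarrow> p x \<le> 1"
    and pos: "0 < r" "\<And>x i. i < d \<Longrightarrow> r * \<bar>x i\<bar> \<le> p x" and d: "1 \<le> d" and \<epsilon>: "0 < \<epsilon>"
  shows "has_section d K \<epsilon> 1 (ball_inf 1)"
proof -
  interpret sublinear p by (rule p)
  define e where "e = unit_seq 0"
  have e1: "x = x 0 *\<^sub>R e" if "x \<in> coord_space 1" for x
    using that by (auto simp: e_def unit_seq_def topspace_Euclidean_space fun_eq_iff)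
  have e2: "c *\<^sub>R e \<in> coord_space n" "(c *\<^sub>R e) 0 = c" if "1 \<le> n" for n c
    using that by (auto simp: e_def unit_seq_def topspace_Euclidean_space)
  have sub: "coord_space 1 \<subseteq> coord_space d" using d by (auto simp: topspace_Euclidean_space)
  have iso: "coord_iso 1 (coord_space 1) (\<lambda>x. x)"
    by (simp add: coord_iso_def linear_iff bij_betw_def)
  have pe: "0 < p e" "0 < p (- e)"
    using pos(2)[of 0 e] pos(2)[of 0 "-e"] pos(1) d by (auto simp: e_def unit_seq_def)
  define u w where "u = 1 / p e" and "w = 1 / p (- e)"
  have uw: "0 < u" "0 < w" using pe by (simp_all add: u_def w_def)
  have in_K: "c *\<^sub>R e \<in> K" if "- w < c" "c < u" for c
  proof -
    have "p (c *\<^sub>R e) < 1"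
    proof (cases "0 \<le> c")
      case True
      thus ?thesis using that pe by (simp add: scale u_def field_simps)
    next
      case False
      hence "p (c *\<^sub>R e) = - c * p (- e)" using scale[of "-c" "-e"] by simp
      thus ?thesis using that pe False by (simp add: w_def field_simps)
    qed
    thus ?thesis using p(2) e2 d by blast
  qed
  have K_in: "- w \<le> c \<and> c \<le> u" if "c *\<^sub>R e \<in> K" for c
  proof (cases "0 \<le> c")
    case True
    hence "c * p e \<le> 1" using p(3)[OF that] by (simp add: scale)
    thus ?thesis using True pe uw by (simp add: u_def field_simps)
  next
    case False
    hence "- c * p (- e) \<le> 1" using p(3)[OF that] scale[of "-c" "-e"] by simp
    thus ?thesis using False pe uw by (simp add: w_def field_simps)
  qed
  define \<eta> where "\<eta> = 1 + \<epsilon> / 2"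
  have \<eta>: "1 < \<eta>" "\<eta> < 1 + \<epsilon>" using \<epsilon> by (simp_all add: \<eta>_def)
  \<comment> \<open>Half the length of the interval; the next definition is its midpoint. The factor
    \<eta> gives the slack for the endpoints, whose gauge is 1.\<close>
  define h where "h = (u + w) / 2"
  define a where "a = (u - w) / 2"
  have h: "0 < h" "a + h = u" "a - h = - w" using uw by (simp_all add: h_def a_def field_simps)
  have "body_dist 1 (coord_space 1 \<inter> K) (ball_inf 1) \<le> \<eta>"
  proof (rule body_dist_le)
    show "0 < \<eta>" using \<eta> by simp
    show "a *\<^sub>R e \<in> coord_space 1" by (rule e2) simp
    show "linear ((*\<^sub>R) (\<eta> / h))" by (simp add: linear_iff scaleR_add_right)
    show "bij_betw ((*\<^sub>R) (\<eta> / h)) (coord_space 1) (coord_space 1)"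
      using \<eta> h by (intro bij_betw_scaleR_coord_space) simp
    show "ball_inf 1 \<subseteq> (*\<^sub>R) (\<eta> / h) ` ((\<lambda>x. x - a *\<^sub>R e) ` (coord_space 1 \<inter> K))"
    proof
      fix t assume t: "t \<in> ball_inf 1"
      hence t0: "\<bar>t 0\<bar> \<le> 1" "t = t 0 *\<^sub>R e" using e1[of t] by (auto simp: ball_inf_def)
      define c where "c = a + t 0 * (h / \<eta>)"
      have "\<bar>t 0 * (h / \<eta>)\<bar> \<le> 1 * (h / \<eta>)"
        using t0(1) h \<eta> unfolding abs_mult by (intro mult_mono) auto
      also have "\<dots> < h" using h \<eta> by (simp add: field_simps)
      finally have "\<bar>t 0 * (h / \<eta>)\<bar> < h" .
      hence "- w < c" "c < u" using h(2,3) unfolding c_def by linarith+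
      hence "c *\<^sub>R e \<in> coord_space 1 \<inter> K" using in_K e2 by simp
      moreover have "c *\<^sub>R e - a *\<^sub>R e = (t 0 * (h / \<eta>)) *\<^sub>R e"
        by (simp add: c_def scaleR_diff_left[symmetric])
      hence "(\<eta> / h) *\<^sub>R (c *\<^sub>R e - a *\<^sub>R e) = t 0 *\<^sub>R e" using h \<eta> by simp
      hence "t = (\<eta> / h) *\<^sub>R (c *\<^sub>R e - a *\<^sub>R e)" using t0(2) by simp
      ultimately show "t \<in> (*\<^sub>R) (\<eta> / h) ` ((\<lambda>x. x - a *\<^sub>R e) ` (coord_space 1 \<inter> K))" by blast
    qed
    show "(*\<^sub>R) (\<eta> / h) ` ((\<lambda>x. x - a *\<^sub>R e) ` (coord_space 1 \<inter> K)) \<subseteq> (\<lambda>x. \<eta> *\<^sub>R x) ` ball_inf 1"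
    proof
      fix y assume "y \<in> (*\<^sub>R) (\<eta> / h) ` ((\<lambda>x. x - a *\<^sub>R e) ` (coord_space 1 \<inter> K))"
      then obtain x where x: "x \<in> coord_space 1" "x \<in> K" "y = (\<eta> / h) *\<^sub>R (x - a *\<^sub>R e)" by auto
      have "- w \<le> x 0 \<and> x 0 \<le> u" using K_in[of "x 0"] e1[OF x(1)] x(2) by simp
      hence ab: "\<bar>x 0 - a\<bar> \<le> h" using h(2,3) by linarith
      define z where "z = ((x 0 - a) / h) *\<^sub>R e"
      have "z \<in> ball_inf 1"
        using ab h(1) e2[of 1 "(x 0 - a) / h"] by (simp add: ball_inf_def z_def del: scaleR_fun_apply)
      moreover have "y = \<eta> *\<^sub>R z"
        unfolding x(3) z_def by (subst e1[OF x(1)]) (simp add: scaleR_diff_left[symmetric])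
      ultimately show "y \<in> (\<lambda>x. \<eta> *\<^sub>R x) ` ball_inf 1" by blast
    qed
  qed
  hence "section_dist 1 (coord_space 1) K (ball_inf 1) < 1 + \<epsilon>"
    using section_dist_eq[OF subspace_coord_space iso, of K "ball_inf 1"] \<eta> by simp
  thus ?thesis
    unfolding has_section_def using sub dim_coord_space[of 1] subspace_coord_space[of 1] by blast
qed

section \<open>The dichotomy\<close>

text \<open>The constants in \<open>B\<close>: symmetrization doubles the mean, passing to signs
  doubles it again, and selection turns \<open>4 * \<tau>\<close> into
  \<open>1 + 8 * \<tau>\<close>; the factor 6 rescales the lower bound \<open>1 / 6\<close> to 1.
  Then \<open>s\<close> rounds of James' argument reduce \<open>B\<close> to
  \<open>1 + \<delta>\<close> and \<open>k\<close> to \<open>2 * m\<close>, and pairing leaves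
  \<open>m\<close>.\<close>

lemma exists_near_cube:
  assumes q: "sublinear q" "\<And>a. symmetrize q a \<le> L2_set a {..<k * k}" and k: "0 < k"
    and lower: "\<And>i. i < k * k \<Longrightarrow> 1 / 6 \<le> symmetrize q (unit_seq i)"
    and \<tau>: "gauss_mean (k * k) q \<le> \<tau>" "0 \<le> \<tau>"
    and m: "(2 * m) ^ 2 ^ s \<le> k" and B: "(6 * (1 + 8 * \<tau>)) powr (1 / 2 ^ s) \<le> 1 + \<delta>"
  shows "\<exists>v. \<forall>b. (1 - 3 * \<delta>) * max_norm m b \<le> q (\<Sum>j<m. b j *\<^sub>R v j) \<and>
    q (\<Sum>j<m. b j *\<^sub>R v j) \<le> (1 + \<delta>) * max_norm m b"
proof -
  interpret sublinear q by (rule q)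
  interpret N: even_sublinear "symmetrize q" by (rule even_sublinear_symmetrize)
  have qle: "q a \<le> L2_set a {..<k * k}" for a
    using q(2)[of a] by (simp add: symmetrize_def)
  have kk: "0 < k * k" using k by simp
  have "gauss_mean (k * k) (symmetrize q) \<le> 2 * gauss_mean (k * k) q"
    by (rule gauss_mean_symmetrize_le[OF q(1) qle kk])
  hence "(\<Sum>\<epsilon>\<in>signs {..<k * k}. symmetrize q \<epsilon>) / 2 ^ (k * k) \<le> 4 * \<tau>"
    using sign_average_le_gauss_mean[OF N.even_sublinear_axioms q(2) kk] \<tau> by linarith
  then obtain f where f: "\<And>b. b < k \<Longrightarrow> f b < k * k"
    "cube_bounded (symmetrize q) k (\<lambda>b. unit_seq (f b)) (1 + 2 * (4 * \<tau>))"
    using exists_cube_of_small_sign_average[OF N.even_sublinear_axioms k q(2)] by blast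
  define y where "y b = 6 *\<^sub>R (unit_seq (f b) :: nat \<Rightarrow> real)" for b
  define B where "B = 6 * (1 + 8 * \<tau>)"
  have y1: "1 \<le> symmetrize q (y b)" if "b < k" for b
    using lower[OF f(1)[OF that]] by (simp add: y_def N.scale)
  have "cube_bounded (symmetrize q) k y B"
    unfolding cube_bounded_def
  proof (intro allI impI)
    fix a :: "nat \<Rightarrow> real" assume a: "\<forall>i<k. \<bar>a i\<bar> \<le> 1"
    have "(\<Sum>i<k. a i *\<^sub>R y i) = 6 *\<^sub>R (\<Sum>i<k. a i *\<^sub>R unit_seq (f i))"
      by (simp add: y_def scaleR_sum_right mult.commute)
    hence "symmetrize q (\<Sum>i<k. a i *\<^sub>R y i) = 6 * symmetrize q (\<Sum>i<k. a i *\<^sub>R unit_seq (f i))"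
      by (simp add: N.scale)
    moreover have "symmetrize q (\<Sum>i<k. a i *\<^sub>R unit_seq (f i)) \<le> 1 + 2 * (4 * \<tau>)"
      using f(2) a unfolding cube_bounded_def by blast
    ultimately show "symmetrize q (\<Sum>i<k. a i *\<^sub>R y i) \<le> B" by (simp add: B_def)
  qed
  hence cb: "cube_bounded (symmetrize q) ((2 * m) ^ 2 ^ s) y B"
    using m by (rule cube_bounded_mono) simp
  have B0: "0 < B" using \<tau>(2) by (simp add: B_def)
  have y1': "1 \<le> symmetrize q (y i)" if "i < (2 * m) ^ 2 ^ s" for i using y1 that m by simp
  obtain z where z: "\<And>j. j < 2 * m \<Longrightarrow> 1 \<le> symmetrize q (z j)"
    "cube_bounded (symmetrize q) (2 * m) z (B powr (1 / 2 ^ s))"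
    using N.james_blocking[OF B0 y1' cb] by blast
  have cz: "cube_bounded (symmetrize q) (2 * m) z (1 + \<delta>)"
    by (rule cube_bounded_mono[OF z(2) order_refl]) (use B in \<open>simp add: B_def\<close>)
  show ?thesis by (rule cube_of_symmetrized_cube[OF _ cz]) (rule z(1))
qed

lemma L2_set_trunc: "k \<le> n \<Longrightarrow> L2_set (trunc k a) {..<n} = L2_set a {..<k}"
proof -
  assume k: "k \<le> n"
  have "(\<Sum>i<n. (trunc k a i)\<^sup>2) = (\<Sum>i<k. (a i)\<^sup>2)"
    using k by (intro sum.mono_neutral_cong_right) (auto simp: trunc_def)
  thus ?thesis by (simp add: L2_set_def)
qed

text \<open>Both cases work with the gauge pulled back to \<open>n = k * k\<close> coordinates by
  the vectors from \<open>dvoretzky_rogers\<close>, and \<open>\<tau>\<close> separates them. The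
  dimensions \<open>m1\<close> and \<open>m2\<close> stay free, so that the choice of parameters is
  pure arithmetic.\<close>

lemma convex_body_dichotomy:
  assumes K: "convex_body d K" "0 \<in> Euclidean_space d interior_of K" and d: "1 \<le> d"
    and k: "0 < k" "2 * (k * k) \<le> d + 1" and \<delta>: "0 < \<delta>" "\<delta> \<le> 1 / 8"
    and \<epsilon>: "1 + 3 * \<delta> < (1 + \<epsilon>) * (1 - 4 * \<delta>)" "1 + \<delta> < (1 + \<epsilon>) * (1 - 3 * \<delta>)"
    and \<tau>: "0 < \<tau>" and N: "0 < N" "sqrt m1 \<le> \<delta> * N"
    and big: "2 * (2 * real N + 1) ^ m1 < exp ((\<delta> * \<tau>)\<^sup>2 / 4)"
    and m2: "(2 * m2) ^ 2 ^ s \<le> k" and B: "(6 * (1 + 8 * \<tau>)) powr (1 / 2 ^ s) \<le> 1 + \<delta>"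
  shows "has_section d K \<epsilon> m1 (ball_2 m1) \<or> has_section d K \<epsilon> m2 (ball_inf m2)"
proof -
  obtain p R r where p: "sublinear p" "0 < r" "\<And>x. p x \<le> R * L2_set x {..<d}"
    "\<And>x i. i < d \<Longrightarrow> r * \<bar>x i\<bar> \<le> p x"
    "\<And>x. x \<in> coord_space d \<Longrightarrow> p x < 1 \<Longrightarrow> x \<in> K" "\<And>x. x \<in> K \<Longrightarrow> p x \<le> 1"
    using ex_gauge[OF K] by blast
  interpret p: sublinear p by (rule p)
  interpret S: even_sublinear "symmetrize p" by (rule p.even_sublinear_symmetrize)
  define n where "n = k * k"
  have n: "n \<le> (d + 1) div 2" "0 < n" using k by (auto simp: n_def)
  have Sle: "symmetrize p x \<le> R * L2_set x {..<d}" for x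
    using p(3)[of x] p(3)[of "-x"] by (simp add: symmetrize_def L2_set_uminus)
  have Sge: "r * \<bar>x i\<bar> \<le> symmetrize p x" if "i < d" for x i
    using p(4)[OF that, of x] by (simp add: symmetrize_def le_max_iff_disj)
  obtain x where x: "\<And>i. x i \<in> coord_space d"
    "\<And>a. symmetrize p (\<Sum>i<(d + 1) div 2. a i *\<^sub>R x i) \<le> L2_set a {..<(d + 1) div 2}"
    "\<And>i. i < (d + 1) div 2 \<Longrightarrow> 1 / 6 \<le> symmetrize p (x i)"
    using dvoretzky_rogers[OF S.even_sublinear_axioms _ Sle p(2) Sge] d by auto
  define X where "X a = (\<Sum>i<n. a i *\<^sub>R x i)" for a :: "nat \<Rightarrow> real"
  have linX: "linear X"
    by (intro linearI) (simp_all add: X_def scaleR_add_left sum.distrib scaleR_sum_right)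
  have Xd: "X a \<in> coord_space d" for a
    unfolding X_def by (intro subspace_sum subspace_scale subspace_coord_space x)
  define q where "q a = p (X a)" for a
  have q: "sublinear q" unfolding q_def by (rule p.sublinear_compose[OF linX])
  have symq: "symmetrize q a = symmetrize p (X a)" for a
    by (simp add: symmetrize_def q_def linear_neg[OF linX])
  have qL2: "symmetrize q a \<le> L2_set a {..<n}" for a
  proof -
    have "X a = (\<Sum>i<(d + 1) div 2. trunc n a i *\<^sub>R x i)"
      unfolding X_def using n(1) by (intro sum.mono_neutral_cong_left) (auto simp: trunc_def)
    thus ?thesis using x(2)[of "trunc n a"] L2_set_trunc[OF n(1), of a] by (simp add: symq)
  qed
  have qle: "q a \<le> L2_set a {..<n}" for a using qL2[of a] by (simp add: symmetrize_def)
  have qlow: "1 / 6 \<le> symmetrize q (unit_seq i)" if "i < n" for i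
  proof -
    have "X (unit_seq i) = (\<Sum>l<n. if l = i then x i else 0)"
      unfolding X_def by (intro sum.cong) (auto simp: unit_seq_def)
    thus ?thesis using that n(1) x(3)[of i] by (simp add: symq)
  qed
  define \<mu> where "\<mu> = gauss_mean n q"
  show ?thesis
  proof (cases "\<tau> \<le> \<mu>")
    case True
    have \<mu>: "0 < gauss_mean n q" using True \<tau> by (simp add: \<mu>_def)
    have "(\<delta> * \<tau>)\<^sup>2 \<le> (\<delta> * \<mu>)\<^sup>2" using True \<delta> \<tau> by (intro power_mono mult_left_mono) auto
    hence "exp ((\<delta> * \<tau>)\<^sup>2 / 4) \<le> exp ((\<delta> * \<mu>)\<^sup>2 / 4)" by simp
    hence "2 * (2 * real N + 1) ^ m1 < exp ((\<delta> * gauss_mean n q)\<^sup>2 / 4)"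
      unfolding \<mu>_def by (rule less_le_trans[OF big])
    moreover have "\<delta> \<le> 1 / 4" using \<delta> by simp
    ultimately obtain W where W: "linear W"
      "\<And>t. (1 - 4 * \<delta>) * \<mu> * L2_set t {..<m1} \<le> q (W t)" "\<And>t. q (W t) \<le> (1 + 3 * \<delta>) * \<mu>
        * L2_set t {..<m1}"
      using dvoretzky_of_gauss_mean[OF q qle n(2) \<delta>(1) _ N \<mu>] unfolding \<mu>_def by blast
    have "has_section d K \<epsilon> m1 (ball_2 m1)"
    proof (rule has_section_of_near_isometry[OF p(1,5,6), where W = "X \<circ> W" and \<nu> = "\<lambda>t. L2_set t {..<m1}"
          and \<alpha> = "(1 - 4 * \<delta>) * \<mu>" and \<beta> = "(1 + 3 * \<delta>) * \<mu>"])
      show "linear (X \<circ> W)" using W(1) linX by (rule linear_compose)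
      show "(X \<circ> W) t \<in> coord_space d" for t by (simp add: Xd)
      show "t = 0" if "t \<in> coord_space m1" "L2_set t {..<m1} = 0" for t
      proof
        fix i
        show "t i = 0 i" using that by (cases "i
          < m1") (auto simp: L2_set_eq_0_iff topspace_Euclidean_space)
      qed
      show "0 < (1 - 4 * \<delta>) * \<mu>" "0 < (1 + 3 * \<delta>) * \<mu>" using \<mu> \<delta> by (simp_all add: \<mu>_def)
      have "(1 + 3 * \<delta>) / (1 - 4 * \<delta>) < 1 + \<epsilon>" using \<epsilon>(1) \<delta> by (simp add: pos_divide_less_eq)
      thus "(1 + 3 * \<delta>) * \<mu> / ((1 - 4 * \<delta>) * \<mu>) < 1 + \<epsilon>" using \<mu> by (simp add: \<mu>_def)
    qed (use W in \<open>auto simp: q_def L2_set_scaleR ball_2_def\<close>)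
    thus ?thesis ..
  next
    case False
    have "\<exists>v. \<forall>b. (1 - 3 * \<delta>) * max_norm m2 b \<le> q (\<Sum>j<m2. b j *\<^sub>R v j) \<and>
      q (\<Sum>j<m2. b j *\<^sub>R v j) \<le> (1 + \<delta>) * max_norm m2 b"
      using exists_near_cube[OF q _ k(1) _ _ _ m2 B] qL2 qlow False \<tau> by (simp add: n_def \<mu>_def)
    then obtain v where v: "\<And>b. (1 - 3 * \<delta>) * max_norm m2 b \<le> q (\<Sum>j<m2. b j *\<^sub>R v j)"
      "\<And>b. q (\<Sum>j<m2. b j *\<^sub>R v j) \<le> (1 + \<delta>) * max_norm m2 b" by blast
    define V where "V b = (\<Sum>j<m2. b j *\<^sub>R v j)" for b :: "nat \<Rightarrow> real"
    have linV: "linear V"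
      by (intro linearI) (simp_all add: V_def scaleR_add_left sum.distrib scaleR_sum_right)
    have "has_section d K \<epsilon> m2 (ball_inf m2)"
    proof (rule has_section_of_near_isometry[OF p(1,5,6), where W = "X \<circ> V" and \<nu> = "max_norm m2"
          and \<alpha> = "1 - 3 * \<delta>" and \<beta> = "1 + \<delta>"])
      show "linear (X \<circ> V)" using linV linX by (rule linear_compose)
      show "(X \<circ> V) t \<in> coord_space d" for t by (simp add: Xd)
      show "max_norm m2 (c *\<^sub>R t) = \<bar>c\<bar> * max_norm m2 t" for c t
      proof (rule antisym)
        show "max_norm m2 (c *\<^sub>R t) \<le> \<bar>c\<bar> * max_norm m2 t"
          by (subst max_norm_le_iff) (auto simp: abs_mult max_norm_nonneg intro!: mult_left_mono max_norm_ge)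
        have "\<bar>t i\<bar> \<le> max_norm m2 (c *\<^sub>R t) / \<bar>c\<bar>" if "c \<noteq> 0" "i < m2" for i
          using max_norm_ge[OF that(2), of "c *\<^sub>R t"] that(1) by (simp add: abs_mult pos_le_divide_eq mult.commute)
        hence "max_norm m2 t \<le> max_norm m2 (c *\<^sub>R t) / \<bar>c\<bar>" if "c \<noteq> 0"
          using that by (subst max_norm_le_iff) (auto simp: max_norm_nonneg)
        thus "\<bar>c\<bar> * max_norm m2 t \<le> max_norm m2 (c *\<^sub>R t)"
          by (cases "c = 0") (auto simp: max_norm_nonneg pos_le_divide_eq mult.commute)
      qed
      show "t = 0" if "t \<in> coord_space m2" "max_norm m2 t = 0" for t
      proof
        fix i
        show "t i = 0 i" using that max_norm_ge[of i m2 t] by (cases "i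
          < m2") (auto simp: topspace_Euclidean_space)
      qed
      show "0 < 1 - 3 * \<delta>" "0 < 1 + \<delta>" using \<delta> by auto
      show "(1 + \<delta>) / (1 - 3 * \<delta>) < 1 + \<epsilon>" using \<epsilon>(2) \<delta> by (simp add: pos_divide_less_eq)
      show "ball_inf m2 = {t \<in> coord_space m2. max_norm m2 t \<le> 1}"
        by (auto simp: ball_inf_def max_norm_le_iff)
    qed (use v in \<open>auto simp: q_def V_def max_norm_nonneg\<close>)
    thus ?thesis ..
  qed
qed

section \<open>Choice of the parameters\<close>

lemma two_le_exp_1: "2 \<le> exp (1::real)"
  using exp_ge_add_one_self[of 1] by simp

text \<open>With \<open>m\<close> about \<open>exp x\<close> and \<open>N\<close> about
  \<open>m / \<delta>\<close>, the crude bound \<open>1 + y \<le> exp y\<close> puts the logarithm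
  of the net size at order \<open>m * m\<close>, that is \<open>exp (2 * x)\<close>, against the
  available \<open>exp (4 * x)\<close>. The assumption on \<open>exp (2 * x)\<close> compares the
  constants.\<close>

lemma euclidean_parameters:
  fixes x \<delta> :: real
  assumes \<delta>: "0 < \<delta>" "\<delta> \<le> 1" and x: "0 < x" "(2 / \<delta> + 3) * 16 / \<delta>\<^sup>2 < exp (2 * x)"
  shows "\<exists>m N. 1 \<le> m \<and> x \<le> ln (real m) \<and> 0 < N \<and> sqrt (real m) \<le> \<delta> * N \<and>
    2 * (2 * real N + 1) ^ m < exp ((\<delta> * exp (2 * x))\<^sup>2 / 4)"
proof -
  define m where "m = nat \<lceil>exp x\<rceil>"
  have m: "exp x \<le> m" "m \<le> 2 * exp x"
  proof -
    show "exp x \<le> m" unfolding m_def by linarith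
    have "m < exp x + 1" unfolding m_def using exp_gt_zero[of x] by linarith
    moreover have "1 \<le> exp x" using x by simp
    ultimately show "m \<le> 2 * exp x" by linarith
  qed
  have m1: "1 \<le> real m" using m(1) x(1) by (meson one_le_exp_iff less_imp_le order_trans)
  have "ln (exp x) \<le> ln (real m)" using m(1) m1 by (subst ln_le_cancel_iff) auto
  hence lnm: "x \<le> ln (real m)" by simp
  define N where "N = nat \<lceil>m / \<delta>\<rceil>"
  have N: "m / \<delta> \<le> N" "N \<le> m / \<delta> + 1"
  proof -
    have "0 \<le> m / \<delta>" using \<delta> by simp
    thus "m / \<delta> \<le> N" "N \<le> m / \<delta> + 1" unfolding N_def by linarith+
  qed
  have "0 < m / \<delta>" using m1 \<delta> by simp
  hence N0: "0 < N" using N(1) by (metis less_le_trans of_nat_0_less_iff)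
  have "sqrt m \<le> m" using m1 by (intro real_le_lsqrt) (auto simp: power2_eq_square)
  also have "\<dots> \<le> \<delta> * N" using N(1) \<delta> by (simp add: pos_divide_le_eq mult.commute)
  finally have sq: "sqrt m \<le> \<delta> * N" .
  have mm: "real m \<le> real m * real m" using m1 by simp
  have "2 * real N * real m + 1 \<le> 2 * (m / \<delta> + 1) * m + real m"
  proof -
    have "2 * real N * m \<le> 2 * (m / \<delta> + 1) * m" using N(2) by (intro mult_right_mono) auto
    thus ?thesis using m1 by linarith
  qed
  also have "\<dots> = (2 / \<delta>) * (real m * real m) + 3 * real m" by (simp add: algebra_simps)
  also have "\<dots> \<le> (2 / \<delta>) * (real m * real m) + 3 * (real m * real m)" using mm by simp
  also have "\<dots> = (2 / \<delta> + 3) * (real m * real m)" by (simp add: algebra_simps)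
  also have "\<dots> \<le> (2 / \<delta> + 3) * ((2 * exp x) * (2 * exp x))"
    using m(2) \<delta> by (intro mult_left_mono mult_mono) auto
  also have "\<dots> = (2 / \<delta> + 3) * 4 * exp (2 * x)" by (simp add: exp_double power2_eq_square)
  also have "\<dots> < \<delta>\<^sup>2 * exp (2 * x) / 4 * exp (2 * x)"
    using x(2) \<delta> by (intro mult_strict_right_mono) (auto simp: field_simps)
  also have "\<dots> = (\<delta> * exp (2 * x))\<^sup>2 / 4" by (simp add: power2_eq_square)
  finally have lt: "2 * real N * real m + 1 < (\<delta> * exp (2 * x))\<^sup>2 / 4" .
  have "2 * (2 * real N + 1) ^ m \<le> exp 1 * exp (2 * real N) ^ m"
    using two_le_exp_1 exp_ge_add_one_self[of "2 * real N"]
    by (intro mult_mono power_mono) (auto simp: add.commute)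
  also have "\<dots> = exp (2 * real N * real m + 1)"
    by (simp add: exp_of_nat_mult[symmetric] exp_add[symmetric] mult_ac)
  also have "\<dots> < exp ((\<delta> * exp (2 * x))\<^sup>2 / 4)" using lt by simp
  finally have "2 * (2 * real N + 1) ^ m < exp ((\<delta> * exp (2 * x))\<^sup>2 / 4)" .
  thus ?thesis using m1 lnm N0 sq by (intro exI[of _ m] exI[of _ N]) auto
qed

text \<open>With \<open>x = sqrt (ln d)\<close>, this is where the square root comes from: \<open>2 ^ s\<close> is of order \<open>x\<close>,
  and the cube has dimension about the \<open>2 ^ s\<close>-th root of a power of \<open>d = exp (x * x)\<close>.\<close>

lemma cube_parameters:
  fixes x c :: real and d :: nat
  assumes c: "0 < c" and x: "8 \<le> x" "1 \<le> c * x" "128 * c \<le> x"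
    and d: "real d = exp (x\<^sup>2)"
  shows "\<exists>m s k. 1 \<le> m \<and> x / (128 * c) \<le> ln (real m) \<and> 0 < k \<and> 2 * (k * k) \<le> d + 1 \<and>
    (2 * m) ^ 2 ^ s \<le> k \<and> c * x \<le> 2 ^ s"
proof -
  define a where "a = nat \<lceil>c * x\<rceil>"
  have a: "c * x \<le> a" "a \<le> c * x + 1" using x(2) unfolding a_def by linarith+
  have "1 \<le> a" using a(1) x(2) by (metis of_nat_1 of_nat_le_iff order_trans)
  then obtain j where j: "2 ^ j \<le> a" "a < 2 ^ (j + 1)" using ex_power_ivl1[of 2 a] by auto
  define s where "s = j + 1"
  have s: "c * x \<le> 2 ^ s" "2 ^ s \<le> 4 * (c * x)"
  proof -
    have "real a < real (2 ^ s)" using j(2) unfolding s_def by (simp only: of_nat_less_iff)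
    hence "real a < 2 ^ s" by simp
    thus "c * x \<le> 2 ^ s" using a(1) by linarith
    have "real (2 ^ j) \<le> real a" using j(1) by (simp only: of_nat_le_iff)
    hence "2 ^ j \<le> real a" by simp
    hence "2 ^ s \<le> 2 * real a" by (simp add: s_def)
    thus "2 ^ s \<le> 4 * (c * x)" using a(2) x(2) by linarith
  qed
  \<comment> \<open>Chosen so that \<open>k\<close> is about \<open>w * w\<close>, the fourth root
    of \<open>d\<close>. Then \<open>k * k\<close> is at most \<open>sqrt d\<close>, and
    \<open>2 * (k * k) \<le> d + 1\<close> follows from
    \<open>2 * v \<le> v * v + 1\<close>.\<close>
  define w where "w = exp (x\<^sup>2 / 8)"
  have "8 * 8 \<le> x * x" using x(1) by (intro mult_mono) auto
  hence "1 \<le> x\<^sup>2 / 8" by (simp add: power2_eq_square)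
  hence w: "2 \<le> w" using exp_ge_add_one_self[of "x\<^sup>2 / 8"] unfolding w_def by linarith
  have w2: "exp (x\<^sup>2 / 4) = w * w" "exp (x\<^sup>2) = (w * w) * (w * w) * ((w * w) * (w * w))"
    by (simp_all add: w_def exp_add[symmetric])
  define k where "k = nat \<lfloor>w * w\<rfloor>"
  have ww: "0 \<le> w * w" by simp
  have k: "k \<le> w * w" "w \<le> k"
  proof -
    show "k \<le> w * w" using ww unfolding k_def by linarith
    have "w + 1 \<le> w * w" using mult_right_mono[OF w, of w] w by linarith
    moreover have "w * w < k + 1" unfolding k_def by linarith
    ultimately show "w \<le> k" by linarith
  qed
  have k0: "0 < k" using k(2) w by (metis less_le_trans of_nat_0_less_iff zero_less_numeral)
  have kd: "2 * (k * k) \<le> d + 1"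
  proof -
    define v where "v = (w * w) * (w * w)"
    have "real k * real k \<le> v" unfolding v_def using k(1) by (intro mult_mono) auto
    moreover have "2 * v \<le> v * v + 1" using zero_le_power2[of "v
      - 1"] by (simp add: power2_eq_square algebra_simps)
    ultimately have "2 * (real k * real k) \<le> real d + 1" unfolding d w2 v_def[symmetric] by linarith
    hence "real (2 * (k * k)) \<le> real (d + 1)" by simp
    thus ?thesis by (simp only: of_nat_le_iff)
  qed
  \<comment> \<open>As \<open>2 ^ s\<close> is at most \<open>4 * c * x\<close>, the factor 64 turns
    \<open>b * 2 ^ s\<close> into at most \<open>x\<^sup>2 / 16\<close>; the remaining
    \<open>x\<^sup>2 / 16\<close> in the exponent of \<open>w\<close> pays for the factor 2 in
    \<open>2 * m\<close>. Rounding \<open>exp b\<close> down costs half of \<open>b\<close>, whence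
    128.\<close>
  define b where "b = x / (64 * c)"
  have b: "2 \<le> b" using x(3) c by (simp add: b_def pos_le_divide_eq)
  define m where "m = nat \<lfloor>exp b\<rfloor>"
  have eb: "3 \<le> exp b" using exp_ge_add_one_self[of b] b by linarith
  have m: "real m \<le> exp b" "exp b - 1 < real m" using eb unfolding m_def by linarith+
  have m1: "2 \<le> real m" using m eb by linarith
  have eb2: "2 \<le> exp (b / 2)" using exp_ge_add_one_self[of "b / 2"] b by linarith
  hence "exp (b / 2) * 2 \<le> exp (b / 2) * exp (b / 2)" by (intro mult_left_mono) auto
  hence "exp (b / 2) * 2 \<le> exp b" by (simp add: exp_add[symmetric])
  hence "exp (b / 2) \<le> real m" using m(2) eb2 by linarith
  hence "ln (exp (b / 2)) \<le> ln (real m)" using m1 by (subst ln_le_cancel_iff) auto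
  hence lnm: "x / (128 * c) \<le> ln (real m)" by (simp add: b_def)
  have "real ((2 * m) ^ 2 ^ s) = (2 * real m) ^ 2 ^ s" by simp
  also have "\<dots> \<le> (exp 1 * exp b) ^ 2 ^ s"
    using m two_le_exp_1 by (intro power_mono mult_mono) auto
  also have "\<dots> = exp ((1 + b) * 2 ^ s)"
    by (simp add: exp_add[symmetric] exp_of_nat_mult[symmetric] mult.commute)
  also have "\<dots> \<le> exp ((1 + b) * (4 * (c * x)))"
    using s(2) b by (intro iffD2[OF exp_le_cancel_iff] mult_left_mono) auto
  also have "\<dots> \<le> w"
  proof -
    have "(1 + b) * (4 * (c * x)) = 4 * c * x + x\<^sup>2 / 16"
      using c by (simp add: b_def power2_eq_square distrib_right)
    moreover have "64 * c * x \<le> x * x" using x(1,3) c by (intro mult_right_mono) auto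
    ultimately show ?thesis by (simp add: w_def power2_eq_square)
  qed
  also have "\<dots> \<le> real k" by (rule k(2))
  finally have "(2 * m) ^ 2 ^ s \<le> k" by (simp only: of_nat_le_iff)
  moreover have "1 \<le> m" using m1 by simp
  ultimately show ?thesis using lnm k0 kd s(1) by blast
qed

text \<open>Case (i) holds when the Gaussian mean is at least \<open>exp (2 * x)\<close> with \<open>x = sqrt (ln d)\<close>.\<close>

lemma has_section_large_dimension:
  assumes K: "convex_body d K" "0 \<in> Euclidean_space d interior_of K" and d: "1 \<le> d"
    and \<delta>: "0 < \<delta>" "\<delta> \<le> 1 / 8"
    and \<epsilon>: "1 + 3 * \<delta> < (1 + \<epsilon>) * (1 - 4 * \<delta>)" "1 + \<delta> < (1 + \<epsilon>) * (1 - 3 * \<delta>)"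
    and c: "c = 10 / ln (1 + \<delta>)" and x: "x = sqrt (ln (real d))"
    and large: "8 \<le> x" "1 / c \<le> x" "128 * c \<le> x" "(2 / \<delta> + 3) * 16 / \<delta>\<^sup>2 \<le> x"
  shows "(\<exists>m\<ge>1. x \<le> ln (real m) \<and> has_section d K \<epsilon> m (ball_2 m)) \<or>
    (\<exists>m\<ge>1. x / (128 * c) \<le> ln (real m) \<and> has_section d K \<epsilon> m (ball_inf m))"
proof -
  have ln\<delta>: "0 < ln (1 + \<delta>)" using \<delta> by simp
  hence c0: "0 < c" by (simp add: c)
  have "0 \<le> ln (real d)" using d by simp
  hence "x\<^sup>2 = ln (real d)" by (simp add: x)
  hence dx: "real d = exp (x\<^sup>2)" using d by simp
  have "x < exp (2 * x)" using exp_ge_add_one_self[of "2 * x"] large(1) by linarith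
  hence "(2 / \<delta> + 3) * 16 / \<delta>\<^sup>2 < exp (2 * x)" using large(4) by linarith
  then obtain m1 N where m1: "1 \<le> m1" "x \<le> ln (real m1)" "0 < N" "sqrt (real m1) \<le> \<delta> * N"
    "2 * (2 * real N + 1) ^ m1 < exp ((\<delta> * exp (2 * x))\<^sup>2 / 4)"
    using euclidean_parameters[of \<delta> x] \<delta> large(1) by auto
  have "1 \<le> c * x" using large(2) c0 by (simp add: pos_divide_le_eq mult.commute)
  then obtain m2 s k where m2: "1 \<le> m2" "x / (128 * c) \<le> ln (real m2)" "0 < k" "2 * (k * k) \<le> d + 1"
    "(2 * m2) ^ 2 ^ s \<le> k" "c * x \<le> 2 ^ s"
    using cube_parameters[OF c0 large(1) _ large(3) dx] by blast
  \<comment> \<open>The base is at most \<open>exp (8 + 2 * x)\<close>, hence at most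
    \<open>exp (10 * x)\<close>, and \<open>2 ^ s\<close> is at least \<open>c * x\<close>. This
    explains \<open>c = 10 / ln (1 + \<delta>)\<close>.\<close>
  have B: "(6 * (1 + 8 * exp (2 * x))) powr (1 / 2 ^ s) \<le> 1 + \<delta>"
  proof -
    have "(2::real) ^ 8 \<le> exp 1 ^ 8" using two_le_exp_1 by (intro power_mono) auto
    hence e8: "256 \<le> exp (8::real)" by (simp add: exp_of_nat_mult[symmetric])
    have "1 \<le> exp (2 * x)" using large(1) by simp
    hence "6 + 48 * exp (2 * x) \<le> 256 * exp (2 * x)" by linarith
    hence "6 * (1 + 8 * exp (2 * x)) \<le> 256 * exp (2 * x)" by (simp only: distrib_left)
    also have "\<dots> \<le> exp 8 * exp (2 * x)" using e8 by (intro mult_right_mono) auto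
    also have "\<dots> \<le> exp (10 * x)" using large(1) by (simp add: exp_add[symmetric])
    finally have "(6 * (1 + 8 * exp (2 * x))) powr (1 / 2 ^ s) \<le> exp (10 * x) powr (1 / 2 ^ s)"
      by (intro powr_mono2) (auto intro: add_nonneg_nonneg)
    also have "\<dots> = exp (10 * x / 2 ^ s)" by (simp add: exp_powr_real)
    also have "\<dots> \<le> exp (ln (1 + \<delta>))"
    proof -
      have "10 * x = ln (1 + \<delta>) * (c * x)" using ln\<delta> by (simp add: c)
      also have "\<dots> \<le> ln (1 + \<delta>) * 2 ^ s" using m2(6) ln\<delta> by (intro mult_left_mono) auto
      finally show ?thesis by (simp add: pos_divide_le_eq)
    qed
    also have "\<dots> = 1 + \<delta>" using \<delta> by simp
    finally show ?thesis .
  qed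
  have "has_section d K \<epsilon> m1 (ball_2 m1) \<or> has_section d K \<epsilon> m2 (ball_inf m2)"
    by (rule convex_body_dichotomy[OF K d m2(3,4) \<delta> \<epsilon> _ m1(3,4,5) m2(5) B]) simp
  thus ?thesis using m1(1,2) m2(1,2) by blast
qed

text \<open>With \<open>x = sqrt (ln d)\<close> the required bound is \<open>ln x\<close>, up to
  \<open>C\<close>. The constant has two sources: \<open>ln (128 * c)\<close> is the loss of the
  cube case, and \<open>ln x0\<close> covers the dimensions below the threshold, where a line is
  taken.\<close>

lemma exists_section_constant:
  fixes \<epsilon> :: real
  assumes \<epsilon>: "0 < \<epsilon>"
  shows "\<exists>C>0. \<forall>d\<ge>1. \<forall>K. convex_body d K \<and> 0 \<in> Euclidean_space d interior_of K \<longrightarrow>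
    (\<exists>m\<ge>1. 1 / 2 * ln (ln (real d)) \<le> ln (ln (real m)) \<and> has_section d K \<epsilon> m (ball_2 m)) \<or>
    (\<exists>m\<ge>1. 1 / 2 * ln (ln (real d)) - C \<le> ln (ln (real m)) \<and> has_section d K \<epsilon> m (ball_inf m))"
proof -
  define \<delta> where "\<delta> = min (1 / 16) (\<epsilon> / 16)"
  have \<delta>: "0 < \<delta>" "\<delta> \<le> 1 / 8" "16 * \<delta> \<le> 1" "16 * \<delta> \<le> \<epsilon>" using \<epsilon> by (auto simp: \<delta>_def)
  have "16 * (\<epsilon> * \<delta>) \<le> \<epsilon>" using mult_left_mono[OF \<delta>(3), of \<epsilon>] \<epsilon> by (simp add: mult.left_commute)
  hence "4 * (\<epsilon> * \<delta>) + 7 * \<delta> < \<epsilon>" "3 * (\<epsilon> * \<delta>) + 4 * \<delta> < \<epsilon>" using \<delta> \<epsilon> by linarith+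
  hence \<epsilon>\<delta>: "1 + 3 * \<delta> < (1 + \<epsilon>) * (1 - 4 * \<delta>)" "1 + \<delta> < (1 + \<epsilon>) * (1 - 3 * \<delta>)"
    by (simp_all add: algebra_simps)
  define c where "c = 10 / ln (1 + \<delta>)"
  have c: "0 < c" using \<delta> by (simp add: c_def)
  define x0 where "x0 = Max {8, 1 / c, 128 * c, (2 / \<delta> + 3) * 16 / \<delta>\<^sup>2}"
  define C where "C = Max {1, ln x0, ln (128 * c)}"
  have C: "1 \<le> C" "ln x0 \<le> C" "ln (128 * c) \<le> C" unfolding C_def by (auto intro: Max_ge)
  show ?thesis
  proof (intro exI[of _ C] conjI allI impI)
    show "C > 0" using C(1) by simp
    fix d :: nat and K
    assume d: "1 \<le> d" and "convex_body d K \<and> 0 \<in> Euclidean_space d interior_of K"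
    hence K: "convex_body d K" "0 \<in> Euclidean_space d interior_of K" by auto
    define x where "x = sqrt (ln (real d))"
    have x: "0 \<le> x" "ln (real d) = x\<^sup>2" using d by (simp_all add: x_def)
    have lnln: "1 / 2 * ln (ln (real d)) = ln x" if "0 < x"
      using that by (simp add: x(2) ln_realpow)
    show "(\<exists>m\<ge>1. 1 / 2 * ln (ln (real d)) \<le> ln (ln (real m)) \<and> has_section d K \<epsilon> m (ball_2 m)) \<or>
      (\<exists>m\<ge>1. 1 / 2 * ln (ln (real d)) - C \<le> ln (ln (real m)) \<and> has_section d K \<epsilon> m (ball_inf m))"
    proof (cases "x0 \<le> x")
      case True
      have large: "8 \<le> x" "1 / c \<le> x" "128 * c \<le> x" "(2 / \<delta> + 3) * 16 / \<delta>\<^sup>2 \<le> x"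
        using True unfolding x0_def by (simp_all add: Max_le_iff)
      hence x0: "0 < x" by simp
      from has_section_large_dimension[OF K d \<delta>(1,2) \<epsilon>\<delta> c_def x_def large]
      show ?thesis
      proof (elim disjE exE conjE)
        fix m assume m: "1 \<le> m" "x \<le> ln (real m)" "has_section d K \<epsilon> m (ball_2 m)"
        have "ln x \<le> ln (ln (real m))" using m(2) x0 by (subst ln_le_cancel_iff) auto
        thus ?thesis using m(1,3) lnln[OF x0] by auto
      next
        fix m assume m: "1 \<le> m" "x / (128 * c) \<le> ln (real m)" "has_section d K \<epsilon> m (ball_inf m)"
        have pos: "0 < x / (128 * c)" using x0 c by simp
        have "ln x - ln (128 * c) = ln (x / (128 * c))" using x0 c by (subst ln_div) auto
        also have "\<dots> \<le> ln (ln (real m))" using m(2) pos by (subst ln_le_cancel_iff) auto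
        finally have "ln x - C \<le> ln (ln (real m))" using C(3) by simp
        thus ?thesis using m(1,3) lnln[OF x0] by auto
      qed
    next
      case False
      obtain p r where p: "sublinear p" "\<And>x. x \<in> coord_space d \<Longrightarrow> p x < 1 \<Longrightarrow> x \<in> K" "\<And>x. x \<in> K \<Longrightarrow> p x \<le> 1"
        "0 < r" "\<And>x i. i < d \<Longrightarrow> r * \<bar>x i\<bar> \<le> p x"
        using ex_gauge[OF K] by blast
      have "has_section d K \<epsilon> 1 (ball_inf 1)" by (rule has_section_line[OF p d \<epsilon>])
      moreover have "1 / 2 * ln (ln (real d)) - C \<le> ln (ln (real 1))"
      proof (cases "x = 0")
        \<comment> \<open>Here \<open>d = 1\<close>, and \<open>ln (ln 1) = ln 0 = 0\<close> on both
          sides.\<close>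
        case True
        thus ?thesis using x(2) C(1) by simp
      next
        case False
        hence "0 < x" using x(1) by simp
        moreover from this have "ln x \<le> ln x0" using \<open>\<not> x0 \<le> x\<close> by (subst ln_le_cancel_iff) auto
        ultimately show ?thesis using lnln C(2) by simp
      qed
      ultimately show ?thesis by blast
    qed
  qed
qed

theorem corollary1:
  shows "\<forall>\<epsilon>::real. \<epsilon> > 0 \<longrightarrow> (\<exists>C::real. C > 0 \<and>
    (\<forall>d::nat. \<forall>K. d \<ge> 1 \<and> convex_body d K \<and> 0 \<in> Euclidean_space d interior_of K \<longrightarrow>
      (\<exists>m::nat. \<exists>H. m \<ge> 1 \<and> subspace H \<and> H \<subseteq> coord_space d \<and> dim H = m \<and>
         section_dist m H K (ball_2 m) < 1 + \<epsilon> \<and>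
         ln (ln (real m)) \<ge> 1 / 2 * ln (ln (real d))) \<or>
      (\<exists>m::nat. \<exists>H. m \<ge> 1 \<and> subspace H \<and> H \<subseteq> coord_space d \<and> dim H = m \<and>
         section_dist m H K (ball_inf m) < 1 + \<epsilon> \<and>
         ln (ln (real m)) \<ge> 1 / 2 * ln (ln (real d)) - C)))"
proof (intro allI impI, goal_cases)
  case (1 \<epsilon>)
  obtain C where "0 < C" and C: "\<forall>d\<ge>1. \<forall>K. convex_body d K \<and> 0 \<in> Euclidean_space d interior_of K \<longrightarrow>
    (\<exists>m\<ge>1. 1 / 2 * ln (ln (real d)) \<le> ln (ln (real m)) \<and> has_section d K \<epsilon> m (ball_2 m)) \<or>
    (\<exists>m\<ge>1. 1 / 2 * ln (ln (real d)) - C \<le> ln (ln (real m)) \<and> has_section d K \<epsilon> m (ball_inf m))"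
    using exists_section_constant[OF 1] by (elim exE conjE) (rule that)
  show ?case
  proof (intro exI[of _ C] conjI allI impI, rule \<open>0 < C\<close>, elim conjE, goal_cases)
    case (1 d K)
    hence "(\<exists>m\<ge>1. 1 / 2 * ln (ln (real d)) \<le> ln (ln (real m)) \<and> has_section d K \<epsilon> m (ball_2 m)) \<or>
      (\<exists>m\<ge>1. 1 / 2 * ln (ln (real d)) - C \<le> ln (ln (real m)) \<and> has_section d K \<epsilon> m (ball_inf m))"
      using C by simp
    thus ?case unfolding has_section_def by blast
  qed
qed

end
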